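(* Let $\alpha\in(0,1)$ and $\beta^*\in\{\beta\in\mathbb R^d:\|\beta\|_2\le1\}$, and let $E$ be a univariate distribution with $\mathbb P_{Z\sim E}(Z=0)\ge\alpha$. For any $\epsilon\in(0,1)$, there is an SQ algorithm that takes $\alpha,\epsilon$ as input, makes $\mathrm{poly}(d)$ queries to $\mathrm{VSTAT}\big(\frac{d}{\epsilon\alpha^2}\big)$ on $P_{\beta^*,E}$, and computes an estimate $\widehat\beta\in\mathbb R^d$ with $\|\widehat\beta-\beta^*\|_2\lesssim\epsilon\alpha$.
   Context: $P_{\beta,E}$: distribution of $(x,y)$ with $x\sim\mathcal N(0,I_d)$, $y=x^\top\beta+Z$, $Z\sim E$ independent of $x$. $\mathrm{VSTAT}(m)$ oracle for a distribution $D$: given $f:\mathbb R^d\times\mathbb R\to[0,1]$, returns any $u$ with $|u-\mathbb E_D[f]|\le\max\{1/m,\sqrt{\mathbb E_D[f](1-\mathbb E_D[f])/m}\}$; an SQ algorithm accesses the distribution only through such queries and must succeed for every valid oracle. $\lesssim$ hides an absolute constant. *)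

theory Defs
  imports
    "HOL-Probability.Probability"
    "HOL-Computational_Algebra.Polynomial"
begin

text \<open>
  Since the constants in the theorem do not depend on the dimension \<open>d\<close>, vectors in \<open>\<real>\<^sup>d\<close> are
  represented as functions \<open>nat \<Rightarrow> real\<close> of which only the coordinates \<open>i < d\<close> matter.
\<close>

definition lr_space :: "nat \<Rightarrow> ((nat \<Rightarrow> real) \<times> real) measure" where
  "lr_space d = (\<Pi>\<^sub>M i\<in>{..<d}. borel) \<Otimes>\<^sub>M borel"

definition lr_dist :: "nat \<Rightarrow> (nat \<Rightarrow> real) \<Rightarrow> real measure \<Rightarrow> ((nat \<Rightarrow> real) \<times> real) measure" where
  "lr_dist d \<beta> E =
     distr ((\<Pi>\<^sub>M i\<in>{..<d}. std_normal_distribution) \<Otimes>\<^sub>M E) (lr_space d)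
       (\<lambda>(x, z). (x, (\<Sum>i<d. x i * \<beta> i) + z))"

text \<open>
  A deterministic adaptive statistical query algorithm is a well-founded decision tree: it either
  stops with an output or asks a query and continues depending on the real-valued answer.
\<close>

datatype ('a, 'b) sq_alg =
    Return 'b
  | Query "'a \<Rightarrow> real" "real \<Rightarrow> ('a, 'b) sq_alg"

primrec sq_admissible :: "'a measure \<Rightarrow> ('a, 'b) sq_alg \<Rightarrow> bool" where
  "sq_admissible M (Return b) \<longleftrightarrow> True"
| "sq_admissible M (Query f k) \<longleftrightarrow>
     f \<in> borel_measurable M \<and> (\<forall>x\<in>space M. f x \<in> {0..1}) \<and> (\<forall>u. sq_admissible M (k u))"

definition vstat_answer :: "real \<Rightarrow> 'a measure \<Rightarrow> ('a \<Rightarrow> real) \<Rightarrow> real \<Rightarrow> bool" where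
  "vstat_answer m D f u \<longleftrightarrow>
     (let p = integral\<^sup>L D f in \<bar>u - p\<bar> \<le> max (1 / m) (sqrt (p * (1 - p) / m)))"

text \<open>
  \<open>vstat_run m D A n b\<close>: some sequence of valid answers of the oracle leads \<open>A\<close> to output \<open>b\<close> after
  \<open>n\<close> queries. Quantifying over all runs covers every valid oracle, including oracles whose answers
  depend on the history of the interaction.
\<close>

inductive vstat_run :: "real \<Rightarrow> 'a measure \<Rightarrow> ('a, 'b) sq_alg \<Rightarrow> nat \<Rightarrow> 'b \<Rightarrow> bool"
  for m :: real and D :: "'a measure" where
  return: "vstat_run m D (Return b) 0 b"
| query: "vstat_answer m D f u \<Longrightarrow> vstat_run m D (k u) n b \<Longrightarrow> vstat_run m D (Query f k) (Suc n) b"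

text \<open>Runs always exist, so a property required of all runs is never vacuous.\<close>

lemma vstat_run_exists:
  assumes "m \<ge> 0"
  shows "\<exists>n b. vstat_run m D A n b"
proof (induction A)
  case (Return b)
  show ?case by (blast intro: vstat_run.return)
next
  case (Query f k)
  have "vstat_answer m D f (integral\<^sup>L D f)"
    using assms by (simp add: vstat_answer_def Let_def le_max_iff_disj)
  moreover obtain n b where "vstat_run m D (k (integral\<^sup>L D f)) n b"
    using Query.IH by blast
  ultimately show ?case by (blast intro: vstat_run.query)
qed

end

theory Submission
  imports Defs
begin

text \<open>
  The estimate is refined in eight rounds, each shrinking the error radius \<open>r\<close> around the current
  centre \<open>c\<close> by a factor of order \<open>(\<epsilon>\<alpha>)\<^bsup>1/8\<^esup>\<close>. Write \<open>v = y - x\<cdot>c = x\<cdot>\<delta> + Z\<close> with \<open>\<delta> = \<beta> - c\<close>. By Stein's identity,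
  \<open>E[(u\<cdot>x) w(x) tanh(v/R)]\<close> is exactly proportional to \<open>u\<cdot>\<delta>\<close> with the measurable factor
  \<open>E[w(x) bell(v/R)] / R\<close>, where \<open>bell = tanh'\<close> and \<open>w\<close> is a Gaussian weight that makes the query bounded.

  A round has two steps. The coarse step uses \<open>R = r/\<surd>(\<epsilon>\<alpha>)\<close>: it gives a radius \<open>r\<^sub>1\<close> and at the same time
  certifies that the noise puts mass at most a small multiple of \<open>\<alpha>/r\<^sub>1\<close> per unit length at scale \<open>R\<close>. The
  fine step uses the redescending function \<open>tanh(v/R\<^sub>1) - tanh(v/R)\<close> with \<open>R\<^sub>1\<close> of order \<open>r\<^sub>1\<close>. Since the
  atom of the noise contributes about \<open>\<alpha>\<close> at scale \<open>R\<^sub>1\<close>, the proportionality factor stays positive, while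
  the queries decay exponentially for \<open>|v|\<close> beyond \<open>R\<close> and hence have small expectation, where the oracle is more accurate.

  For \<open>\<epsilon>\<close> close to 1 the constants in the certificate matter. They are won in high dimension by querying
  sign vectors on windows of coordinates as well, and in bounded dimension by a weight \<open>w\<close> concentrated
  near \<open>x = 0\<close>, which makes the atom contribute a much larger density.
\<close>

subsection \<open>The function bell\<close>

text \<open>Put P = \<open>soft_mass E R\<close> and h = (\<epsilon> \<alpha>)^(1/8). P can be
  anything in [\<alpha>, 1], and the two steps react to it in opposite ways. The tanh queries of the
  coarse step do not decay, so their noise, summed over the d directions, is of order \<alpha> sqrt
  \<epsilon> whatever P is; dividing by the slope P / R gives a radius \<open>r\<^sub>1\<close> of
  order R \<alpha> sqrt \<epsilon> / P, so large P helps. The fine queries have expectation O(P),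
  hence noise of order \<alpha> sqrt (\<epsilon> P), and a slope of order at least \<alpha> /
  \<open>r\<^sub>1\<close>; the error is of order \<open>r\<^sub>1\<close> sqrt (\<epsilon> P), so
  large P hurts. With R = r / h^4 the certificate balances both: either \<open>r\<^sub>1\<close> is
  below h^2 r already, or \<epsilon> P = O(h^2). Each round thus gains O(h), and eight rounds give
  O(h^8) = O(\<epsilon> \<alpha>). If h is not small, \<epsilon> \<alpha> is bounded below and the
  output 0 is good enough. The slope has to be positive for every \<epsilon> < 1, where sqrt
  \<epsilon> absorbs no constant. This is the origin of the condition 65536000 \<mu> \<le> \<kappa>,
  with narrow scale \<mu> \<open>r\<^sub>1\<close> and \<kappa> the gain obtained from additional
  directions.\<close>

definition bell :: "real \<Rightarrow> real" where "bell t = 1 - (tanh t)\<^sup>2"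

lemma bell_eq: "bell t = 1 / (cosh t)\<^sup>2"
proof -
  have "(cosh t)\<^sup>2 - (sinh t)\<^sup>2 = 1" by (simp add: cosh_square_eq)
  moreover have "(cosh t)\<^sup>2 > 0" by simp
  ultimately show ?thesis by (simp add: bell_def tanh_def power_divide diff_divide_eq_iff)
qed

lemma bell_pos: "0 < bell t"
  by (simp add: bell_eq)

lemma bell_nonneg: "0 \<le> bell t"
  by (rule less_imp_le[OF bell_pos])

lemma bell_le_1: "bell t \<le> 1"
  by (simp add: bell_def)

lemma bell_0 [simp]: "bell 0 = 1" by (simp add: bell_def)

lemma bell_minus [simp]: "bell (- t) = bell t" by (simp add: bell_eq)

lemma measurable_bell [measurable]: "bell \<in> borel_measurable borel"
  unfolding bell_eq[abs_def] by (intro borel_measurable_continuous_onI continuous_intros) auto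
lemma measurable_tanh [measurable]: "(tanh :: real \<Rightarrow> real) \<in> borel_measurable borel"
  by (intro borel_measurable_continuous_onI continuous_intros) auto

lemma cosh_add_le: "cosh (s + t) \<le> cosh s * exp \<bar>t\<bar>" for s t :: real
proof -
  have "sinh s * sinh t \<le> cosh s * \<bar>sinh t\<bar>"
  proof -
    have "\<bar>sinh s\<bar> \<le> cosh s" by (rule abs_le_square_iff[THEN iffD2, of "sinh s" "cosh s", simplified]) (simp add: cosh_square_eq)
    then have "\<bar>sinh s * sinh t\<bar> \<le> cosh s * \<bar>sinh t\<bar>" by (simp add: abs_mult mult_right_mono)
    then show ?thesis by linarith
  qed
  then have "cosh (s + t) \<le> cosh s * (cosh \<bar>t\<bar> + sinh \<bar>t\<bar>)" by (simp add: cosh_add algebra_simps)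
  then show ?thesis by (simp only: cosh_plus_sinh)
qed

text \<open>A Harnack-type bound: the tails of \<open>bell\<close> are exponential, so a shift by t
  costs at most a factor exp (2 |t|). It is what later replaces x\<cdot>\<delta> + Z by Z alone
  without any assumption on the noise.\<close>

lemma bell_add_ge: "bell s * exp (- (2 * \<bar>t\<bar>)) \<le> bell (s + t)"
proof -
  have "(cosh (s + t))\<^sup>2 \<le> (cosh s * exp \<bar>t\<bar>)\<^sup>2"
    by (rule power_mono[OF cosh_add_le]) simp
  also have "\<dots> = (cosh s)\<^sup>2 * exp (2 * \<bar>t\<bar>)" by (simp add: power_mult_distrib exp_double)
  finally have "(cosh (s + t))\<^sup>2 \<le> (cosh s)\<^sup>2 * exp (2 * \<bar>t\<bar>)" .
  moreover have "0 < (cosh (s + t))\<^sup>2" "0 < (cosh s)\<^sup>2" by simp_all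
  ultimately show ?thesis by (simp add: bell_eq exp_minus field_simps)
qed

lemma bell_add_le: "bell (t + s) \<le> exp (2 * \<bar>t\<bar>) * bell s"
  using bell_add_ge[of "s + t" "- t"] by (simp add: exp_minus field_simps)

lemma abs_tanh_le: "\<bar>tanh t\<bar> \<le> \<bar>t\<bar>" for t :: real
proof -
  have "tanh x \<le> x" if "0 \<le> x" for x :: real
  proof -
    have "(\<lambda>x. x - tanh x) 0 \<le> (\<lambda>x. x - tanh x) x"
    proof (rule DERIV_nonneg_imp_nondecreasing[OF that])
      show "\<exists>y. ((\<lambda>x. x - tanh x) has_real_derivative y) (at z) \<and> 0 \<le> y" for z :: real
        by (rule exI[of _ "(tanh z)\<^sup>2"]) (auto intro!: derivative_eq_intros)
    qed
    then show ?thesis by simp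
  qed
  from this[of "\<bar>t\<bar>"] show ?thesis by simp
qed

lemma bell_ge: "1 - t\<^sup>2 \<le> bell t"
  using abs_tanh_le[of t] by (simp add: bell_def abs_le_square_iff)

lemma bell_divide_mono:
  assumes "0 < a" "a \<le> b" shows "bell (v / a) \<le> bell (v / b)"
proof -
  have "\<bar>v / b\<bar> \<le> \<bar>v / a\<bar>" using assms by (auto simp: abs_mult divide_left_mono)
  then have "tanh \<bar>v / b\<bar> \<le> tanh \<bar>v / a\<bar>" by (simp only: tanh_real_le_iff)
  then have "\<bar>tanh (v / b)\<bar> \<le> \<bar>tanh (v / a)\<bar>" by (simp only: tanh_real_abs)
  then show ?thesis by (simp add: bell_def abs_le_square_iff)
qed

text \<open>For v \<ge> 0 the difference is at most 1 - tanh (v / b), which is below 1 - tanh^2 (v /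
  b). Subtracting the two scales therefore makes the fine query small wherever \<open>bell\<close>
  is small at the wide scale, so its expectation is governed by the noise mass there.\<close>

lemma tanh_diff_le_bell:
  assumes "0 < a" "a \<le> b" shows "\<bar>tanh (v / a) - tanh (v / b)\<bar> \<le> bell (v / b)"
proof -
  have *: "\<bar>tanh (x / a) - tanh (x / b)\<bar> \<le> bell (x / b)" if "0 \<le> x" for x
  proof -
    have "x / b \<le> x / a" using assms that by (auto intro: divide_left_mono)
    then have 1: "tanh (x / b) \<le> tanh (x / a)" by simp
    have 2: "0 \<le> tanh (x / b)" using assms that by simp
    have 3: "tanh (x / b) < 1" "tanh (x / a) < 1" by (rule tanh_real_lt_1)+
    have "(1 - tanh (x / b)) * 1 \<le> (1 - tanh (x / b)) * (1 + tanh (x / b))"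
      using 2 3 by (intro mult_left_mono) auto
    then show ?thesis using 1 2 3 by (simp add: bell_def power2_eq_square algebra_simps)
  qed
  show ?thesis
  proof (cases "0 \<le> v")
    case False
    then show ?thesis using *[of "- v"] by (simp add: abs_minus_commute)
  qed (use * in auto)
qed

lemma DERIV_tanh_bell: "(tanh has_real_derivative bell t) (at t)"
  unfolding bell_def by (auto intro!: derivative_eq_intros)

lemma abs_tanh_le_1: "\<bar>tanh t\<bar> \<le> 1" for t :: real
  using tanh_real_lt_1[of t] tanh_real_gt_neg1[of t] by linarith

lemma abs_mult_exp_le_1: "\<bar>x\<bar> * exp (- x\<^sup>2 / 2) \<le> 1" for x :: real
proof -
  have "\<bar>x\<bar> \<le> 1 + x\<^sup>2 / 2" using sum_squares_bound[of "\<bar>x\<bar>" 1] by simp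
  also have "\<dots> \<le> exp (x\<^sup>2 / 2)" by (rule exp_ge_add_one_self)
  finally show ?thesis by (simp add: exp_minus field_simps)
qed

subsection \<open>Gaussian vectors\<close>

definition ip :: "nat \<Rightarrow> (nat \<Rightarrow> real) \<Rightarrow> (nat \<Rightarrow> real) \<Rightarrow> real" where
  "ip d x y = (\<Sum>i<d. x i * y i)"

abbreviation gauss :: "nat \<Rightarrow> (nat \<Rightarrow> real) measure" where
  "gauss d \<equiv> \<Pi>\<^sub>M i\<in>{..<d}. std_normal_distribution"

lemma ip_commute: "ip d x y = ip d y x"
  by (simp add: ip_def mult.commute)

lemma ip_scale: "ip d x (\<lambda>i. c * y i) = c * ip d x y"
  by (simp add: ip_def sum_distrib_left mult.left_commute)

lemma ip_diff_right: "ip d x (\<lambda>i. y i - z i) = ip d x y - ip d x z"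
  by (simp add: ip_def algebra_simps sum_subtractf)

lemma abs_ip_le: "\<bar>ip d x y\<bar> \<le> L2_set x {..<d} * L2_set y {..<d}"
  unfolding ip_def
  by (rule order_trans[OF sum_abs]) (simp add: abs_mult L2_set_mult_ineq)

lemma ip_self: "ip d x x = (L2_set x {..<d})\<^sup>2"
  by (simp add: ip_def L2_set_def power2_eq_square[symmetric] sum_nonneg)

lemma ip_fun_upd:
  assumes "i < d"
  shows "ip d (x(i := t)) y = ip d (x(i := 0)) y + t * y i"
proof -
  have eq: "(\<Sum>j\<in>{..<d} - {i}. (x(i := t)) j * y j) = (\<Sum>j\<in>{..<d} - {i}. (x(i := 0)) j * y j)"
    by (rule sum.cong) auto
  show ?thesis
    using assms unfolding ip_def by (simp add: sum.remove[of "{..<d}" i] eq)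
qed

lemma sets_gauss [measurable_cong]: "sets (gauss d) = sets (\<Pi>\<^sub>M i\<in>{..<d}. borel)"
  by (rule sets_PiM_cong) auto

interpretation std_normal: real_distribution std_normal_distribution
  by (rule real_dist_normal_dist)

interpretation std_normal_prod: product_prob_space "\<lambda>i::nat. std_normal_distribution" I for I
  by unfold_locales

lemma prob_space_gauss: "prob_space (gauss d)"
  by (rule prob_space_PiM) (rule std_normal.prob_space_axioms)

lemma measurable_coord [measurable]:
  "i < d \<Longrightarrow> (\<lambda>x. x i) \<in> borel_measurable (\<Pi>\<^sub>M i\<in>{..<d}. (borel :: real measure))"
  by (rule measurable_component_singleton) auto

lemma measurable_ip [measurable]: "(\<lambda>x. ip d x y) \<in> borel_measurable (\<Pi>\<^sub>M i\<in>{..<d}. borel)"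
  unfolding ip_def by measurable

lemma gauss_integrable_bounded:
  fixes f :: "(nat \<Rightarrow> real) \<Rightarrow> real"
  assumes "f \<in> borel_measurable (\<Pi>\<^sub>M i\<in>{..<d}. borel)" "\<And>x. \<bar>f x\<bar> \<le> K"
  shows "integrable (gauss d) f"
proof -
  show ?thesis
  proof (rule finite_measure.integrable_const_bound[OF prob_space.finite_measure[OF prob_space_gauss]])
    show "AE x in gauss d. norm (f x) \<le> K" using assms(2) by simp
    show "f \<in> borel_measurable (gauss d)" using assms(1) by (simp add: measurable_cong_sets[OF sets_gauss refl])
  qed
qed

lemma std_normal_mgf:
  "integrable std_normal_distribution (\<lambda>x. exp (t * x))"
  "(\<integral>x. exp (t * x) \<partial>std_normal_distribution) = exp (t\<^sup>2 / 2)"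
proof -
  have eq: "std_normal_density x * exp (t * x) = exp (t\<^sup>2 / 2) * normal_density t 1 x" for x
  proof -
    have "- x\<^sup>2 / 2 + t * x = t\<^sup>2 / 2 + - (x - t)\<^sup>2 / 2" by (simp add: power2_eq_square field_simps)
    then have "exp (- x\<^sup>2 / 2) * exp (t * x) = exp (t\<^sup>2 / 2) * exp (- (x - t)\<^sup>2 / 2)"
      by (simp only: exp_add[symmetric])
    then show ?thesis by (simp add: normal_density_def mult_ac)
  qed
  show "integrable std_normal_distribution (\<lambda>x. exp (t * x))"
    by (subst integrable_density) (auto simp: eq)
  show "(\<integral>x. exp (t * x) \<partial>std_normal_distribution) = exp (t\<^sup>2 / 2)"
    by (subst integral_density) (auto simp: eq)
qed

lemma gauss_mgf:
  "integrable (gauss d) (\<lambda>x. exp (ip d x a))"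
  "(\<integral>x. exp (ip d x a) \<partial>gauss d) = exp ((L2_set a {..<d})\<^sup>2 / 2)"
proof -
  have eq: "exp (ip d x a) = (\<Prod>i<d. exp (a i * x i))" for x
    by (simp add: ip_def exp_sum mult.commute)
  show "integrable (gauss d) (\<lambda>x. exp (ip d x a))"
    unfolding eq by (rule std_normal_prod.product_integrable_prod) (auto intro: std_normal_mgf)
  have "(\<integral>x. exp (ip d x a) \<partial>gauss d) = (\<Prod>i<d. exp ((a i)\<^sup>2 / 2))"
    unfolding eq by (subst std_normal_prod.product_integral_prod) (auto simp: std_normal_mgf)
  also have "\<dots> = exp ((\<Sum>i<d. (a i)\<^sup>2) / 2)"
    by (simp add: exp_sum sum_divide_distrib)
  also have "(\<Sum>i<d. (a i)\<^sup>2) = (L2_set a {..<d})\<^sup>2"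
    by (simp add: L2_set_def sum_nonneg)
  finally show "(\<integral>x. exp (ip d x a) \<partial>gauss d) = exp ((L2_set a {..<d})\<^sup>2 / 2)" .
qed

lemma gauss_exp_abs:
  shows "integrable (gauss d) (\<lambda>x. exp (c * \<bar>ip d x a\<bar>))"
    and "(\<integral>x. exp (c * \<bar>ip d x a\<bar>) \<partial>gauss d) \<le> 2 * exp (c\<^sup>2 * (L2_set a {..<d})\<^sup>2 / 2)"
proof -
  have L: "(L2_set (\<lambda>i. c * a i) {..<d})\<^sup>2 = c\<^sup>2 * (L2_set a {..<d})\<^sup>2" for c
    by (simp add: L2_set_def sum_nonneg power_mult_distrib sum_distrib_left)
  have I: "integrable (gauss d) (\<lambda>x. exp (c * ip d x a))"
    "(\<integral>x. exp (c * ip d x a) \<partial>gauss d) = exp (c\<^sup>2 * (L2_set a {..<d})\<^sup>2 / 2)" for c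
    using gauss_mgf[of d "\<lambda>i. c * a i"] by (simp_all add: ip_scale L)
  have le: "exp (c * \<bar>t\<bar>) \<le> exp (c * t) + exp ((- c) * t)" for t :: real
    by (cases "t \<ge> 0") auto
  have I2: "integrable (gauss d) (\<lambda>x. exp (c * ip d x a) + exp ((- c) * ip d x a))"
    by (intro Bochner_Integration.integrable_add I)
  show I3: "integrable (gauss d) (\<lambda>x. exp (c * \<bar>ip d x a\<bar>))"
    by (rule Bochner_Integration.integrable_bound[OF I2])
      (use le in \<open>auto simp: abs_of_pos add_pos_pos\<close>)
  have "(\<integral>x. exp (c * \<bar>ip d x a\<bar>) \<partial>gauss d) \<le> (\<integral>x. exp (c * ip d x a) + exp ((- c) * ip d x a) \<partial>gauss d)"
    by (rule integral_mono[OF I3 I2]) (use le in auto)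
  also have "\<dots> = exp (c\<^sup>2 * (L2_set a {..<d})\<^sup>2 / 2) + exp ((- c)\<^sup>2 * (L2_set a {..<d})\<^sup>2 / 2)"
    by (subst Bochner_Integration.integral_add) (intro I, intro I, simp only: I)
  finally show "(\<integral>x. exp (c * \<bar>ip d x a\<bar>) \<partial>gauss d) \<le> 2 * exp (c\<^sup>2 * (L2_set a {..<d})\<^sup>2 / 2)"
    by simp
qed

text \<open>The inequality t^2 \<le> 2 (cosh t - 1) reduces the moment to the moment generating
  function. The bound is |a|^2 to leading order, which suffices for small a.\<close>

lemma gauss_second_moment:
  shows "integrable (gauss d) (\<lambda>x. (ip d x a)\<^sup>2)"
    and "(\<integral>x. (ip d x a)\<^sup>2 \<partial>gauss d) \<le> 2 * (exp ((L2_set a {..<d})\<^sup>2 / 2) - 1)"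
proof -
  have le: "t\<^sup>2 \<le> exp t + exp (- t) - 2" for t :: real
  proof -
    have "t\<^sup>2 / 2 \<le> cosh t - 1"
    proof -
      have "\<bar>t / 2\<bar> \<le> \<bar>sinh (t / 2)\<bar>"
      proof -
        have "x \<le> sinh x" if "0 \<le> x" for x :: real
        proof -
          have "(\<lambda>x. sinh x - x) 0 \<le> (\<lambda>x. sinh x - x) x"
          proof (rule DERIV_nonneg_imp_nondecreasing[OF that])
            show "\<exists>y. ((\<lambda>x. sinh x - x) has_real_derivative y) (at z) \<and> 0 \<le> y" for z :: real
              by (rule exI[of _ "cosh z - 1"]) (auto intro!: derivative_eq_intros simp: cosh_real_ge_1)
          qed
          then show ?thesis by simp
        qed
        from this[of "\<bar>t / 2\<bar>"] show ?thesis by (simp only: sinh_real_abs abs_ge_zero)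
      qed
      then have "(t / 2)\<^sup>2 \<le> (sinh (t / 2))\<^sup>2" by (simp only: abs_le_square_iff)
      moreover have "cosh t = 1 + 2 * (sinh (t / 2))\<^sup>2"
        using cosh_double[of "t / 2"] by (simp add: cosh_square_eq)
      ultimately show ?thesis by (simp add: power_divide)
    qed
    then show ?thesis by (simp add: cosh_field_def field_simps)
  qed
  have L: "(L2_set (\<lambda>i. - a i) {..<d})\<^sup>2 = (L2_set a {..<d})\<^sup>2"
    by (simp add: L2_set_def)
  have J: "ip d x (\<lambda>i. - a i) = - ip d x a" for x
    using ip_scale[of d x "-1" a] by simp
  have I2: "integrable (gauss d) (\<lambda>x. exp (ip d x a) + exp (- ip d x a) - 2)"
    using gauss_mgf(1)[of d a] gauss_mgf(1)[of d "\<lambda>i. - a i"] by (simp add: J)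
  show I3: "integrable (gauss d) (\<lambda>x. (ip d x a)\<^sup>2)"
  proof (rule Bochner_Integration.integrable_bound[OF I2])
    show "AE x in gauss d. norm ((ip d x a)\<^sup>2) \<le> norm (exp (ip d x a) + exp (- ip d x a) - 2)"
      using le by (intro AE_I2) (auto intro: order_trans[OF _ abs_ge_self])
  qed simp
  have "(\<integral>x. (ip d x a)\<^sup>2 \<partial>gauss d) \<le> (\<integral>x. exp (ip d x a) + exp (- ip d x a) - 2 \<partial>gauss d)"
    by (rule integral_mono[OF I3 I2]) (use le in auto)
  also have "\<dots> = 2 * (exp ((L2_set a {..<d})\<^sup>2 / 2) - 1)"
    using gauss_mgf[of d a] gauss_mgf[of d "\<lambda>i. - a i"] by (simp add: J L prob_space.prob_space[OF prob_space_gauss])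
  finally show "(\<integral>x. (ip d x a)\<^sup>2 \<partial>gauss d) \<le> 2 * (exp ((L2_set a {..<d})\<^sup>2 / 2) - 1)" .
qed

text \<open>Integration by parts: the density satisfies \<phi>' = - t \<phi>, so \<open>?G\<close> =
  - \<phi> F has derivative \<phi> (t F - F'), and its total increment over the line is 0 because F
  is bounded and \<phi> vanishes at both ends.\<close>

lemma std_normal_stein:
  fixes F F' :: "real \<Rightarrow> real"
  assumes F: "\<And>t. (F has_real_derivative F' t) (at t)"
    and cont: "\<And>t. isCont F' t"
    and bound: "\<And>t. \<bar>F t\<bar> \<le> K" "\<And>t. \<bar>F' t\<bar> \<le> K"
  shows "(\<integral>t. t * F t \<partial>std_normal_distribution) = (\<integral>t. F' t \<partial>std_normal_distribution)"
proof -
  let ?\<phi> = std_normal_density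
  let ?G = "\<lambda>t. - (?\<phi> t * F t)"
  let ?g = "\<lambda>t. ?\<phi> t * (t * F t) - ?\<phi> t * F' t"
  have contF: "isCont F t" for t using F DERIV_isCont by blast
  have mF [measurable]: "F \<in> borel_measurable borel" "F' \<in> borel_measurable borel"
    using contF cont by (auto intro!: borel_measurable_continuous_onI continuous_at_imp_continuous_on)
  have phi': "(?\<phi> has_real_derivative (- t * ?\<phi> t)) (at t)" for t
    unfolding std_normal_density_def by (auto intro!: derivative_eq_intros simp: real_div_sqrt field_simps)
  have dG: "(?G has_real_derivative ?g t) (at t)" for t
    by (rule derivative_eq_intros phi' F refl)+ (simp add: algebra_simps)
  have contphi: "isCont ?\<phi> t" for t using phi' DERIV_isCont by blast
  have contg: "isCont ?g t" for t
    by (intro continuous_intros contphi contF cont)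
  have int1: "integrable std_normal_distribution (\<lambda>t. t * F t)"
  proof (rule Bochner_Integration.integrable_bound[of _ "\<lambda>t. K * t"])
    show "integrable std_normal_distribution (\<lambda>t. K * t)"
      using integrable_std_normal_distribution_moment[of 1] by simp
    show "AE t in std_normal_distribution. norm (t * F t) \<le> norm (K * t)"
    proof (rule AE_I2)
      fix t have "\<bar>F t\<bar> \<le> \<bar>K\<bar>" using bound(1)[of t] by linarith
      then show "norm (t * F t) \<le> norm (K * t)" by (simp add: abs_mult mult.commute[of "\<bar>K\<bar>"] mult_left_mono)
    qed
  qed simp
  have int2: "integrable std_normal_distribution F'"
    by (rule std_normal.integrable_const_bound[of _ K]) (use bound in auto)
  have i1: "integrable lborel (\<lambda>t. ?\<phi> t * (t * F t))" and i2: "integrable lborel (\<lambda>t. ?\<phi> t * F' t)"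
    using int1 int2 by (auto simp: integrable_density)
  have lim0: "((\<lambda>t. ?\<phi> t) \<longlongrightarrow> 0) at_top" "((\<lambda>t. ?\<phi> t) \<longlongrightarrow> 0) at_bot"
  proof -
    have *: "?\<phi> t \<le> 1 / \<bar>t\<bar>" if "t \<noteq> 0" for t
    proof -
      have "1 \<le> sqrt (2 * pi)" using pi_gt3 by (simp add: real_le_rsqrt)
      then have "?\<phi> t \<le> exp (- t\<^sup>2 / 2)" by (simp add: std_normal_density_def divide_le_eq)
      also have "\<dots> \<le> 1 / \<bar>t\<bar>" using abs_mult_exp_le_1[of t] that by (simp add: field_simps)
      finally show ?thesis .
    qed
    show "((\<lambda>t. ?\<phi> t) \<longlongrightarrow> 0) at_top"
    proof (rule tendsto_sandwich[where f = "\<lambda>_. 0" and h = "\<lambda>t. 1 / t"])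
      show "eventually (\<lambda>t. ?\<phi> t \<le> 1 / t) at_top"
        using eventually_gt_at_top[of 0]
      proof eventually_elim
        case (elim t)
        then show ?case using *[of t] by simp
      qed
      show "((\<lambda>t::real. 1 / t) \<longlongrightarrow> 0) at_top"
        by (rule tendsto_divide_0[OF tendsto_const filterlim_at_top_imp_at_infinity[OF filterlim_ident]])
    qed auto
    then have "((\<lambda>t. ?\<phi> (- t)) \<longlongrightarrow> 0) at_bot"
      by (simp add: filterlim_at_bot_mirror)
    then show "((\<lambda>t. ?\<phi> t) \<longlongrightarrow> 0) at_bot"
      by (simp add: std_normal_density_def)
  qed
  have limG: "(?G \<longlongrightarrow> 0) X" if "(?\<phi> \<longlongrightarrow> 0) X" for X
  proof (rule tendsto_0_le[OF that, of _ K])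
    show "eventually (\<lambda>t. norm (?G t) \<le> norm (?\<phi> t) * K) X"
      using bound(1) by (intro always_eventually) (auto simp: abs_mult mult_left_mono)
  qed
  have "(LBINT t=-\<infinity>..\<infinity>. ?g t) = 0 - 0"
  proof (rule interval_integral_FTC_integrable[where F = ?G])
    show "(?G has_vector_derivative ?g t) (at t)" for t
      using dG by (simp add: has_real_derivative_iff_has_vector_derivative)
    show "set_integrable lborel (einterval (-\<infinity>) \<infinity>) ?g"
      unfolding set_integrable_def using i1 i2 by simp
    show "((?G \<circ> real_of_ereal) \<longlongrightarrow> 0) (at_right (-\<infinity>))" "((?G \<circ> real_of_ereal) \<longlongrightarrow> 0) (at_left \<infinity>)"
      by (simp_all only: ereal_tendsto_simps) (intro limG lim0)+
  qed (use contg in auto)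
  then have "(\<integral>t. ?g t \<partial>lborel) = 0"
    by (simp add: interval_integral_to_infinity_eq interval_lebesgue_integral_def set_lebesgue_integral_def)
  then have "(\<integral>t. ?\<phi> t * (t * F t) \<partial>lborel) = (\<integral>t. ?\<phi> t * F' t \<partial>lborel)"
    using i1 i2 by simp
  then show ?thesis by (simp add: integral_density)
qed

lemma gauss_integrable_coord_mult:
  fixes G :: "(nat \<Rightarrow> real) \<Rightarrow> real"
  assumes i: "i < d" and [measurable]: "G \<in> borel_measurable (\<Pi>\<^sub>M i\<in>{..<d}. borel)"
    and bound: "\<And>x. \<bar>G x\<bar> \<le> K"
  shows "integrable (gauss d) (\<lambda>x. x i * G x)"
proof -
  let ?e = "\<lambda>j. if j = i then 1 else 0 :: real"
  have e: "ip d x ?e = x i" for x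
    using i by (simp add: ip_def if_distrib[where f = "\<lambda>c. _ * c"] cong: if_cong)
  have *: "integrable (gauss d) (\<lambda>x. K * (1 + (x i)\<^sup>2))"
    using gauss_second_moment(1)[of d ?e] unfolding e by simp
  show ?thesis
  proof (rule Bochner_Integration.integrable_bound[OF *])
    show "AE x in gauss d. norm (x i * G x) \<le> norm (K * (1 + (x i)\<^sup>2))"
    proof (rule AE_I2)
      fix x :: "nat \<Rightarrow> real"
      have "\<bar>x i\<bar> \<le> 1 + (x i)\<^sup>2" using sum_squares_bound[of "\<bar>x i\<bar>" 1] abs_ge_zero[of "x i"] zero_le_power2[of "x i"]
        by (simp del: abs_ge_zero zero_le_power2)
      moreover have "0 \<le> K" using bound[of x] by linarith
      ultimately have "\<bar>x i\<bar> * \<bar>G x\<bar> \<le> (1 + (x i)\<^sup>2) * K" using bound[of x] by (intro mult_mono) auto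
      then show "norm (x i * G x) \<le> norm (K * (1 + (x i)\<^sup>2))" using \<open>0 \<le> K\<close> by (simp add: abs_mult mult.commute)
    qed
  qed (use i in measurable)
qed

text \<open>Fubini isolates coordinate i; the one-dimensional identity applies on each line on which
  the other coordinates are fixed.\<close>

lemma gauss_stein:
  fixes G G' :: "(nat \<Rightarrow> real) \<Rightarrow> real"
  assumes i: "i < d"
    and G [measurable]: "G \<in> borel_measurable (\<Pi>\<^sub>M i\<in>{..<d}. borel)"
    and G' [measurable]: "G' \<in> borel_measurable (\<Pi>\<^sub>M i\<in>{..<d}. borel)"
    and deriv: "\<And>x t. ((\<lambda>t. G (x(i := t))) has_real_derivative G' (x(i := t))) (at t)"
    and cont: "\<And>x t. isCont (\<lambda>t. G' (x(i := t))) t"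
    and bound: "\<And>x. \<bar>G x\<bar> \<le> K" "\<And>x. \<bar>G' x\<bar> \<le> K"
  shows "(\<integral>x. x i * G x \<partial>gauss d) = (\<integral>x. G' x \<partial>gauss d)"
proof -
  let ?I = "{..<d} - {i}"
  have ins: "{..<d} = insert i ?I" using i by auto
  have int1: "integrable (gauss d) (\<lambda>x. x i * G x)"
    by (rule gauss_integrable_coord_mult[OF i G bound(1)])
  have int2: "integrable (gauss d) G'" by (rule gauss_integrable_bounded[OF G' bound(2)])
  have "(\<integral>x. x i * G x \<partial>gauss d) =
    (\<integral>x. (\<integral>t. (x(i := t)) i * G (x(i := t)) \<partial>std_normal_distribution) \<partial>Pi\<^sub>M ?I (\<lambda>_. std_normal_distribution))"
    using std_normal_prod.product_integral_insert[of ?I i "\<lambda>x. x i * G x"] int1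
    unfolding ins[symmetric] by simp
  also have "\<dots> = (\<integral>x. (\<integral>t. G' (x(i := t)) \<partial>std_normal_distribution) \<partial>Pi\<^sub>M ?I (\<lambda>_. std_normal_distribution))"
    using std_normal_stein[OF deriv cont bound(1) bound(2)] by simp
  also have "\<dots> = (\<integral>x. G' x \<partial>gauss d)"
    using std_normal_prod.product_integral_insert[of ?I i G'] int2 unfolding ins[symmetric] by simp
  finally show ?thesis .
qed

subsection \<open>Stein's identity with Gaussian weights\<close>

text \<open>The factor exp (- (u\<cdot>x)^2 / 2) makes (u\<cdot>x) w(x) bounded by 1, as a query has
  to be. The parameter s tilts the Gaussian towards the origin: for unit u the weighted law has
  variance 1 / (1 + s) orthogonally to u. The shape is Gaussian because its derivative along u is
  again a multiple of (u\<cdot>x) w, which keeps Stein's identity exact.\<close>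

definition wt :: "nat \<Rightarrow> (nat \<Rightarrow> real) \<Rightarrow> real \<Rightarrow> (nat \<Rightarrow> real) \<Rightarrow> real" where
  "wt d u s x = exp (- ((ip d u x)\<^sup>2 + s * ip d x x) / 2)"

lemma ip_self_nonneg: "0 \<le> ip d x x"
  by (simp add: ip_self)

lemma coord_le_ip_self: "i < d \<Longrightarrow> (x i)\<^sup>2 \<le> ip d x x"
  unfolding ip_def power2_eq_square by (rule member_le_sum) auto

lemma ip_self_fun_upd:
  assumes "i < d"
  shows "ip d (x(i := t)) (x(i := t)) = ip d (x(i := 0)) (x(i := 0)) + t\<^sup>2"
proof -
  have eq: "(\<Sum>j\<in>{..<d} - {i}. (x(i := t)) j * (x(i := t)) j) = (\<Sum>j\<in>{..<d} - {i}. (x(i := 0)) j * (x(i := 0)) j)"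
    by (rule sum.cong) auto
  show ?thesis
    using assms unfolding ip_def by (simp add: sum.remove[of "{..<d}" i] eq power2_eq_square)
qed

lemma wt_pos: "0 < wt d u s x"
  by (simp add: wt_def)

lemma wt_le_1:
  assumes "0 \<le> s" shows "wt d u s x \<le> 1"
proof -
  have "0 \<le> (ip d u x)\<^sup>2 + s * ip d x x"
    using assms by (intro add_nonneg_nonneg mult_nonneg_nonneg ip_self_nonneg) simp_all
  then show ?thesis by (simp add: wt_def)
qed

lemma wt_le_exp_ip: "0 \<le> s \<Longrightarrow> wt d u s x \<le> exp (- (ip d u x)\<^sup>2 / 2)"
  by (simp add: wt_def ip_self_nonneg)

lemma wt_le_exp_norm: "wt d u s x \<le> exp (- (s * ip d x x) / 2)"
  by (simp add: wt_def)

lemma measurable_ip' [measurable]: "ip d u \<in> borel_measurable (\<Pi>\<^sub>M i\<in>{..<d}. borel)"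
  unfolding ip_def[abs_def] by measurable

lemma measurable_ip_self [measurable]: "(\<lambda>x. ip d x x) \<in> borel_measurable (\<Pi>\<^sub>M i\<in>{..<d}. borel)"
  unfolding ip_def by measurable

lemma measurable_wt [measurable]: "wt d u s \<in> borel_measurable (\<Pi>\<^sub>M i\<in>{..<d}. borel)"
  unfolding wt_def[abs_def] by measurable

lemma abs_ip_mult_wt_le:
  assumes "0 \<le> s" shows "\<bar>ip d u x\<bar> * wt d u s x \<le> 1"
  using mult_left_mono[OF wt_le_exp_ip[OF assms, of d u x], of "\<bar>ip d u x\<bar>"] abs_mult_exp_le_1[of "ip d u x"]
  by simp

lemma wt_le_coord:
  assumes "1 \<le> s" "i < d" shows "wt d u s x \<le> exp (- (x i)\<^sup>2 / 2)"
proof -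
  have "(x i)\<^sup>2 \<le> s * ip d x x"
    using coord_le_ip_self[OF assms(2), of x] mult_right_mono[OF assms(1) ip_self_nonneg[of d x]] by simp
  then show ?thesis
    using wt_le_exp_norm[of d u s x] by (simp add: order_trans)
qed

lemma abs_coord_mult_wt_le:
  assumes "1 \<le> s" "i < d" shows "\<bar>x i\<bar> * wt d u s x \<le> 1"
  using mult_left_mono[OF wt_le_coord[OF assms, of u x], of "\<bar>x i\<bar>"] abs_mult_exp_le_1[of "x i"]
  by simp

lemma power2_mult_exp_le_2: "x\<^sup>2 * exp (- x\<^sup>2 / 2) \<le> 2" for x :: real
proof -
  have "x\<^sup>2 / 2 \<le> exp (x\<^sup>2 / 2)" using exp_ge_add_one_self[of "x\<^sup>2 / 2"] by linarith
  then show ?thesis by (simp add: exp_minus field_simps)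
qed

lemma DERIV_wt:
  assumes "i < d"
  shows "((\<lambda>t. wt d u s (x(i := t))) has_real_derivative
    - (ip d u (x(i := t)) * u i + s * t) * wt d u s (x(i := t))) (at t)"
proof -
  define a b where "a = ip d u (x(i := 0))" and "b = ip d (x(i := 0)) (x(i := 0))"
  have eq': "ip d u (x(i := t)) = a + t * u i" for t
    using ip_fun_upd[OF assms, of x t u] by (simp add: ip_commute a_def)
  have eq: "wt d u s (x(i := t)) = exp (- ((a + t * u i)\<^sup>2 + s * (b + t\<^sup>2)) / 2)" for t
    using ip_self_fun_upd[OF assms, of x t] by (simp add: wt_def eq' b_def)
  show ?thesis
    unfolding eq eq' by (auto intro!: derivative_eq_intros simp: field_simps)
qed

lemma isCont_ip_fun_upd: "i < d \<Longrightarrow> isCont (\<lambda>t. ip d u (x(i := t))) t"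
  unfolding ip_commute[of d u] by (subst ip_fun_upd) (auto intro!: continuous_intros)

lemma isCont_wt: "i < d \<Longrightarrow> isCont (\<lambda>t. wt d u s (x(i := t))) t"
  using DERIV_isCont[OF DERIV_wt] by blast

text \<open>For unit u the derivative of w along u is - (1 + s) (u\<cdot>x) w. Stein's identity in
  direction u therefore returns - (1 + s) times its own left side plus the \<psi>' term, and
  collecting gives 2 + s. The two cases for s keep the derivatives bounded: |x i| w \<le> 1 comes
  from s \<ge> 1, and for s = 0 the term s x i vanishes.\<close>

lemma gauss_stein_weighted:
  fixes \<psi> \<psi>' :: "real \<Rightarrow> real"
  assumes u: "ip d u u = 1" and s: "s = 0 \<or> 1 \<le> s"
    and deriv: "\<And>t. (\<psi> has_real_derivative \<psi>' t) (at t)" and cont: "\<And>t. isCont \<psi>' t"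
    and bound: "\<And>t. \<bar>\<psi> t\<bar> \<le> K" "\<And>t. \<bar>\<psi>' t\<bar> \<le> K"
  shows "(2 + s) * (\<integral>x. ip d u x * wt d u s x * \<psi> (ip d x \<delta> + z) \<partial>gauss d) =
    ip d u \<delta> * (\<integral>x. wt d u s x * \<psi>' (ip d x \<delta> + z) \<partial>gauss d)"
proof -
  have s0: "0 \<le> s" using s by auto
  have K: "0 \<le> K" using bound(1)[of 0] by linarith
  have c\<psi>: "isCont \<psi> t" for t using deriv DERIV_isCont by blast
  have [measurable]: "\<psi> \<in> borel_measurable borel" "\<psi>' \<in> borel_measurable borel"
    using c\<psi> cont by (auto intro!: borel_measurable_continuous_onI continuous_at_imp_continuous_on)
  define G where "G x = wt d u s x * \<psi> (ip d x \<delta> + z)" for x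
  define B where "B x = wt d u s x * \<psi>' (ip d x \<delta> + z)" for x
  define G' where "G' i x = - ((ip d u x * u i + s * x i) * G x) + \<delta> i * B x" for i x
  have G_m [measurable]: "G \<in> borel_measurable (\<Pi>\<^sub>M i\<in>{..<d}. borel)" unfolding G_def[abs_def] by measurable
  have B_m [measurable]: "B \<in> borel_measurable (\<Pi>\<^sub>M i\<in>{..<d}. borel)" unfolding B_def[abs_def] by measurable
  have wK: "wt d u s x * \<bar>a\<bar> \<le> K" if "\<bar>a\<bar> \<le> K" for x a
    using mult_mono[OF wt_le_1[OF s0, of d u x] that] K by simp
  have G_b: "\<bar>G x\<bar> \<le> K" for x
    unfolding G_def abs_mult using wK[OF bound(1)] wt_pos[of d u s x] by (simp add: abs_of_pos)
  have B_b: "\<bar>B x\<bar> \<le> K" for x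
    unfolding B_def abs_mult using wK[OF bound(2)] wt_pos[of d u s x] by (simp add: abs_of_pos)
  have ipG: "\<bar>ip d u x * G x\<bar> \<le> K" for x
  proof -
    have "\<bar>ip d u x * G x\<bar> = (\<bar>ip d u x\<bar> * wt d u s x) * \<bar>\<psi> (ip d x \<delta> + z)\<bar>"
      using wt_pos[of d u s x] by (simp add: G_def abs_mult abs_of_pos)
    also have "\<dots> \<le> 1 * K"
      using wt_pos[of d u s x] by (intro mult_mono abs_ip_mult_wt_le s0 bound) auto
    finally show ?thesis by simp
  qed
  have sxG: "\<bar>s * x i * G x\<bar> \<le> s * K" if "i < d" for x i
  proof (cases "s = 0")
    case False
    then have s1: "1 \<le> s" using s by auto
    have "\<bar>x i * G x\<bar> = (\<bar>x i\<bar> * wt d u s x) * \<bar>\<psi> (ip d x \<delta> + z)\<bar>"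
      using wt_pos[of d u s x] by (simp add: G_def abs_mult abs_of_pos)
    also have "\<dots> \<le> 1 * K"
      using wt_pos[of d u s x] by (intro mult_mono abs_coord_mult_wt_le s1 that bound) auto
    finally have "\<bar>s\<bar> * \<bar>x i * G x\<bar> \<le> s * K" using s0 by (simp add: mult_left_mono)
    then show ?thesis by (simp add: abs_mult mult.assoc)
  qed simp
  have G'_m: "G' i \<in> borel_measurable (\<Pi>\<^sub>M i\<in>{..<d}. borel)" if "i < d" for i
    unfolding G'_def[abs_def]
    by (intro borel_measurable_add borel_measurable_uminus borel_measurable_times borel_measurable_const
        G_m B_m measurable_ip' measurable_coord that)
  have stein: "(\<integral>x. x i * G x \<partial>gauss d) = (\<integral>x. G' i x \<partial>gauss d)" if i: "i < d" for i
  proof (rule gauss_stein[OF i G_m G'_m[OF i], where K = "K + \<bar>u i\<bar> * K + s * K + \<bar>\<delta> i\<bar> * K"])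
    have v: "((\<lambda>t. ip d (x(i := t)) \<delta> + z) has_real_derivative \<delta> i) (at t)" for x t
      by (subst ip_fun_upd[OF i, of x _ \<delta>]) (auto intro!: derivative_eq_intros)
    show "((\<lambda>t. G (x(i := t))) has_real_derivative G' i (x(i := t))) (at t)" for x t
    proof -
      have "((\<lambda>t. \<psi> (ip d (x(i := t)) \<delta> + z)) has_real_derivative \<psi>' (ip d (x(i := t)) \<delta> + z) * \<delta> i) (at t)"
        by (rule DERIV_chain2[OF deriv v])
      from DERIV_mult[OF DERIV_wt[OF i, of u s x t] this] show ?thesis
        by (simp add: G_def G'_def B_def algebra_simps)
    qed
    show "isCont (\<lambda>t. G' i (x(i := t))) t" for x t
      unfolding G'_def G_def B_def
      by (intro continuous_intros isCont_ip_fun_upd isCont_wt isCont_o2[OF _ cont] isCont_o2[OF _ c\<psi>] i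
          DERIV_isCont[OF v]) simp
    show "\<bar>G x\<bar> \<le> K + \<bar>u i\<bar> * K + s * K + \<bar>\<delta> i\<bar> * K" for x
      using G_b[of x] K s0 by (smt (verit) mult_nonneg_nonneg abs_ge_zero)
    show "\<bar>G' i x\<bar> \<le> K + \<bar>u i\<bar> * K + s * K + \<bar>\<delta> i\<bar> * K" for x
    proof -
      have "\<bar>u i * (ip d u x * G x)\<bar> \<le> \<bar>u i\<bar> * K" "\<bar>\<delta> i * B x\<bar> \<le> \<bar>\<delta> i\<bar> * K"
        using ipG[of x] B_b[of x] by (simp_all add: abs_mult mult_left_mono)
      moreover have "G' i x = - (u i * (ip d u x * G x)) - s * x i * G x + \<delta> i * B x"
        by (simp add: G'_def algebra_simps)
      ultimately show ?thesis using sxG[OF i, of x] K by linarith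
    qed
  qed
  have intG': "integrable (gauss d) (\<lambda>x. G' i x)" if i: "i < d" for i
  proof -
    have "integrable (gauss d) (\<lambda>x. u i * (ip d u x * G x))"
      by (intro integrable_mult_right gauss_integrable_bounded[of _ _ K] ipG) measurable
    moreover have "integrable (gauss d) (\<lambda>x. s * x i * G x)"
      using i by (intro gauss_integrable_bounded[of _ _ "s * K"] sxG) measurable
    moreover have "integrable (gauss d) (\<lambda>x. \<delta> i * B x)"
      by (intro integrable_mult_right gauss_integrable_bounded[of _ _ K] B_b) measurable
    ultimately have "integrable (gauss d) (\<lambda>x. - (u i * (ip d u x * G x)) - s * x i * G x + \<delta> i * B x)"
      by (intro Bochner_Integration.integrable_add Bochner_Integration.integrable_diff) auto
    then show ?thesis by (simp add: G'_def algebra_simps)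
  qed
  have intxG: "integrable (gauss d) (\<lambda>x. x i * G x)" if "i < d" for i
    by (rule gauss_integrable_coord_mult[OF that G_m G_b])
  have intipG: "integrable (gauss d) (\<lambda>x. ip d u x * G x)"
    by (rule gauss_integrable_bounded[OF _ ipG]) measurable
  have intB: "integrable (gauss d) B" by (rule gauss_integrable_bounded[OF B_m B_b])
  have "(\<integral>x. ip d u x * G x \<partial>gauss d) = (\<integral>x. (\<Sum>i<d. u i * (x i * G x)) \<partial>gauss d)"
    by (simp add: ip_def sum_distrib_right mult.assoc)
  also have "\<dots> = (\<Sum>i<d. u i * (\<integral>x. x i * G x \<partial>gauss d))"
    by (subst Bochner_Integration.integral_sum) (auto intro!: integrable_mult_right intxG)
  also have "\<dots> = (\<Sum>i<d. u i * (\<integral>x. G' i x \<partial>gauss d))"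
    by (intro sum.cong) (auto simp: stein)
  also have "\<dots> = (\<integral>x. (\<Sum>i<d. u i * G' i x) \<partial>gauss d)"
    by (subst Bochner_Integration.integral_sum) (auto intro!: integrable_mult_right intG')
  also have "\<dots> = (\<integral>x. - ((1 + s) * (ip d u x * G x)) + ip d u \<delta> * B x \<partial>gauss d)"
  proof (rule Bochner_Integration.integral_cong[OF refl])
    fix x
    have "(\<Sum>i<d. u i * G' i x) =
      - (ip d u x * G x * (\<Sum>i<d. u i * u i) + s * G x * (\<Sum>i<d. u i * x i)) + B x * (\<Sum>i<d. u i * \<delta> i)"
      by (simp add: G'_def sum_distrib_left sum.distrib[symmetric] sum_negf[symmetric] algebra_simps)
    then show "(\<Sum>i<d. u i * G' i x) = - ((1 + s) * (ip d u x * G x)) + ip d u \<delta> * B x"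
      using u unfolding ip_def[symmetric] by (simp add: algebra_simps)
  qed
  also have "\<dots> = - ((1 + s) * (\<integral>x. ip d u x * G x \<partial>gauss d)) + ip d u \<delta> * (\<integral>x. B x \<partial>gauss d)"
    using intipG intB by simp
  finally have "(2 + s) * (\<integral>x. ip d u x * G x \<partial>gauss d) = ip d u \<delta> * (\<integral>x. B x \<partial>gauss d)"
    by (simp add: algebra_simps)
  then show ?thesis by (simp add: G_def B_def mult.assoc)
qed

text \<open>Stein's identity for x i w, summed over i, gives E[|x|^2 w] = d E[w] -
  E[(u\<cdot>x)^2 w] - s E[|x|^2 w]. Hence |x|^2 has weighted mean at most d / (1 + s), and a large
  s makes x\<cdot>\<delta> as small as desired in bounded dimension.\<close>

lemma wt_second_moment:
  assumes u: "ip d u u = 1" and s: "1 \<le> s"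
  shows "integrable (gauss d) (\<lambda>x. ip d x x * wt d u s x)"
    and "(1 + s) * (\<integral>x. ip d x x * wt d u s x \<partial>gauss d) \<le> d * (\<integral>x. wt d u s x \<partial>gauss d)"
proof -
  have s0: "0 \<le> s" using s by auto
  define G where "G i x = x i * wt d u s x" for i x
  define G' where "G' i x = wt d u s x - (u i * x i * ip d u x + s * (x i)\<^sup>2) * wt d u s x" for i x
  have w2: "(x i)\<^sup>2 * wt d u s x \<le> 2" if "i < d" for i x
    using mult_left_mono[OF wt_le_coord[OF s that, of u x], of "(x i)\<^sup>2"] power2_mult_exp_le_2[of "x i"]
    by simp
  have p2: "(ip d u x)\<^sup>2 * wt d u s x \<le> 2" for x
    using mult_left_mono[OF wt_le_exp_ip[OF s0, of d u x], of "(ip d u x)\<^sup>2"] power2_mult_exp_le_2[of "ip d u x"]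
    by simp
  have xp: "\<bar>x i * ip d u x * wt d u s x\<bar> \<le> 2" if "i < d" for i x
  proof -
    have "2 * \<bar>x i * ip d u x\<bar> \<le> (x i)\<^sup>2 + (ip d u x)\<^sup>2"
      using sum_squares_bound[of "\<bar>x i\<bar>" "\<bar>ip d u x\<bar>"] by (simp add: abs_mult)
    then have "2 * \<bar>x i * ip d u x\<bar> * wt d u s x \<le> ((x i)\<^sup>2 + (ip d u x)\<^sup>2) * wt d u s x"
      by (rule mult_right_mono) (rule less_imp_le[OF wt_pos])
    then show ?thesis using w2[OF that, of x] p2[of x] wt_pos[of d u s x]
      by (simp add: abs_mult abs_of_pos algebra_simps)
  qed
  have G_m: "G i \<in> borel_measurable (\<Pi>\<^sub>M i\<in>{..<d}. borel)" if [simp]: "i < d" for i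
    unfolding G_def[abs_def] by measurable
  have G'_m: "G' i \<in> borel_measurable (\<Pi>\<^sub>M i\<in>{..<d}. borel)" if [simp]: "i < d" for i
    unfolding G'_def[abs_def] by measurable
  have G_b: "\<bar>G i x\<bar> \<le> 1" if "i < d" for i x
    using abs_coord_mult_wt_le[OF s that, of x u] wt_pos[of d u s x] by (simp add: G_def abs_mult abs_of_pos)
  have G'_b: "\<bar>G' i x\<bar> \<le> 1 + 2 * \<bar>u i\<bar> + 2 * s" if "i < d" for i x
  proof -
    have "\<bar>u i * (x i * ip d u x * wt d u s x)\<bar> \<le> \<bar>u i\<bar> * 2" unfolding abs_mult[of "u i"]
      by (rule mult_left_mono[OF xp[OF that]]) simp
    moreover have "s * ((x i)\<^sup>2 * wt d u s x) \<le> s * 2" "0 \<le> s * ((x i)\<^sup>2 * wt d u s x)"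
      using w2[OF that, of x] s0 wt_pos[of d u s x] by (auto intro: mult_left_mono)
    moreover have "G' i x = wt d u s x - u i * (x i * ip d u x * wt d u s x) - s * ((x i)\<^sup>2 * wt d u s x)"
      by (simp add: G'_def algebra_simps)
    ultimately show ?thesis using wt_le_1[OF s0, of d u x] wt_pos[of d u s x] by linarith
  qed
  have stein: "(\<integral>x. x i * G i x \<partial>gauss d) = (\<integral>x. G' i x \<partial>gauss d)" if i: "i < d" for i
  proof (rule gauss_stein[OF i G_m[OF i] G'_m[OF i], where K = "1 + 2 * \<bar>u i\<bar> + 2 * s"])
    show "((\<lambda>t. G i (x(i := t))) has_real_derivative G' i (x(i := t))) (at t)" for x t
      using DERIV_mult[OF DERIV_ident DERIV_wt[OF i, of u s x t]]
      by (simp add: G_def G'_def algebra_simps power2_eq_square)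
    show "isCont (\<lambda>t. G' i (x(i := t))) t" for x t
      unfolding G'_def by (simp, intro continuous_intros isCont_ip_fun_upd isCont_wt i)
    show "\<bar>G i x\<bar> \<le> 1 + 2 * \<bar>u i\<bar> + 2 * s" for x using G_b[OF i, of x] s0 by linarith
  qed (rule G'_b[OF i])
  have intx: "integrable (gauss d) (\<lambda>x. x i * G i x)" if "i < d" for i
    by (rule gauss_integrable_coord_mult[OF that G_m[OF that] G_b[OF that]])
  have intG': "integrable (gauss d) (\<lambda>x. G' i x)" if i: "i < d" for i
    by (rule gauss_integrable_bounded[OF G'_m[OF i] G'_b[OF i]])
  have eq: "ip d x x * wt d u s x = (\<Sum>i<d. x i * G i x)" for x
    by (simp add: ip_def G_def sum_distrib_right mult.assoc)
  show I: "integrable (gauss d) (\<lambda>x. ip d x x * wt d u s x)"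
    unfolding eq by (auto intro: intx)
  have intw: "integrable (gauss d) (wt d u s)"
    using wt_le_1[OF s0] wt_pos by (intro gauss_integrable_bounded[of _ _ 1]) (auto simp: abs_of_pos)
  have intp: "integrable (gauss d) (\<lambda>x. (ip d u x)\<^sup>2 * wt d u s x)"
    using p2 wt_pos[of d u s] by (intro gauss_integrable_bounded[of _ _ 2]) (auto simp: abs_mult abs_of_pos)
  have "(\<integral>x. ip d x x * wt d u s x \<partial>gauss d) = (\<Sum>i<d. (\<integral>x. x i * G i x \<partial>gauss d))"
    unfolding eq by (subst Bochner_Integration.integral_sum) (auto intro: intx)
  also have "\<dots> = (\<Sum>i<d. (\<integral>x. G' i x \<partial>gauss d))"
    by (intro sum.cong) (auto simp: stein)
  also have "\<dots> = (\<integral>x. (\<Sum>i<d. G' i x) \<partial>gauss d)"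
    by (subst Bochner_Integration.integral_sum) (auto intro: intG')
  also have "\<dots> = (\<integral>x. d * wt d u s x - (ip d u x)\<^sup>2 * wt d u s x - s * (ip d x x * wt d u s x) \<partial>gauss d)"
  proof (rule Bochner_Integration.integral_cong[OF refl])
    fix x
    have "(\<Sum>i<d. G' i x) = d * wt d u s x - ip d u x * wt d u s x * (\<Sum>i<d. u i * x i) - s * wt d u s x * (\<Sum>i<d. x i * x i)"
      by (simp add: G'_def sum_distrib_left sum_subtractf sum.distrib algebra_simps power2_eq_square)
    then show "(\<Sum>i<d. G' i x) = d * wt d u s x - (ip d u x)\<^sup>2 * wt d u s x - s * (ip d x x * wt d u s x)"
      by (simp add: ip_def[symmetric] power2_eq_square algebra_simps)
  qed
  also have "\<dots> = d * (\<integral>x. wt d u s x \<partial>gauss d) - (\<integral>x. (ip d u x)\<^sup>2 * wt d u s x \<partial>gauss d)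
      - s * (\<integral>x. ip d x x * wt d u s x \<partial>gauss d)"
    using I intw intp by simp
  moreover have "0 \<le> (\<integral>x. (ip d u x)\<^sup>2 * wt d u s x \<partial>gauss d)"
    using wt_pos[of d u s] by (intro Bochner_Integration.integral_nonneg) (simp add: less_imp_le)
  ultimately show "(1 + s) * (\<integral>x. ip d x x * wt d u s x \<partial>gauss d) \<le> d * (\<integral>x. wt d u s x \<partial>gauss d)"
    by (simp add: algebra_simps)
qed

subsection \<open>Expectations under the regression model\<close>

text \<open>The second argument of F is the residual v = y - x\<cdot>c, so that \<beta> and the
  centre c enter only through \<delta> = \<beta> - c.\<close>

definition ev :: "nat \<Rightarrow> real measure \<Rightarrow> (nat \<Rightarrow> real) \<Rightarrow> ((nat \<Rightarrow> real) \<Rightarrow> real \<Rightarrow> real) \<Rightarrow> real" where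
  "ev d E \<delta> F = (\<integral>p. F (fst p) (ip d (fst p) \<delta> + snd p) \<partial>(gauss d \<Otimes>\<^sub>M E))"

text \<open>A smooth substitute for the noise mass of [-R, R]. \<open>bell\<close> combines two
  properties that an indicator lacks: Stein's identity for tanh produces it, and shifts change it by
  a bounded factor.\<close>

definition soft_mass :: "real measure \<Rightarrow> real \<Rightarrow> real" where
  "soft_mass E R = (\<integral>z. bell (z / R) \<partial>E)"

abbreviation qry :: "nat \<Rightarrow> (nat \<Rightarrow> real) \<Rightarrow> ((nat \<Rightarrow> real) \<Rightarrow> real \<Rightarrow> real) \<Rightarrow> (nat \<Rightarrow> real) \<times> real \<Rightarrow> real" where
  "qry d c F \<equiv> (\<lambda>p. F (fst p) (snd p - ip d (fst p) c))"

lemma sets_gauss_pair: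
  assumes "real_distribution E"
  shows "sets (gauss d \<Otimes>\<^sub>M E) = sets (lr_space d)"
  unfolding lr_space_def
  by (rule sets_pair_measure_cong) (simp_all add: sets_gauss real_distribution.events_eq_borel[OF assms])

lemma measurable_qry:
  assumes F: "(\<lambda>p. F (fst p) (snd p)) \<in> borel_measurable (lr_space d)"
  shows "qry d c F \<in> borel_measurable (lr_space d)"
proof -
  have "(\<lambda>p. (fst p, snd p - ip d (fst p) c)) \<in> lr_space d \<rightarrow>\<^sub>M lr_space d"
    unfolding lr_space_def by measurable
  from measurable_compose[OF this F] show ?thesis by simp
qed

context
  fixes E :: "real measure"
  assumes E: "real_distribution E"
begin

interpretation E: real_distribution E by (rule E)

lemma prob_space_gauss_pair: "prob_space (gauss d \<Otimes>\<^sub>M E)"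
proof -
  interpret G: prob_space "gauss d" by (rule prob_space_gauss)
  interpret P: pair_prob_space "gauss d" E ..
  show ?thesis by (rule P.prob_space_axioms)
qed

lemma pair_sigma_finite_gauss: "pair_sigma_finite (gauss d) E"
  using prob_space_imp_sigma_finite[OF prob_space_gauss] prob_space_imp_sigma_finite[OF E.prob_space_axioms]
  by (simp add: pair_sigma_finite_def)

lemma ev_measurable:
  assumes F: "(\<lambda>p. F (fst p) (snd p)) \<in> borel_measurable (lr_space d)"
  shows "(\<lambda>p. F (fst p) (ip d (fst p) \<delta> + snd p)) \<in> borel_measurable (gauss d \<Otimes>\<^sub>M E)"
proof -
  have "(\<lambda>p. (fst p, ip d (fst p) \<delta> + snd p)) \<in> lr_space d \<rightarrow>\<^sub>M lr_space d"
    unfolding lr_space_def by measurable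
  from measurable_compose[OF this F] show ?thesis
    by (simp add: measurable_cong_sets[OF sets_gauss_pair[OF E] refl])
qed

lemma ev_integrable:
  fixes F :: "(nat \<Rightarrow> real) \<Rightarrow> real \<Rightarrow> real"
  assumes F: "(\<lambda>p. F (fst p) (snd p)) \<in> borel_measurable (lr_space d)" and K: "\<And>x v. \<bar>F x v\<bar> \<le> K"
  shows "integrable (gauss d \<Otimes>\<^sub>M E) (\<lambda>p. F (fst p) (ip d (fst p) \<delta> + snd p))"
  by (rule finite_measure.integrable_const_bound[OF prob_space.finite_measure[OF prob_space_gauss_pair], of _ K])
    (use K in \<open>auto intro: ev_measurable[OF F]\<close>)

lemma integral_lr_dist:
  assumes F: "(\<lambda>p. F (fst p) (snd p)) \<in> borel_measurable (lr_space d)"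
  shows "integral\<^sup>L (lr_dist d \<beta> E) (qry d c F) = ev d E (\<lambda>i. \<beta> i - c i) F"
proof -
  have m: "(\<lambda>(x, z). (x, (\<Sum>i<d. x i * \<beta> i) + z)) \<in> gauss d \<Otimes>\<^sub>M E \<rightarrow>\<^sub>M lr_space d"
  proof -
    have "(\<lambda>p. (fst p, ip d (fst p) \<beta> + snd p)) \<in> lr_space d \<rightarrow>\<^sub>M lr_space d"
      unfolding lr_space_def by measurable
    then show ?thesis
      by (simp add: measurable_cong_sets[OF sets_gauss_pair[OF E] refl] ip_def case_prod_beta)
  qed
  have "integral\<^sup>L (lr_dist d \<beta> E) (qry d c F) =
    (\<integral>p. qry d c F ((\<lambda>(x, z). (x, (\<Sum>i<d. x i * \<beta> i) + z)) p) \<partial>(gauss d \<Otimes>\<^sub>M E))"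
    unfolding lr_dist_def by (rule integral_distr[OF m measurable_qry[OF F]])
  also have "\<dots> = ev d E (\<lambda>i. \<beta> i - c i) F"
    unfolding ev_def
    by (rule Bochner_Integration.integral_cong[OF refl])
      (simp add: case_prod_beta ip_diff_right ip_def[symmetric] algebra_simps)
  finally show ?thesis .
qed

lemma ev_iterated:
  assumes F: "(\<lambda>p. F (fst p) (snd p)) \<in> borel_measurable (lr_space d)" and K: "\<And>x v. \<bar>F x v\<bar> \<le> K"
  shows "ev d E \<delta> F = (\<integral>z. (\<integral>x. F x (ip d x \<delta> + z) \<partial>gauss d) \<partial>E)"
    and "integrable E (\<lambda>z. \<integral>x. F x (ip d x \<delta> + z) \<partial>gauss d)"
proof -
  interpret P: pair_sigma_finite "gauss d" E by (rule pair_sigma_finite_gauss)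
  have I: "integrable (gauss d \<Otimes>\<^sub>M E) (\<lambda>(x, z). F x (ip d x \<delta> + z))"
    using ev_integrable[OF F K, of \<delta>] by (simp add: case_prod_beta')
  show "ev d E \<delta> F = (\<integral>z. (\<integral>x. F x (ip d x \<delta> + z) \<partial>gauss d) \<partial>E)"
    using P.integral_snd[OF I] by (simp add: ev_def case_prod_beta')
  show "integrable E (\<lambda>z. \<integral>x. F x (ip d x \<delta> + z) \<partial>gauss d)"
    by (rule P.integrable_snd[OF I])
qed

lemma ev_mono:
  assumes "(\<lambda>p. F (fst p) (snd p)) \<in> borel_measurable (lr_space d)" "\<And>x v. \<bar>F x v\<bar> \<le> K"
    and "(\<lambda>p. G (fst p) (snd p)) \<in> borel_measurable (lr_space d)" "\<And>x v. \<bar>G x v\<bar> \<le> K'"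
    and "\<And>x v. F x v \<le> G x v"
  shows "ev d E \<delta> F \<le> ev d E \<delta> G"
  unfolding ev_def
  by (rule integral_mono[OF ev_integrable[OF assms(1,2)] ev_integrable[OF assms(3,4)] assms(5)])

lemma ev_le_1:
  assumes "(\<lambda>p. F (fst p) (snd p)) \<in> borel_measurable (lr_space d)" "\<And>x v. \<bar>F x v\<bar> \<le> 1"
  shows "ev d E \<delta> F \<le> 1"
proof -
  have "ev d E \<delta> F \<le> ev d E \<delta> (\<lambda>_ _. 1)"
    by (rule ev_mono[where K = 1 and K' = 1]) (use assms abs_le_D1 in auto)
  also have "\<dots> = 1" by (simp add: ev_def prob_space.prob_space[OF prob_space_gauss_pair])
  finally show ?thesis .
qed

lemma integrable_bell: "integrable E (\<lambda>z. bell (z / R))"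
  by (rule E.integrable_const_bound[of _ 1]) (auto simp: bell_le_1 bell_nonneg abs_of_nonneg)

lemma integrable_atom: "integrable E (indicator {0} :: real \<Rightarrow> real)"
  by (rule E.integrable_const_bound[of _ 1]) (auto simp: indicator_def)

lemma soft_mass_ge: "measure E {0} \<le> soft_mass E R"
proof -
  have "measure E {0} = (\<integral>z. indicator {0} z \<partial>E)" by simp
  also have "\<dots> \<le> soft_mass E R"
    unfolding soft_mass_def
    by (rule integral_mono[OF integrable_atom integrable_bell]) (simp add: indicator_def bell_nonneg)
  finally show ?thesis .
qed

context
  fixes d :: nat and g :: "(nat \<Rightarrow> real) \<Rightarrow> real" and R :: real and \<delta> :: "nat \<Rightarrow> real"
  assumes g [measurable]: "g \<in> borel_measurable (\<Pi>\<^sub>M i\<in>{..<d}. borel)"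
    and g_bound: "\<And>x. 0 \<le> g x" "\<And>x. g x \<le> 1" and R: "0 < R"
begin

lemma weighted_bell_measurable: "(\<lambda>p. g (fst p) * bell (snd p / R)) \<in> borel_measurable (lr_space d)"
  unfolding lr_space_def by measurable

lemma weighted_bell_bound: "\<bar>g x * bell (v / R)\<bar> \<le> 1"
  using mult_mono[OF g_bound(2)[of x] bell_le_1[of "v / R"]] g_bound(1)[of x] bell_nonneg[of "v / R"]
  by (simp add: abs_mult)

lemma integrable_weighted_bell_shift: "integrable (gauss d) (\<lambda>x. g x * bell ((ip d x \<delta> + z) / R))"
  by (rule gauss_integrable_bounded[OF _ weighted_bell_bound]) measurable

text \<open>Integrating the shift bound over x for fixed z separates the Gaussian part from the
  noise, which then enters only through its soft mass. The lower bound
  \<open>ev_weighted_bell_ge\<close> is obtained in the same way.\<close>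

lemma ev_weighted_bell_le:
  assumes "integrable (gauss d) (\<lambda>x. g x * exp (2 * \<bar>ip d x \<delta>\<bar> / R))"
  shows "ev d E \<delta> (\<lambda>x v. g x * bell (v / R)) \<le> (\<integral>x. g x * exp (2 * \<bar>ip d x \<delta>\<bar> / R) \<partial>gauss d) * soft_mass E R"
proof -
  have "(\<integral>x. g x * bell ((ip d x \<delta> + z) / R) \<partial>gauss d) \<le>
    (\<integral>x. g x * exp (2 * \<bar>ip d x \<delta>\<bar> / R) \<partial>gauss d) * bell (z / R)" for z
  proof -
    have "(\<integral>x. g x * bell ((ip d x \<delta> + z) / R) \<partial>gauss d) \<le> (\<integral>x. g x * exp (2 * \<bar>ip d x \<delta>\<bar> / R) * bell (z / R) \<partial>gauss d)"
    proof (rule integral_mono[OF integrable_weighted_bell_shift])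
      show "g x * bell ((ip d x \<delta> + z) / R) \<le> g x * exp (2 * \<bar>ip d x \<delta>\<bar> / R) * bell (z / R)" for x
        using mult_left_mono[OF bell_add_le[of "ip d x \<delta> / R" "z / R"] g_bound(1)[of x]] R
        by (simp add: add_divide_distrib mult.assoc)
    qed (use assms in simp)
    then show ?thesis by simp
  qed
  then have "(\<integral>z. (\<integral>x. g x * bell ((ip d x \<delta> + z) / R) \<partial>gauss d) \<partial>E) \<le>
    (\<integral>z. (\<integral>x. g x * exp (2 * \<bar>ip d x \<delta>\<bar> / R) \<partial>gauss d) * bell (z / R) \<partial>E)"
    by (intro integral_mono ev_iterated(2)[OF weighted_bell_measurable weighted_bell_bound]
        integrable_mult_right integrable_bell)
  then show ?thesis
    unfolding ev_iterated(1)[OF weighted_bell_measurable weighted_bell_bound] soft_mass_def by simp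
qed

lemma ev_weighted_bell_ge:
  "(\<integral>x. g x * exp (- (2 * \<bar>ip d x \<delta>\<bar> / R)) \<partial>gauss d) * soft_mass E R \<le> ev d E \<delta> (\<lambda>x v. g x * bell (v / R))"
proof -
  have "(\<integral>x. g x * exp (- (2 * \<bar>ip d x \<delta>\<bar> / R)) \<partial>gauss d) * bell (z / R) \<le>
    (\<integral>x. g x * bell ((ip d x \<delta> + z) / R) \<partial>gauss d)" for z
  proof -
    have "integrable (gauss d) (\<lambda>x. g x * exp (- (2 * \<bar>ip d x \<delta>\<bar> / R)))"
    proof (rule gauss_integrable_bounded[of _ _ 1])
      show "\<bar>g x * exp (- (2 * \<bar>ip d x \<delta>\<bar> / R))\<bar> \<le> 1" for x
        using mult_mono[OF g_bound(2)[of x], of "exp (- (2 * \<bar>ip d x \<delta>\<bar> / R))" 1] R g_bound(1)[of x]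
        by (simp add: abs_mult)
    qed measurable
    then have "(\<integral>x. g x * exp (- (2 * \<bar>ip d x \<delta>\<bar> / R)) * bell (z / R) \<partial>gauss d) \<le> (\<integral>x. g x * bell ((ip d x \<delta> + z) / R) \<partial>gauss d)"
    proof (intro integral_mono integrable_weighted_bell_shift)
      show "g x * exp (- (2 * \<bar>ip d x \<delta>\<bar> / R)) * bell (z / R) \<le> g x * bell ((ip d x \<delta> + z) / R)" for x
        using mult_left_mono[OF bell_add_ge[of "z / R" "ip d x \<delta> / R"] g_bound(1)[of x]] R
        by (simp add: add_divide_distrib mult_ac add.commute)
    qed simp
    then show ?thesis by simp
  qed
  then have "(\<integral>z. (\<integral>x. g x * exp (- (2 * \<bar>ip d x \<delta>\<bar> / R)) \<partial>gauss d) * bell (z / R) \<partial>E) \<le>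
    (\<integral>z. (\<integral>x. g x * bell ((ip d x \<delta> + z) / R) \<partial>gauss d) \<partial>E)"
    by (intro integral_mono ev_iterated(2)[OF weighted_bell_measurable weighted_bell_bound]
        integrable_mult_right integrable_bell)
  then show ?thesis
    unfolding ev_iterated(1)[OF weighted_bell_measurable weighted_bell_bound] soft_mass_def by simp
qed

text \<open>The integrand is nonnegative, so the noise may be restricted to the event Z = 0, where
  the residual is x\<cdot>\<delta>.\<close>

lemma ev_weighted_bell_ge_atom:
  "measure E {0} * (\<integral>x. g x * bell (ip d x \<delta> / R) \<partial>gauss d) \<le> ev d E \<delta> (\<lambda>x v. g x * bell (v / R))"
proof -
  let ?h = "\<lambda>z. \<integral>x. g x * bell ((ip d x \<delta> + z) / R) \<partial>gauss d"
  have h0: "0 \<le> ?h z" for z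
    by (intro Bochner_Integration.integral_nonneg mult_nonneg_nonneg g_bound bell_nonneg)
  have "measure E {0} * ?h 0 = (\<integral>z. indicator {0} z * ?h 0 \<partial>E)" by simp
  also have "\<dots> \<le> (\<integral>z. ?h z \<partial>E)"
    by (rule integral_mono[OF integrable_mult_left[OF integrable_atom]
          ev_iterated(2)[OF weighted_bell_measurable weighted_bell_bound]])
      (use h0 in \<open>auto simp: indicator_def\<close>)
  finally show ?thesis
    unfolding ev_iterated(1)[OF weighted_bell_measurable weighted_bell_bound] by simp
qed

end

text \<open>For fixed z the noise merely translates tanh, so the identity survives integration over
  any law of Z. Both expectations can be queried, hence u\<cdot>\<delta> is determined without
  knowing E.\<close>

lemma ev_stein_tanh:
  assumes u: "ip d u u = 1" and s: "s = 0 \<or> 1 \<le> s" and R: "0 < R"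
  shows "(2 + s) * ev d E \<delta> (\<lambda>x v. ip d u x * wt d u s x * tanh (v / R)) =
    ip d u \<delta> / R * ev d E \<delta> (\<lambda>x v. wt d u s x * bell (v / R))"
proof -
  have s0: "0 \<le> s" using s by auto
  have b1: "\<bar>ip d u x * wt d u s x * tanh (v / R)\<bar> \<le> 1" for x v
    using mult_mono[OF abs_ip_mult_wt_le[OF s0, of d u x] abs_tanh_le_1[of "v / R"]] wt_pos[of d u s x]
    by (simp add: abs_mult abs_of_pos)
  have m1: "(\<lambda>p. ip d u (fst p) * wt d u s (fst p) * tanh (snd p / R)) \<in> borel_measurable (lr_space d)"
    unfolding lr_space_def by measurable
  note m2 = weighted_bell_measurable[OF measurable_wt[of d u s] less_imp_le[OF wt_pos] wt_le_1[OF s0] R]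
  note b2 = weighted_bell_bound[OF measurable_wt[of d u s] less_imp_le[OF wt_pos] wt_le_1[OF s0] R]
  have "(2 + s) * (\<integral>x. ip d u x * wt d u s x * tanh ((ip d x \<delta> + z) / R) \<partial>gauss d) =
    ip d u \<delta> * (\<integral>x. wt d u s x * (bell ((ip d x \<delta> + z) / R) / R) \<partial>gauss d)" for z
  proof (rule gauss_stein_weighted[OF u s, where K = "1 + 1 / R"])
    show "((\<lambda>t. tanh (t / R)) has_real_derivative bell (t / R) / R) (at t)" for t
      using DERIV_chain2[OF DERIV_tanh_bell, of "\<lambda>t. t / R" "1 / R" t UNIV] by (simp add: DERIV_cdivide)
    show "isCont (\<lambda>t. bell (t / R) / R) t" for t
      unfolding bell_def using R by (intro continuous_intros) auto
    show "\<bar>tanh (t / R)\<bar> \<le> 1 + 1 / R" for t using abs_tanh_le_1[of "t / R"] R by (simp add: add_increasing2)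
    show "\<bar>bell (t / R) / R\<bar> \<le> 1 + 1 / R" for t
      using bell_le_1[of "t / R"] bell_nonneg[of "t / R"] R by (simp add: abs_mult divide_right_mono add_increasing)
  qed
  then have "(2 + s) * (\<integral>x. ip d u x * wt d u s x * tanh ((ip d x \<delta> + z) / R) \<partial>gauss d) =
    ip d u \<delta> / R * (\<integral>x. wt d u s x * bell ((ip d x \<delta> + z) / R) \<partial>gauss d)" for z
    by simp
  then have "(\<integral>z. (2 + s) * (\<integral>x. ip d u x * wt d u s x * tanh ((ip d x \<delta> + z) / R) \<partial>gauss d) \<partial>E) =
    (\<integral>z. ip d u \<delta> / R * (\<integral>x. wt d u s x * bell ((ip d x \<delta> + z) / R) \<partial>gauss d) \<partial>E)"
    by simp
  then show ?thesis
    unfolding ev_iterated(1)[OF m1 b1] ev_iterated(1)[OF m2 b2] by simp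
qed

end

subsection \<open>Statistical queries and families of directions\<close>

text \<open>The oracle accepts only values in [0, 1], so a signed \<phi> is asked as its positive
  and its negative part, two queries per index. The answers are handed on as a function, with 0 as
  filler outside the list.\<close>

primrec ask :: "'i list \<Rightarrow> ('i \<Rightarrow> 'a \<Rightarrow> real) \<Rightarrow> (('i \<Rightarrow> real) \<Rightarrow> ('a, 'b) sq_alg) \<Rightarrow> ('a, 'b) sq_alg" where
  "ask [] \<phi> k = k (\<lambda>_. 0)"
| "ask (u # us) \<phi> k =
     Query (\<lambda>x. max 0 (\<phi> u x)) (\<lambda>p. Query (\<lambda>x. max 0 (- \<phi> u x)) (\<lambda>q.
       ask us \<phi> (\<lambda>a. k (a(u := p - q)))))"

lemma sq_admissible_ask:
  assumes "\<And>u. u \<in> set us \<Longrightarrow> \<phi> u \<in> borel_measurable M"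
    and "\<And>u x. u \<in> set us \<Longrightarrow> \<bar>\<phi> u x\<bar> \<le> 1"
    and "\<And>a. sq_admissible M (k a)"
  shows "sq_admissible M (ask us \<phi> k)"
  using assms
proof (induction us arbitrary: k)
  case (Cons u us)
  have "\<phi> u x \<le> 1" "- \<phi> u x \<le> 1" for x using Cons.prems(2)[of u x] by auto
  moreover have "sq_admissible M (ask us \<phi> (\<lambda>a. k (a(u := p - q))))" for p q
    by (rule Cons.IH) (use Cons.prems in auto)
  ultimately show ?case using Cons.prems(1)[of u] by simp
qed simp

inductive_cases vstat_run_QueryE: "vstat_run m D (Query f k) n b"
inductive_cases vstat_run_ReturnE: "vstat_run m D (Return a) n b"

text \<open>Bounding p (1 - p) by p shows the feature of VSTAT that the fine step exploits: queries
  of small expectation are answered more accurately.\<close>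

lemma vstat_answer_error:
  assumes "vstat_answer m D f u" "0 < m" "0 \<le> integral\<^sup>L D f" "integral\<^sup>L D f \<le> q"
  shows "\<bar>u - integral\<^sup>L D f\<bar> \<le> 1 / m + sqrt (q / m)"
proof -
  let ?p = "integral\<^sup>L D f"
  have "?p * (1 - ?p) \<le> ?p" using assms(3) by (simp add: mult_left_le algebra_simps)
  then have "?p * (1 - ?p) / m \<le> q / m" using assms by (simp add: divide_right_mono)
  then have "sqrt (?p * (1 - ?p) / m) \<le> sqrt (q / m)" by simp
  moreover have "0 \<le> 1 / m" "0 \<le> sqrt (q / m)" using assms by auto
  ultimately have "max (1 / m) (sqrt (?p * (1 - ?p) / m)) \<le> 1 / m + sqrt (q / m)" by linarith
  then show ?thesis using assms(1) unfolding vstat_answer_def Let_def by linarith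
qed

lemma abs_diff_le:
  fixes p q P Q t :: real
  assumes "\<bar>p - P\<bar> \<le> t" "\<bar>q - Q\<bar> \<le> t" "P - Q = D"
  shows "\<bar>(p - q) - D\<bar> \<le> 2 * t"
  using assms by linarith

text \<open>Both parts of \<phi> have expectation at most E|\<phi>|, so the two oracle errors add up
  to the factor 2. A repeated index does no harm, since the value that overwrites the other one is a
  valid answer too.\<close>

lemma vstat_run_ask:
  assumes "vstat_run m D (ask us \<phi> k) n b" and m: "0 < m" and D: "prob_space D"
    and "\<And>u. u \<in> set us \<Longrightarrow> \<phi> u \<in> borel_measurable D"
    and "\<And>u x. u \<in> set us \<Longrightarrow> \<bar>\<phi> u x\<bar> \<le> 1"
  shows "\<exists>a n'. n = 2 * length us + n' \<and> vstat_run m D (k a) n' b \<and>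
    (\<forall>u\<in>set us. \<bar>a u - integral\<^sup>L D (\<phi> u)\<bar> \<le> 2 * (1 / m + sqrt ((\<integral>x. \<bar>\<phi> u x\<bar> \<partial>D) / m)))"
  using assms(1,4,5)
proof (induction us arbitrary: k n)
  case Nil
  then show ?case by auto
next
  case (Cons u us)
  let ?f = "\<lambda>x. max 0 (\<phi> u x)" and ?g = "\<lambda>x. max 0 (- \<phi> u x)"
  obtain p n1 where 1: "vstat_answer m D ?f p" "n = Suc n1"
    "vstat_run m D (Query ?g (\<lambda>q. ask us \<phi> (\<lambda>a. k (a(u := p - q))))) n1 b"
    using Cons.prems(1) by (auto elim: vstat_run_QueryE)
  obtain q n2 where 2: "vstat_answer m D ?g q" "n1 = Suc n2"
    "vstat_run m D (ask us \<phi> (\<lambda>a. k (a(u := p - q)))) n2 b"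
    using 1(3) by (auto elim: vstat_run_QueryE)
  have "\<exists>a n'. n2 = 2 * length us + n' \<and> vstat_run m D (k (a(u := p - q))) n' b \<and>
    (\<forall>u\<in>set us. \<bar>a u - integral\<^sup>L D (\<phi> u)\<bar> \<le> 2 * (1 / m + sqrt ((\<integral>x. \<bar>\<phi> u x\<bar> \<partial>D) / m)))"
    by (rule Cons.IH[OF 2(3)]) (use Cons.prems(2,3) in auto)
  then obtain a n' where 3: "n2 = 2 * length us + n'" "vstat_run m D (k (a(u := p - q))) n' b"
    "\<forall>u\<in>set us. \<bar>a u - integral\<^sup>L D (\<phi> u)\<bar> \<le> 2 * (1 / m + sqrt ((\<integral>x. \<bar>\<phi> u x\<bar> \<partial>D) / m))"
    by (elim exE conjE)
  have [measurable]: "\<phi> u \<in> borel_measurable D" using Cons.prems(2) by auto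
  have b: "\<bar>\<phi> u x\<bar> \<le> 1" for x using Cons.prems(3) by auto
  have int: "integrable D h" if [measurable]: "h \<in> borel_measurable D" and "\<And>x. \<bar>h x\<bar> \<le> 1" for h :: "_ \<Rightarrow> real"
    by (rule finite_measure.integrable_const_bound[OF prob_space.finite_measure[OF D], of _ 1]) (use that in auto)
  have if1: "integrable D ?f" by (rule int) (use b in \<open>simp_all add: abs_le_iff max_def\<close>)
  have if2: "integrable D ?g" by (rule int) (use b in \<open>simp_all add: abs_le_iff max_def\<close>)
  have if3: "integrable D (\<lambda>x. \<bar>\<phi> u x\<bar>)" by (rule int) (use b in auto)
  have "integral\<^sup>L D ?f - integral\<^sup>L D ?g = (\<integral>x. ?f x - ?g x \<partial>D)" using if1 if2 by simp
  also have "\<dots> = integral\<^sup>L D (\<phi> u)" by (rule Bochner_Integration.integral_cong) auto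
  finally have eq: "integral\<^sup>L D ?f - integral\<^sup>L D ?g = integral\<^sup>L D (\<phi> u)" .
  have "\<bar>p - integral\<^sup>L D ?f\<bar> \<le> 1 / m + sqrt ((\<integral>x. \<bar>\<phi> u x\<bar> \<partial>D) / m)"
    by (rule vstat_answer_error[OF 1(1) m]) (auto intro!: Bochner_Integration.integral_nonneg integral_mono if1 if3)
  moreover have "\<bar>q - integral\<^sup>L D ?g\<bar> \<le> 1 / m + sqrt ((\<integral>x. \<bar>\<phi> u x\<bar> \<partial>D) / m)"
    by (rule vstat_answer_error[OF 2(1) m]) (auto intro!: Bochner_Integration.integral_nonneg integral_mono if2 if3)
  ultimately have "\<bar>(p - q) - integral\<^sup>L D (\<phi> u)\<bar> \<le> 2 * (1 / m + sqrt ((\<integral>x. \<bar>\<phi> u x\<bar> \<partial>D) / m))"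
    by (rule abs_diff_le[OF _ _ eq])
  then have "\<forall>v\<in>set (u # us). \<bar>(a(u := p - q)) v - integral\<^sup>L D (\<phi> v)\<bar> \<le>
      2 * (1 / m + sqrt ((\<integral>x. \<bar>\<phi> v x\<bar> \<partial>D) / m))"
    using 3(3) by simp
  moreover have "n = 2 * length (u # us) + n'" using 1(2) 2(2) 3(1) by simp
  ultimately show ?case using 3(2) by blast
qed

lemma L2_set_le_of_sup_sum:
  assumes "\<And>i. i < d \<Longrightarrow> \<bar>e i\<bar> \<le> \<tau>" "(\<Sum>i<d. \<bar>e i\<bar>) \<le> S" "0 \<le> \<tau>"
  shows "(L2_set e {..<d})\<^sup>2 \<le> \<tau> * S"
proof -
  have "(L2_set e {..<d})\<^sup>2 = (\<Sum>i<d. \<bar>e i\<bar> * \<bar>e i\<bar>)"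
    by (simp add: L2_set_def sum_nonneg power2_eq_square)
  also have "\<dots> \<le> (\<Sum>i<d. \<tau> * \<bar>e i\<bar>)"
    by (intro sum_mono mult_right_mono assms) auto
  also have "\<dots> \<le> \<tau> * S" using assms by (simp add: sum_distrib_left[symmetric] mult_left_mono)
  finally show ?thesis .
qed

definition unit_vec :: "nat \<Rightarrow> nat \<Rightarrow> real" where
  "unit_vec i = (\<lambda>j. if j = i then 1 else 0)"

lemma ip_unit_vec: "i < d \<Longrightarrow> ip d (unit_vec i) x = x i"
  by (simp add: ip_def unit_vec_def if_distrib[where f = "\<lambda>c. c * _"] cong: if_cong)

lemma ip_unit_vec_self: "i < d \<Longrightarrow> ip d (unit_vec i) (unit_vec i) = 1"
  by (subst ip_unit_vec) (auto simp: unit_vec_def)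

text \<open>\<open>\<kappa>\<close> is the gain over the coordinate basis, for which it is 1. Unit
  length of the directions is what the weighted Stein identity asks for.\<close>

definition norming :: "nat \<Rightarrow> real \<Rightarrow> (nat \<Rightarrow> real) list \<Rightarrow> bool" where
  "norming d \<kappa> us \<longleftrightarrow> (\<forall>u\<in>set us. ip d u u = 1) \<and>
     (\<forall>e \<tau>. 0 \<le> \<tau> \<longrightarrow> (\<forall>u\<in>set us. \<bar>ip d u e\<bar> \<le> \<tau>) \<longrightarrow> L2_set e {..<d} \<le> sqrt d * \<tau> / \<kappa>)"

lemma norming_coords: "norming d 1 (map unit_vec [0..<d])"
  unfolding norming_def
proof (intro conjI allI impI ballI)
  fix u assume "u \<in> set (map unit_vec [0..<d])"
  then show "ip d u u = 1" by (auto simp: ip_unit_vec_self)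
next
  fix e :: "nat \<Rightarrow> real" and \<tau> :: real
  assume \<tau>: "0 \<le> \<tau>" and "\<forall>u\<in>set (map unit_vec [0..<d]). \<bar>ip d u e\<bar> \<le> \<tau>"
  then have e: "\<bar>e i\<bar> \<le> \<tau>" if "i < d" for i using that by (force simp: ip_unit_vec)
  have "(\<Sum>i<d. \<bar>e i\<bar>) \<le> (\<Sum>i<d. \<tau>)" by (intro sum_mono e) auto
  from L2_set_le_of_sup_sum[OF e this \<tau>] have "(L2_set e {..<d})\<^sup>2 \<le> (sqrt d * \<tau>)\<^sup>2"
    by (simp add: power_mult_distrib power2_eq_square mult_ac)
  then have "L2_set e {..<d} \<le> sqrt d * \<tau>" by (rule power2_le_imp_le) (use \<tau> in simp)
  then show "L2_set e {..<d} \<le> sqrt d * \<tau> / 1" by simp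
qed

text \<open>
  Adding the sign vectors on the cyclic windows of length \<open>\<kappa>\<^sup>4\<close> controls the \<open>\<ell>\<^sub>1\<close> norm as well, and
  \<open>\<parallel>e\<parallel>\<^sub>2\<^sup>2 \<le> \<parallel>e\<parallel>\<^sub>1 \<parallel>e\<parallel>\<^sub>\<infinity>\<close> then gains a factor \<open>\<kappa>\<close> over what the coordinates alone give.
\<close>

lemma norming_windows:
  assumes "1 \<le> \<kappa>" "\<kappa> ^ 4 \<le> d"
  shows "\<exists>us. norming d (real \<kappa>) us \<and> length us \<le> (2 ^ (\<kappa> ^ 4) + 1) * d"
proof -
  define b where "b = \<kappa> ^ 4"
  have b: "1 \<le> b" "b \<le> d" using assms one_le_power[of \<kappa> 4] by (auto simp: b_def)
  then have d: "0 < d" by linarith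
  \<comment> \<open>Windows wrap around modulo d, so each coordinate lies in exactly b of the d
    windows.\<close>
  define S where "S k = (\<lambda>j. (k + j) mod d) ` {..<b}" for k :: nat
  have Sd: "S k \<subseteq> {..<d}" for k using d by (auto simp: S_def)
  have inj: "inj_on (\<lambda>j. (k + j) mod d) {..<d}" for k
  proof (rule linorder_inj_onI)
    fix i j :: nat assume ij: "i < j" "i \<in> {..<d}" "j \<in> {..<d}"
    show "(k + i) mod d \<noteq> (k + j) mod d"
    proof
      assume "(k + i) mod d = (k + j) mod d"
      then have "d dvd (k + j) - (k + i)" using ij by (subst mod_eq_dvd_iff_nat[symmetric]) auto
      then show False using ij by (auto dest: dvd_imp_le)
    qed
  qed auto
  then have injb: "inj_on (\<lambda>j. (k + j) mod d) {..<b}" for k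
    by (rule inj_on_subset) (use b in auto)
  \<comment> \<open>The entries are 1 / sqrt b in absolute value, which gives unit vectors. All sign
    patterns are taken because the signs of the error are unknown; the cost of 2^b per window is a
    constant once \<kappa> is fixed.\<close>
  define V where "V k = (\<lambda>\<sigma> i. if i \<in> S k then \<sigma> i else 0) ` (S k \<rightarrow>\<^sub>E {1 / real \<kappa> ^ 2, - 1 / real \<kappa> ^ 2})" for k
  have fin: "finite (S k)" for k by (simp add: S_def)
  have cardS: "card (S k) = b" for k unfolding S_def using card_image[OF injb] by simp
  have finV: "finite (V k)" for k unfolding V_def by (intro finite_imageI finite_PiE fin) auto
  have cardV: "card (V k) \<le> 2 ^ b" for k
  proof -
    have "card (V k) \<le> card (S k \<rightarrow>\<^sub>E {1 / real \<kappa> ^ 2, - 1 / real \<kappa> ^ 2})"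
      unfolding V_def by (rule card_image_le) (intro finite_PiE fin, auto)
    also have "\<dots> = card {1 / real \<kappa> ^ 2, - 1 / real \<kappa> ^ 2} ^ b" by (simp add: card_PiE fin cardS)
    also have "\<dots> \<le> 2 ^ b" by (intro power_mono) (auto simp: card_insert_if)
    finally show ?thesis .
  qed
  have finU: "finite (\<Union>k<d. V k)" using finV by auto
  have cardU: "card (\<Union>k<d. V k) \<le> d * 2 ^ b"
  proof -
    have "card (\<Union>k<d. V k) \<le> (\<Sum>k<d. card (V k))" by (rule card_UN_le) simp
    also have "\<dots> \<le> (\<Sum>k<d. 2 ^ b)" by (intro sum_mono cardV)
    finally show ?thesis by simp
  qed
  obtain vs where vs: "set vs = (\<Union>k<d. V k)" "distinct vs" using finite_distinct_list[OF finU] by auto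
  let ?us = "map unit_vec [0..<d] @ vs"
  have len: "length ?us \<le> (2 ^ b + 1) * d"
    using cardU vs distinct_card[OF vs(2)] by (simp add: algebra_simps)
  have k2: "(real \<kappa> ^ 2) ^ 2 = real b" by (simp add: b_def)
  have k0: "0 < real \<kappa>" using assms by simp
  have ipV: "ip d (\<lambda>i. if i \<in> S k then \<sigma> i else 0) x = (\<Sum>i\<in>S k. \<sigma> i * x i)" for k \<sigma> x
  proof -
    have "ip d (\<lambda>i. if i \<in> S k then \<sigma> i else 0) x = (\<Sum>i<d. if i \<in> S k then \<sigma> i * x i else 0)"
      unfolding ip_def by (rule sum.cong) auto
    also have "\<dots> = (\<Sum>i\<in>{..<d} \<inter> S k. \<sigma> i * x i)" by (simp add: sum.inter_restrict)
    also have "{..<d} \<inter> S k = S k" using Sd[of k] by auto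
    finally show ?thesis .
  qed
  have unit: "ip d u u = 1" if "u \<in> V k" for u k
  proof -
    obtain \<sigma> where \<sigma>: "\<sigma> \<in> S k \<rightarrow>\<^sub>E {1 / real \<kappa> ^ 2, - 1 / real \<kappa> ^ 2}" "u = (\<lambda>i. if i \<in> S k then \<sigma> i else 0)"
      using \<open>u \<in> V k\<close> by (auto simp: V_def)
    have "ip d u u = (\<Sum>i\<in>S k. \<sigma> i * u i)" unfolding \<sigma>(2) by (rule ipV)
    also have "\<dots> = (\<Sum>i\<in>S k. 1 / real b)"
    proof (rule sum.cong[OF refl])
      fix i assume i: "i \<in> S k"
      then have "\<sigma> i = 1 / real \<kappa> ^ 2 \<or> \<sigma> i = - 1 / real \<kappa> ^ 2" using \<sigma>(1) by auto
      then have "(\<sigma> i)\<^sup>2 = 1 / (real \<kappa> ^ 2) ^ 2" by (auto simp: power_divide)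
      then show "\<sigma> i * u i = 1 / real b" using i unfolding k2 by (simp add: \<sigma>(2) power2_eq_square)
    qed
    also have "\<dots> = 1" using b by (simp add: cardS)
    finally show ?thesis .
  qed
  have "norming d (real \<kappa>) ?us"
    unfolding norming_def
  proof (intro conjI allI impI ballI)
    fix u assume "u \<in> set ?us"
    then show "ip d u u = 1" using vs unit by (auto simp: ip_unit_vec_self)
  next
    fix e :: "nat \<Rightarrow> real" and \<tau> :: real
    assume \<tau>: "0 \<le> \<tau>" and us: "\<forall>u\<in>set ?us. \<bar>ip d u e\<bar> \<le> \<tau>"
    have e: "\<bar>e i\<bar> \<le> \<tau>" if "i < d" for i
    proof -
      have "unit_vec i \<in> set ?us" using that by auto
      then show ?thesis using us that by (force simp: ip_unit_vec)
    qed
    have win: "(\<Sum>i\<in>S k. \<bar>e i\<bar>) \<le> real \<kappa> ^ 2 * \<tau>" if "k < d" for k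
    proof -
      define \<sigma> where "\<sigma> = (\<lambda>i\<in>S k. if 0 \<le> e i then 1 / real \<kappa> ^ 2 else - 1 / real \<kappa> ^ 2)"
      let ?u = "\<lambda>i. if i \<in> S k then \<sigma> i else 0"
      have "\<sigma> \<in> S k \<rightarrow>\<^sub>E {1 / real \<kappa> ^ 2, - 1 / real \<kappa> ^ 2}" by (auto simp: \<sigma>_def)
      then have "?u \<in> set ?us" using that vs by (auto simp: V_def)
      then have "\<bar>ip d ?u e\<bar> \<le> \<tau>" using us by blast
      moreover have "ip d ?u e = (\<Sum>i\<in>S k. \<bar>e i\<bar> / real \<kappa> ^ 2)"
        unfolding ipV by (rule sum.cong) (auto simp: \<sigma>_def)
      ultimately have "(\<Sum>i\<in>S k. \<bar>e i\<bar>) / real \<kappa> ^ 2 \<le> \<tau>"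
        by (simp add: sum_divide_distrib[symmetric] abs_le_iff)
      then show ?thesis using k0 by (simp add: divide_le_eq mult.commute)
    qed
    \<comment> \<open>Double counting over the windows: b \<parallel>e\<parallel>_1 is the sum of
      the d window norms, each at most \<kappa>^2 \<tau>. Since b = \<kappa>^4, this gives
      \<parallel>e\<parallel>_1 \<le> d \<tau> / \<kappa>^2.\<close>
    have "real b * (\<Sum>i<d. \<bar>e i\<bar>) = (\<Sum>j<b. \<Sum>k<d. \<bar>e ((k + j) mod d)\<bar>)"
    proof -
      have "(\<Sum>k<d. \<bar>e ((k + j) mod d)\<bar>) = (\<Sum>i<d. \<bar>e i\<bar>)" for j
      proof -
        have "(\<lambda>k. (j + k) mod d) ` {..<d} = {..<d}"
          by (rule card_subset_eq) (use d in \<open>auto simp: card_image[OF inj]\<close>)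
        then have "bij_betw (\<lambda>k. (j + k) mod d) {..<d} {..<d}" using inj[of j] by (simp add: bij_betw_def)
        from sum.reindex_bij_betw[OF this, of "\<lambda>i. \<bar>e i\<bar>"] show ?thesis by (simp add: add.commute)
      qed
      then show ?thesis by simp
    qed
    also have "\<dots> = (\<Sum>k<d. \<Sum>j<b. \<bar>e ((k + j) mod d)\<bar>)" by (rule sum.swap)
    also have "\<dots> = (\<Sum>k<d. \<Sum>i\<in>S k. \<bar>e i\<bar>)"
      unfolding S_def by (simp add: sum.reindex[OF injb])
    also have "\<dots> \<le> (\<Sum>k<d. real \<kappa> ^ 2 * \<tau>)" by (intro sum_mono win) auto
    also have "\<dots> = d * (real \<kappa> ^ 2 * \<tau>)" by simp
    finally have *: "real b * (\<Sum>i<d. \<bar>e i\<bar>) \<le> d * (real \<kappa> ^ 2 * \<tau>)" .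
    have cancel: "y \<le> z / K" if "b' * y \<le> z * K" "K\<^sup>2 = b'" "0 < K" for b' y z K :: real
    proof -
      have "K * (K * y) \<le> K * z" using that(1) unfolding that(2)[symmetric] by (simp add: power2_eq_square mult_ac)
      then have "K * y \<le> z" using that(3) by simp
      then show ?thesis using that(3) by (simp add: pos_le_divide_eq mult.commute)
    qed
    have "(\<Sum>i<d. \<bar>e i\<bar>) \<le> d * \<tau> / real \<kappa> ^ 2"
      by (rule cancel[OF _ k2]) (use * k0 in \<open>simp_all add: mult_ac\<close>)
    note L2_set_le_of_sup_sum[OF e this \<tau>]
    also have "\<tau> * (d * \<tau> / real \<kappa> ^ 2) = (sqrt d * \<tau> / real \<kappa>)\<^sup>2"
      by (simp add: power_mult_distrib power_divide power2_eq_square[of \<tau>])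
    finally have "(L2_set e {..<d})\<^sup>2 \<le> (sqrt d * \<tau> / real \<kappa>)\<^sup>2" .
    then show "L2_set e {..<d} \<le> sqrt d * \<tau> / real \<kappa>" by (rule power2_le_imp_le) (use \<tau> k0 in simp)
  qed
  then show ?thesis using len by (auto simp: b_def)
qed

text \<open>The candidates e that explain the measured numerators \<open>a u\<close> through the
  measured denominators \<open>c u\<close>. Estimating every u\<cdot>\<delta> separately by a
  quotient would leave values which, for overlapping directions, need not come from a single vector;
  any consistent e will do instead.\<close>

definition consistent :: "nat \<Rightarrow> (nat \<Rightarrow> real) list \<Rightarrow> ((nat \<Rightarrow> real) \<Rightarrow> real) \<Rightarrow> ((nat \<Rightarrow> real) \<Rightarrow> real) \<Rightarrow>
    real \<Rightarrow> real \<Rightarrow> real \<Rightarrow> (nat \<Rightarrow> real) \<Rightarrow> bool" where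
  "consistent d us a c \<rho> T r e \<longleftrightarrow>
     L2_set e {..<d} \<le> r \<and> (\<forall>u\<in>set us. \<bar>a u - ip d u e / \<rho> * c u\<bar> \<le> T)"

lemma abs_ip_unit_le:
  assumes "ip d u u = 1" shows "\<bar>ip d u x\<bar> \<le> L2_set x {..<d}"
proof -
  have "L2_set u {..<d} = 1"
    using assms by (simp add: ip_self power2_eq_1_iff) (use L2_set_nonneg[of u "{..<d}"] in linarith)
  then show ?thesis using abs_ip_le[of d u x] by simp
qed

text \<open>The true error vector passes the test: the exact identity is perturbed by t through the
  numerator and by at most (r / \<rho>) t through the denominator.\<close>

lemma consistentI:
  assumes "L2_set \<delta> {..<d} \<le> r" "0 < \<rho>" and u: "\<And>u. u \<in> set us \<Longrightarrow> ip d u u = 1"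
    and eq: "\<And>u. u \<in> set us \<Longrightarrow> A u = ip d u \<delta> / \<rho> * C u"
    and err: "\<And>u. u \<in> set us \<Longrightarrow> \<bar>a u - A u\<bar> \<le> t" "\<And>u. u \<in> set us \<Longrightarrow> \<bar>c u - C u\<bar> \<le> t"
    and T: "t * (1 + r / \<rho>) \<le> T"
  shows "consistent d us a c \<rho> T r \<delta>"
  unfolding consistent_def
proof (intro conjI ballI assms(1))
  fix u assume us: "u \<in> set us"
  have "\<bar>ip d u \<delta> / \<rho> * (C u - c u)\<bar> \<le> r / \<rho> * t"
    unfolding abs_mult
  proof (rule mult_mono)
    show "\<bar>ip d u \<delta> / \<rho>\<bar> \<le> r / \<rho>"
      using abs_ip_unit_le[OF u[OF us], of \<delta>] assms(1,2) by (simp add: divide_right_mono)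
    show "\<bar>C u - c u\<bar> \<le> t" using err(2)[OF us] by (simp add: abs_minus_commute)
    show "0 \<le> r / \<rho>" using order_trans[OF L2_set_nonneg assms(1)] assms(2) by simp
  qed simp
  moreover have "a u - ip d u \<delta> / \<rho> * c u = (a u - A u) + ip d u \<delta> / \<rho> * (C u - c u)"
    unfolding eq[OF us] by (simp add: right_diff_distrib)
  ultimately have "\<bar>a u - ip d u \<delta> / \<rho> * c u\<bar> \<le> t + r / \<rho> * t"
    using err(1)[OF us] by (simp only:)
  then show "\<bar>a u - ip d u \<delta> / \<rho> * c u\<bar> \<le> T"
    using T by (simp add: algebra_simps)
qed

text \<open>Two vectors that explain the same answers have predictions within 2 T of each other; a
  lower bound on the measured denominator permits division. It is applied to the true error and the
  chosen candidate.\<close>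

lemma consistent_diff:
  assumes "consistent d us a c \<rho> T r \<delta>" "consistent d us a c \<rho> T r e" "0 < \<rho>" "0 < n"
    and u: "u \<in> set us" and "n \<le> c u"
  shows "\<bar>ip d u (\<lambda>i. \<delta> i - e i)\<bar> \<le> 2 * \<rho> * T / n"
proof -
  let ?y = "ip d u (\<lambda>i. \<delta> i - e i)"
  have "\<bar>y - z\<bar> \<le> 2 * T" if "\<bar>x - y\<bar> \<le> T" "\<bar>x - z\<bar> \<le> T" for x y z :: real
    using that by linarith
  moreover have "\<bar>a u - ip d u \<delta> / \<rho> * c u\<bar> \<le> T" "\<bar>a u - ip d u e / \<rho> * c u\<bar> \<le> T"
    using assms(1,2) u by (auto simp: consistent_def)
  ultimately have "\<bar>ip d u \<delta> / \<rho> * c u - ip d u e / \<rho> * c u\<bar> \<le> 2 * T" by blast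
  also have "ip d u \<delta> / \<rho> * c u - ip d u e / \<rho> * c u = ?y / \<rho> * c u"
    by (simp add: ip_diff_right diff_divide_distrib algebra_simps)
  finally have "\<bar>?y\<bar> / \<rho> * c u \<le> 2 * T" using assms by (simp add: abs_mult)
  moreover have "\<bar>?y\<bar> / \<rho> * n \<le> \<bar>?y\<bar> / \<rho> * c u" using assms by (intro mult_left_mono) auto
  ultimately have "\<bar>?y\<bar> / \<rho> * n \<le> 2 * T" by linarith
  then show ?thesis using assms by (simp add: field_simps)
qed

lemma L2_set_diff_le: "L2_set (\<lambda>i. x i - y i) A \<le> L2_set x A + L2_set y A" for x y :: "'a \<Rightarrow> real"
  using L2_set_triangle_ineq[of x "\<lambda>i. - y i" A] by (simp add: L2_set_def)

subsection \<open>Moments of the weights\<close>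

abbreviation wt_mass :: "nat \<Rightarrow> (nat \<Rightarrow> real) \<Rightarrow> real \<Rightarrow> real" where
  "wt_mass d u s \<equiv> \<integral>x. wt d u s x \<partial>gauss d"

text \<open>The demands of the fine step on w: enough mass, at least half of it surviving at the
  narrow scale \<mu> r, and a bounded price for shifts at the wide scale R. With R = r / h^4 and L =
  1 / h^4 the last premise reads |\<delta>| \<le> 2 r. The 100 leaves room for both weights used
  below, which need 12 and 82.\<close>

definition good_weight :: "nat \<Rightarrow> real \<Rightarrow> real \<Rightarrow> real \<Rightarrow> real \<Rightarrow> bool" where
  "good_weight d s \<mu> \<omega> L\<^sub>0 \<longleftrightarrow> (\<forall>u. ip d u u = 1 \<longrightarrow>
     \<omega> \<le> wt_mass d u s \<and>
     (\<forall>r \<delta>. 0 < r \<longrightarrow> L2_set \<delta> {..<d} \<le> r \<longrightarrow>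
        wt_mass d u s / 2 \<le> (\<integral>x. wt d u s x * bell (ip d x \<delta> / (\<mu> * r)) \<partial>gauss d)) \<and>
     (\<forall>L R \<delta>. L\<^sub>0 \<le> L \<longrightarrow> 0 < R \<longrightarrow> L2_set \<delta> {..<d} \<le> 2 * R / L \<longrightarrow>
        integrable (gauss d) (\<lambda>x. wt d u s x * exp (2 * \<bar>ip d x \<delta>\<bar> / R)) \<and>
        (\<integral>x. wt d u s x * exp (2 * \<bar>ip d x \<delta>\<bar> / R) \<partial>gauss d) \<le> 100 * wt_mass d u s))"

lemma integrable_wt: "0 \<le> s \<Longrightarrow> integrable (gauss d) (wt d u s)"
  using wt_le_1 wt_pos by (intro gauss_integrable_bounded[of _ _ 1]) (auto simp: abs_of_pos)

lemma integrable_wt_bell: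
  assumes "0 \<le> s" shows "integrable (gauss d) (\<lambda>x. wt d u s x * bell (ip d x \<delta> / R))"
proof (rule gauss_integrable_bounded[of _ _ 1])
  show "\<bar>wt d u s x * bell (ip d x \<delta> / R)\<bar> \<le> 1" for x
    using mult_mono[OF wt_le_1[OF assms, of d u x] bell_le_1[of "ip d x \<delta> / R"]]
      wt_pos[of d u s x] bell_nonneg[of "ip d x \<delta> / R"]
    by (simp add: abs_mult)
qed measurable

lemma exp_le_1_plus_double: "0 \<le> x \<Longrightarrow> x \<le> 1 / 2 \<Longrightarrow> exp x \<le> 1 + 2 * x" for x :: real
  using exp_bound_lemma[of x] by simp

lemma gauss_second_moment_le:
  assumes "L2_set a {..<d} \<le> c" "c \<le> 1"
  shows "(\<integral>x. (ip d x a)\<^sup>2 \<partial>gauss d) \<le> 2 * c\<^sup>2"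
proof -
  have c: "0 \<le> c" using order_trans[OF L2_set_nonneg assms(1)] .
  have 1: "(L2_set a {..<d})\<^sup>2 \<le> c\<^sup>2" by (rule power_mono[OF assms(1)]) simp
  have 2: "c\<^sup>2 \<le> 1" using assms(2) c by (simp add: power_le_one)
  have "exp ((L2_set a {..<d})\<^sup>2 / 2) \<le> 1 + 2 * ((L2_set a {..<d})\<^sup>2 / 2)"
    using 1 2 by (intro exp_le_1_plus_double) auto
  then show ?thesis using gauss_second_moment(2)[of d a] 1 by simp
qed

lemma ip_divide: "ip d x (\<lambda>i. a i / c) = ip d x a / c"
  by (simp add: ip_def sum_divide_distrib)

lemma L2_set_divide: "0 < c \<Longrightarrow> L2_set (\<lambda>i. a i / c) A = L2_set a A / c"
  using L2_set_left_distrib[of "1 / c" a A] by simp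

lemma exp_half_le: "exp (1 / 2 :: real) \<le> 7 / 4"
proof -
  have "(exp (1 / 2 :: real))\<^sup>2 = exp 1" by (simp add: exp_double[symmetric])
  also have "\<dots> \<le> 3" by (rule exp_le)
  also have "\<dots> \<le> (7 / 4)\<^sup>2" by (simp add: power2_eq_square)
  finally show ?thesis by (rule power2_le_imp_le) simp
qed

lemma gauss_second_moment_unit:
  assumes "ip d u u = 1" shows "(\<integral>x. (ip d u x)\<^sup>2 \<partial>gauss d) \<le> 3 / 2"
proof -
  have "ip d u x = ip d x u" for x by (rule ip_commute)
  moreover have "(L2_set u {..<d})\<^sup>2 = 1" using assms by (simp only: ip_self)
  ultimately show ?thesis using gauss_second_moment(2)[of d u] exp_half_le by simp
qed

lemma wt0_ge: "1 - (ip d u x)\<^sup>2 / 2 \<le> wt d u 0 x"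
  using exp_ge_add_one_self[of "- (ip d u x)\<^sup>2 / 2"] by (simp add: wt_def)

lemma integrable_ip_sq: "integrable (gauss d) (\<lambda>x. (ip d u x)\<^sup>2)"
  using gauss_second_moment(1)[of d u] unfolding ip_commute[of d _ u] .

lemma integrable_gauss_const: "integrable (gauss d) (\<lambda>x. c :: real)"
  by (rule gauss_integrable_bounded[of _ _ "\<bar>c\<bar>"]) auto

lemma wt0_mass_ge:
  assumes "ip d u u = 1" shows "1 / 4 \<le> wt_mass d u 0"
proof -
  have "1 / 4 \<le> (\<integral>x. 1 - (ip d u x)\<^sup>2 / 2 \<partial>gauss d)"
    using gauss_second_moment_unit[OF assms] integrable_ip_sq[of d u] integrable_gauss_const[of d 1]
    by (simp add: prob_space.prob_space[OF prob_space_gauss])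
  also have "\<dots> \<le> wt_mass d u 0"
    using integrable_ip_sq[of d u] integrable_gauss_const[of d 1]
    by (intro integral_mono integrable_wt wt0_ge) auto
  finally show ?thesis .
qed

text \<open>The exponential is linearised with exp y \<ge> 1 + y and 2 |t| \<le> 1/16 + 16 t^2. The
  second moments are at most 3/2 and 2/256, which leaves 1 - 3/4 - 1/16 - 1/8 = 1/16.\<close>

lemma wt0_exp_ge:
  assumes u: "ip d u u = 1" and R: "0 < R" and \<delta>: "L2_set \<delta> {..<d} \<le> R / 16"
  shows "1 / 16 \<le> (\<integral>x. wt d u 0 x * exp (- (2 * \<bar>ip d x \<delta>\<bar> / R)) \<partial>gauss d)"
proof -
  let ?h = "\<lambda>x. ip d x (\<lambda>i. \<delta> i / R)"
  have h2: "(\<integral>x. (?h x)\<^sup>2 \<partial>gauss d) \<le> 2 * (1 / 16)\<^sup>2"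
    by (rule gauss_second_moment_le) (use \<delta> R in \<open>auto simp: L2_set_divide pos_divide_le_eq\<close>)
  note hI = gauss_second_moment(1)[of d "\<lambda>i. \<delta> i / R"]
  have pt: "1 - (ip d u x)\<^sup>2 / 2 - 1 / 16 - 16 * (?h x)\<^sup>2 \<le> wt d u 0 x * exp (- (2 * \<bar>ip d x \<delta>\<bar> / R))" for x
  proof -
    have "2 * \<bar>t\<bar> \<le> 1 / 16 + 16 * t\<^sup>2" for t :: real
      using zero_le_power2[of "4 * \<bar>t\<bar> - 1 / 4"] by (simp add: power2_diff power_mult_distrib power_divide)
    from this[of "?h x"] have "1 - (ip d u x)\<^sup>2 / 2 - 1 / 16 - 16 * (?h x)\<^sup>2 \<le> 1 + (- (ip d u x)\<^sup>2 / 2 - 2 * \<bar>?h x\<bar>)" by simp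
    also have "\<dots> \<le> exp (- (ip d u x)\<^sup>2 / 2 - 2 * \<bar>?h x\<bar>)" by (rule exp_ge_add_one_self)
    also have "\<dots> = wt d u 0 x * exp (- (2 * \<bar>ip d x \<delta>\<bar> / R))"
      using R by (simp add: wt_def exp_add[symmetric] ip_divide abs_mult)
    finally show ?thesis .
  qed
  have "1 / 16 \<le> (\<integral>x. 1 - (ip d u x)\<^sup>2 / 2 - 1 / 16 - 16 * (?h x)\<^sup>2 \<partial>gauss d)"
    using gauss_second_moment_unit[OF u] integrable_ip_sq[of d u] integrable_gauss_const hI h2
    by (simp add: prob_space.prob_space[OF prob_space_gauss] power2_eq_square[of "1 / 16 :: real"])
  also have "\<dots> \<le> (\<integral>x. wt d u 0 x * exp (- (2 * \<bar>ip d x \<delta>\<bar> / R)) \<partial>gauss d)"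
  proof (rule integral_mono[OF _ _ pt])
    show "integrable (gauss d) (\<lambda>x. 1 - (ip d u x)\<^sup>2 / 2 - 1 / 16 - 16 * (?h x)\<^sup>2)"
      using integrable_ip_sq[of d u] integrable_gauss_const hI by simp
    show "integrable (gauss d) (\<lambda>x. wt d u 0 x * exp (- (2 * \<bar>ip d x \<delta>\<bar> / R)))"
    proof (rule gauss_integrable_bounded[of _ _ 1])
      show "\<bar>wt d u 0 x * exp (- (2 * \<bar>ip d x \<delta>\<bar> / R))\<bar> \<le> 1" for x
        using mult_mono[OF wt_le_1[of 0 d u x], of "exp (- (2 * \<bar>ip d x \<delta>\<bar> / R))" 1] R wt_pos[of d u 0 x]
        by (simp add: abs_mult abs_of_pos)
    qed measurable
  qed
  finally show ?thesis .
qed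

lemma gauss_exp_abs_le:
  assumes R: "0 < R" and \<delta>: "L2_set \<delta> {..<d} \<le> R / 8"
  shows "integrable (gauss d) (\<lambda>x. exp (2 * \<bar>ip d x \<delta>\<bar> / R))"
    and "(\<integral>x. exp (2 * \<bar>ip d x \<delta>\<bar> / R) \<partial>gauss d) \<le> 3"
proof -
  show "integrable (gauss d) (\<lambda>x. exp (2 * \<bar>ip d x \<delta>\<bar> / R))"
    using gauss_exp_abs(1)[of d "2 / R" \<delta>] by simp
  have "(L2_set \<delta> {..<d})\<^sup>2 \<le> (R / 8)\<^sup>2" by (rule power_mono[OF \<delta>]) simp
  then have "(2 / R)\<^sup>2 * (L2_set \<delta> {..<d})\<^sup>2 / 2 \<le> 1 / 32"
    using R by (simp add: power_divide field_simps)
  then have "exp ((2 / R)\<^sup>2 * (L2_set \<delta> {..<d})\<^sup>2 / 2) \<le> exp (1 / 32)" by simp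
  also have "\<dots> \<le> 1 + 2 * (1 / 32 :: real)" by (rule exp_le_1_plus_double) auto
  finally show "(\<integral>x. exp (2 * \<bar>ip d x \<delta>\<bar> / R) \<partial>gauss d) \<le> 3"
    using gauss_exp_abs(2)[of d "2 / R" \<delta>] by simp
qed

text \<open>For \<mu> = 4 the mean of (x\<cdot>\<delta> / (4 r))^2 is at most 1/8, half of the
  guaranteed mass 1/4. L \<ge> 16 gives |\<delta>| \<le> R / 8, where the exponential moment is at
  most 3.\<close>

lemma good_weight_high: "good_weight d 0 4 (1 / 4) 16"
  unfolding good_weight_def
proof (intro allI impI conjI)
  fix u assume u: "ip d u u = 1"
  note W = wt0_mass_ge[OF u]
  show "1 / 4 \<le> wt_mass d u 0" by (rule W)
  show "wt_mass d u 0 / 2 \<le> (\<integral>x. wt d u 0 x * bell (ip d x \<delta> / (4 * r)) \<partial>gauss d)"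
    if r: "0 < r" and \<delta>: "L2_set \<delta> {..<d} \<le> r" for r \<delta>
  proof -
    let ?h = "\<lambda>x. ip d x (\<lambda>i. \<delta> i / (4 * r))"
    have h2: "(\<integral>x. (?h x)\<^sup>2 \<partial>gauss d) \<le> 2 * (1 / 4)\<^sup>2"
      by (rule gauss_second_moment_le) (use \<delta> r in \<open>auto simp: L2_set_divide pos_divide_le_eq\<close>)
    note hI = gauss_second_moment(1)[of d "\<lambda>i. \<delta> i / (4 * r)"]
    have pt: "wt d u 0 x - (?h x)\<^sup>2 \<le> wt d u 0 x * bell (ip d x \<delta> / (4 * r))" for x
    proof -
      have "wt d u 0 x * (1 - (?h x)\<^sup>2) \<le> wt d u 0 x * bell (?h x)"
        by (intro mult_left_mono bell_ge less_imp_le[OF wt_pos])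
      moreover have "wt d u 0 x * (?h x)\<^sup>2 \<le> 1 * (?h x)\<^sup>2"
        by (intro mult_right_mono wt_le_1) auto
      ultimately show ?thesis by (simp add: ip_divide algebra_simps)
    qed
    have "wt_mass d u 0 / 2 \<le> (\<integral>x. wt d u 0 x - (?h x)\<^sup>2 \<partial>gauss d)"
      using W h2 hI integrable_wt[of 0 d u] by (simp add: power2_eq_square)
    also have "\<dots> \<le> (\<integral>x. wt d u 0 x * bell (ip d x \<delta> / (4 * r)) \<partial>gauss d)"
      using integrable_wt_bell[of 0 d u \<delta> "4 * r"] hI integrable_wt[of 0 d u]
      by (intro integral_mono[OF _ _ pt]) auto
    finally show ?thesis .
  qed
  fix L R :: real and \<delta> :: "nat \<Rightarrow> real"
  assume L: "16 \<le> L" and R: "0 < R" and \<delta>: "L2_set \<delta> {..<d} \<le> 2 * R / L"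
  have "2 * R / L \<le> 2 * R / 16" using L R by (intro divide_left_mono) auto
  then have \<delta>': "L2_set \<delta> {..<d} \<le> R / 8" using \<delta> by simp
  note e = gauss_exp_abs_le[OF R \<delta>']
  have pt: "wt d u 0 x * exp (2 * \<bar>ip d x \<delta>\<bar> / R) \<le> exp (2 * \<bar>ip d x \<delta>\<bar> / R)" for x
    using mult_right_mono[OF wt_le_1[of 0 d u x], of "exp (2 * \<bar>ip d x \<delta>\<bar> / R)"] by simp
  show I: "integrable (gauss d) (\<lambda>x. wt d u 0 x * exp (2 * \<bar>ip d x \<delta>\<bar> / R))"
    by (rule Bochner_Integration.integrable_bound[OF e(1)])
      (use pt wt_pos[of d u 0] in \<open>auto simp: abs_mult abs_of_pos\<close>)
  have "(\<integral>x. wt d u 0 x * exp (2 * \<bar>ip d x \<delta>\<bar> / R) \<partial>gauss d) \<le> 3"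
    using integral_mono[OF I e(1) pt] e(2) by linarith
  then show "(\<integral>x. wt d u 0 x * exp (2 * \<bar>ip d x \<delta>\<bar> / R) \<partial>gauss d) \<le> 100 * wt_mass d u 0"
    using W by linarith
qed

lemma wt_ge_exp_norm:
  assumes "ip d u u = 1" shows "exp (- ((1 + s) * ip d x x) / 2) \<le> wt d u s x"
proof -
  have "\<bar>ip d u x\<bar>\<^sup>2 \<le> (L2_set x {..<d})\<^sup>2"
    by (rule power_mono[OF abs_ip_unit_le[OF assms]]) simp
  then have "(ip d u x)\<^sup>2 \<le> ip d x x" by (simp add: ip_self)
  then have "(ip d u x)\<^sup>2 + s * ip d x x \<le> (1 + s) * ip d x x" by (simp add: distrib_right)
  then show ?thesis by (simp add: wt_def)
qed

lemma exp_norm_mass_pos: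
  assumes "0 \<le> s" shows "0 < (\<integral>x. exp (- (s * ip d x x) / 2) \<partial>gauss d)"
proof -
  let ?f = "\<lambda>x. exp (- (s * ip d x x) / 2)"
  have I: "integrable (gauss d) ?f"
    using assms by (intro gauss_integrable_bounded[of _ _ 1]) (auto simp: ip_self_nonneg)
  have "0 \<le> integral\<^sup>L (gauss d) ?f" by (rule Bochner_Integration.integral_nonneg) simp
  moreover have "integral\<^sup>L (gauss d) ?f \<noteq> 0"
  proof
    assume "integral\<^sup>L (gauss d) ?f = 0"
    then have "AE x in gauss d. ?f x = 0"
      using integral_nonneg_eq_0_iff_AE[OF I] by simp
    then have "AE x in gauss d. False" by simp
    then show False using prob_space.AE_False[OF prob_space_gauss] by simp
  qed
  ultimately show ?thesis by linarith
qed

text \<open>The tilt makes the weighted mean of |x|^2 at most d / (1 + s) \<le> \<mu>^2 / 2, so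
  x\<cdot>\<delta> is mostly below \<mu> r even for tiny \<mu>. The price is a small mass \<omega>,
  which enters the threshold for L only logarithmically.\<close>

lemma good_weight_low:
  assumes \<mu>: "0 < \<mu>" and s: "1 \<le> s" "2 * real d \<le> \<mu>\<^sup>2 * (1 + s)" and \<omega>: "0 < \<omega>"
    and mass: "\<omega> \<le> (\<integral>x. exp (- ((1 + s) * ip d x x) / 2) \<partial>gauss d)"
  shows "good_weight d s \<mu> \<omega> (max 2 (4 - ln \<omega>))"
  unfolding good_weight_def
proof (intro allI impI conjI)
  fix u assume u: "ip d u u = 1"
  have s0: "0 \<le> s" using s by simp
  have IW: "integrable (gauss d) (wt d u s)" by (rule integrable_wt[OF s0])
  show W: "\<omega> \<le> wt_mass d u s"
  proof (rule order_trans[OF mass], rule integral_mono[OF _ IW wt_ge_exp_norm[OF u]])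
    show "integrable (gauss d) (\<lambda>x. exp (- ((1 + s) * ip d x x) / 2))"
      using s0 by (intro gauss_integrable_bounded[of _ _ 1]) (auto simp: ip_self_nonneg)
  qed
  show "wt_mass d u s / 2 \<le> (\<integral>x. wt d u s x * bell (ip d x \<delta> / (\<mu> * r)) \<partial>gauss d)"
    if r: "0 < r" and \<delta>: "L2_set \<delta> {..<d} \<le> r" for r \<delta>
  proof -
    have pt: "wt d u s x - 1 / \<mu>\<^sup>2 * (ip d x x * wt d u s x) \<le> wt d u s x * bell (ip d x \<delta> / (\<mu> * r))" for x
    proof -
      have "\<bar>ip d x \<delta>\<bar> \<le> L2_set x {..<d} * r"
        using abs_ip_le[of d x \<delta>] mult_left_mono[OF \<delta> L2_set_nonneg[of x "{..<d}"]] by linarith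
      then have "\<bar>ip d x \<delta>\<bar>\<^sup>2 \<le> (L2_set x {..<d} * r)\<^sup>2" by (rule power_mono) simp
      then have "(ip d x \<delta> / (\<mu> * r))\<^sup>2 \<le> ip d x x / \<mu>\<^sup>2"
        using r \<mu> by (simp add: ip_self power_mult_distrib power_divide field_simps)
      then have "1 - ip d x x / \<mu>\<^sup>2 \<le> bell (ip d x \<delta> / (\<mu> * r))" using bell_ge[of "ip d x \<delta> / (\<mu> * r)"] by linarith
      from mult_left_mono[OF this less_imp_le[OF wt_pos[of d u s x]]] show ?thesis by (simp add: algebra_simps)
    qed
    have "2 * ((1 + s) * (\<integral>x. ip d x x * wt d u s x \<partial>gauss d)) \<le> 2 * (real d * wt_mass d u s)"
      by (intro mult_left_mono wt_second_moment(2)[OF u s(1)]) simp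
    also have "\<dots> = 2 * real d * wt_mass d u s" by simp
    also have "\<dots> \<le> \<mu>\<^sup>2 * (1 + s) * wt_mass d u s"
      using s(2) W \<omega> by (intro mult_right_mono) auto
    finally have "(1 + s) * (2 * (\<integral>x. ip d x x * wt d u s x \<partial>gauss d)) \<le> (1 + s) * (\<mu>\<^sup>2 * wt_mass d u s)"
      by (simp add: mult_ac)
    then have "2 * (\<integral>x. ip d x x * wt d u s x \<partial>gauss d) \<le> \<mu>\<^sup>2 * wt_mass d u s"
      using s0 by (subst (asm) mult_le_cancel_left_pos) auto
    then have "1 / \<mu>\<^sup>2 * (\<integral>x. ip d x x * wt d u s x \<partial>gauss d) \<le> wt_mass d u s / 2"
      using \<mu> by (simp add: field_simps)
    then have "wt_mass d u s / 2 \<le> (\<integral>x. wt d u s x - 1 / \<mu>\<^sup>2 * (ip d x x * wt d u s x) \<partial>gauss d)"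
      using IW wt_second_moment(1)[OF u s(1)] by simp
    also have "\<dots> \<le> (\<integral>x. wt d u s x * bell (ip d x \<delta> / (\<mu> * r)) \<partial>gauss d)"
      using integrable_wt_bell[OF s0, of d u \<delta> "\<mu> * r"] IW wt_second_moment(1)[OF u s(1)]
      by (intro integral_mono[OF _ _ pt]) auto
    finally show ?thesis .
  qed
  fix L R :: real and \<delta> :: "nat \<Rightarrow> real"
  assume L: "max 2 (4 - ln \<omega>) \<le> L" and R: "0 < R" and \<delta>: "L2_set \<delta> {..<d} \<le> 2 * R / L"
  have L2: "2 \<le> L" and Lw: "4 - L \<le> ln \<omega>" using L by auto
  have e4: "exp (4 :: real) \<le> 81"
  proof -
    have "exp (4 :: real) = exp 1 ^ 4" by (simp add: exp_of_nat_mult[symmetric])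
    also have "\<dots> \<le> 3 ^ 4" by (intro power_mono exp_le) simp
    finally show ?thesis by simp
  qed
  have pt: "wt d u s x * exp (2 * \<bar>ip d x \<delta>\<bar> / R) \<le> 81 * wt d u s x + \<omega>" for x
  proof -
    let ?n = "L2_set x {..<d}"
    have n0: "0 \<le> ?n" by simp
    have "\<bar>ip d x \<delta>\<bar> \<le> ?n * (2 * R / L)"
      using abs_ip_le[of d x \<delta>] mult_left_mono[OF \<delta> n0] by linarith
    then have le: "2 * \<bar>ip d x \<delta>\<bar> / R \<le> 4 * ?n / L" using R L2 by (simp add: field_simps)
    show ?thesis
    \<comment> \<open>Up to |x| = L the exponent is at most 4, and exp 4 \<le> 3^4. Beyond, the
      Gaussian tail of w beats the shift factor and leaves at most exp (4 - L) \<le> \<omega>; hence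
      the threshold 4 - ln \<omega>.\<close>
    proof (cases "?n \<le> L")
      case True
      then have "4 * ?n / L \<le> 4" using L2 by (simp add: divide_le_eq)
      then have "exp (2 * \<bar>ip d x \<delta>\<bar> / R) \<le> exp 4" using le by simp
      also note e4
      finally have "wt d u s x * exp (2 * \<bar>ip d x \<delta>\<bar> / R) \<le> wt d u s x * 81"
        by (intro mult_left_mono less_imp_le[OF wt_pos])
      then show ?thesis using \<omega> by simp
    next
      case False
      have "wt d u s x * exp (2 * \<bar>ip d x \<delta>\<bar> / R) \<le> exp (- (s * ?n\<^sup>2) / 2) * exp (4 * ?n / L)"
        using wt_le_exp_norm[of d u s x] le by (intro mult_mono) (auto simp: ip_self)
      also have "\<dots> = exp (4 * ?n / L - s * ?n\<^sup>2 / 2)" by (simp add: exp_add[symmetric])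
      also have "\<dots> \<le> exp (4 - L)"
      proof -
        have "4 * (?n - L) / L \<le> 2 * (?n - L)"
          using mult_left_mono[OF L2, of "2 * (?n - L)"] L2 False by (simp add: pos_divide_le_eq)
        then have a: "4 * ?n / L \<le> 4 + 2 * (?n - L)" using L2 by (simp add: diff_divide_distrib right_diff_distrib)
        have "?n\<^sup>2 \<le> s * ?n\<^sup>2" using s(1) mult_right_mono[of 1 s "?n\<^sup>2"] by simp
        moreover have "4 * ?n - 4 \<le> ?n\<^sup>2"
          using zero_le_power2[of "?n - 2"] by (simp add: power2_diff)
        moreover have "y - S / 2 \<le> 4 - L" if "N \<le> S" "4 * m - 4 \<le> N" "y \<le> 4 + 2 * (m - L)"
          for y S N m :: real using that L2 by argo
        ultimately have "4 * ?n / L - s * ?n\<^sup>2 / 2 \<le> 4 - L" using a by blast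
        then show ?thesis by (simp only: exp_le_cancel_iff)
      qed
      also have "\<dots> \<le> exp (ln \<omega>)" using Lw by (simp only: exp_le_cancel_iff)
      also have "\<dots> = \<omega>" using \<omega> by (rule exp_ln)
      finally show ?thesis using wt_pos[of d u s x] by linarith
    qed
  qed
  have I2: "integrable (gauss d) (\<lambda>x. 81 * wt d u s x + \<omega>)"
    using IW integrable_gauss_const[of d \<omega>] by simp
  show I: "integrable (gauss d) (\<lambda>x. wt d u s x * exp (2 * \<bar>ip d x \<delta>\<bar> / R))"
  proof (rule Bochner_Integration.integrable_bound[OF I2])
    show "AE x in gauss d. norm (wt d u s x * exp (2 * \<bar>ip d x \<delta>\<bar> / R)) \<le> norm (81 * wt d u s x + \<omega>)"
    proof (rule AE_I2)
      fix x
      have "0 \<le> wt d u s x * exp (2 * \<bar>ip d x \<delta>\<bar> / R)"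
        by (intro mult_nonneg_nonneg less_imp_le[OF wt_pos]) simp
      then show "norm (wt d u s x * exp (2 * \<bar>ip d x \<delta>\<bar> / R)) \<le> norm (81 * wt d u s x + \<omega>)"
        unfolding real_norm_def using order_trans[OF pt[of x] abs_ge_self] by (simp only: abs_of_nonneg)
    qed
  qed measurable
  have "(\<integral>x. wt d u s x * exp (2 * \<bar>ip d x \<delta>\<bar> / R) \<partial>gauss d) \<le> 81 * wt_mass d u s + \<omega>"
    using integral_mono[OF I I2 pt] IW integrable_gauss_const[of d \<omega>]
    by (simp add: prob_space.prob_space[OF prob_space_gauss])
  then show "(\<integral>x. wt d u s x * exp (2 * \<bar>ip d x \<delta>\<bar> / R) \<partial>gauss d) \<le> 100 * wt_mass d u s"
    using W \<omega> by linarith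
qed

text \<open>Only finitely many dimensions occur: s is fitted to the bound b, and \<omega> is the
  minimum of finitely many positive masses. The inserted 1 covers b = 0.\<close>

lemma good_weight_low_ex:
  assumes "0 < \<mu>"
  shows "\<exists>s \<omega> L\<^sub>0. 1 \<le> s \<and> 0 < \<omega> \<and> (\<forall>d<b. good_weight d s \<mu> \<omega> L\<^sub>0)"
proof -
  define s where "s = 1 + 2 * real b / \<mu>\<^sup>2"
  define M where "M d = (\<integral>x. exp (- ((1 + s) * ip d x x) / 2) \<partial>gauss d)" for d
  define \<omega> where "\<omega> = Min (insert 1 (M ` {..<b}))"
  have s1: "1 \<le> s" by (simp add: s_def)
  have M: "0 < M d" for d unfolding M_def using s1 by (intro exp_norm_mass_pos) simp
  have \<omega>: "0 < \<omega>" using M unfolding \<omega>_def by (subst Min_gr_iff) auto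
  have "good_weight d s \<mu> \<omega> (max 2 (4 - ln \<omega>))" if "d < b" for d
  proof (rule good_weight_low[OF assms s1 _ \<omega>])
    have "2 * real d \<le> 2 * real b" using that by simp
    also have "\<dots> \<le> \<mu>\<^sup>2 * (1 + s)" using assms by (simp add: s_def field_simps)
    finally show "2 * real d \<le> \<mu>\<^sup>2 * (1 + s)" .
    show "\<omega> \<le> (\<integral>x. exp (- ((1 + s) * ip d x x) / 2) \<partial>gauss d)"
      unfolding M_def[symmetric] \<omega>_def using that by (intro Min_le) auto
  qed
  then show ?thesis using s1 \<omega> by blast
qed

subsection \<open>Error analysis of the two steps\<close>

text \<open>The error guaranteed for a signed query \<phi> with E|\<phi>| \<le> q, asked in two
  parts.\<close>

definition tol :: "real \<Rightarrow> real \<Rightarrow> real" where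
  "tol m q = 2 * (1 / m + sqrt (q / m))"

lemma tol_mono: "0 < m \<Longrightarrow> p \<le> q \<Longrightarrow> tol m p \<le> tol m q"
  by (simp add: tol_def divide_right_mono)

lemma tol_nonneg: "0 < m \<Longrightarrow> 0 \<le> q \<Longrightarrow> 0 \<le> tol m q"
  by (simp add: tol_def)

lemma tol_le_half:
  assumes "0 < m" "64 \<le> m * q"
  shows "tol m q \<le> q / 2"
proof -
  have 1: "1 / m \<le> q / 64" using assms by (simp add: field_simps)
  have q: "0 \<le> q" using assms mult_pos_neg[of m q] by linarith
  have "q / m \<le> (q / 8)\<^sup>2"
    using mult_left_mono[OF 1 q] by (simp add: power2_eq_square)
  then have "sqrt (q / m) \<le> q / 8" using q by (intro real_le_lsqrt) auto
  then show ?thesis using 1 q by (simp add: tol_def)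
qed

context
  fixes d :: nat and \<alpha> \<epsilon> h :: real and E :: "real measure" and m :: real
  assumes E: "real_distribution E" and atom: "\<alpha> \<le> measure E {0}"
    and d: "1 \<le> d" and \<alpha>: "0 < \<alpha>" "\<alpha> < 1" and \<epsilon>: "0 < \<epsilon>" "\<epsilon> < 1"
    and h: "0 < h" "h \<le> 1 / 4" "h ^ 8 = \<epsilon> * \<alpha>"
    and m_def: "m = real d / (\<epsilon> * \<alpha>\<^sup>2)"
begin

lemma m_pos: "0 < m"
  using d \<alpha> \<epsilon> by (simp add: m_def)

lemma m_inverse: "1 / m = (\<alpha> * sqrt (\<epsilon> / d))\<^sup>2"
  using \<alpha> \<epsilon> d by (simp add: m_def power_mult_distrib)

lemma m_\<alpha>: "1024 \<le> m * \<alpha>"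
proof -
  have "h ^ 8 \<le> (1 / 4) ^ 8" using h by (intro power_mono) auto
  then have *: "1024 * (\<epsilon> * \<alpha>) \<le> 1" using h by (simp add: power_divide)
  have "m * \<alpha> = real d / (\<epsilon> * \<alpha>)" using \<alpha> by (simp add: m_def power2_eq_square)
  moreover have "1024 * (\<epsilon> * \<alpha>) \<le> real d" using * d by linarith
  ultimately show ?thesis using \<alpha> \<epsilon> by (simp add: pos_le_divide_eq)
qed

text \<open>Since m \<alpha> \<ge> 1024, any expectation of at least \<alpha> / 16 is measured up to
  a constant factor. All coarse denominators are of this size because the atom alone gives them
  mass.\<close>

lemma tol_le_half':
  assumes "\<alpha> / 16 \<le> q" shows "tol m q \<le> q / 2"
proof (rule tol_le_half[OF m_pos])
  have "m * (\<alpha> / 16) \<le> m * q" using assms m_pos by simp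
  then show "64 \<le> m * q" using m_\<alpha> by simp
qed

lemma scale_ge:
  assumes "0 < r" shows "16 * r \<le> r / h ^ 4"
proof -
  have "h ^ 4 \<le> (1 / 4) ^ 4" using h by (intro power_mono) auto
  then have "16 * h ^ 4 \<le> 1" by (simp add: power_divide)
  then have "r * (16 * h ^ 4) \<le> r * 1" using assms by (intro mult_left_mono) auto
  then show ?thesis using h by (simp add: pos_le_divide_eq mult_ac)
qed

lemma soft_mass_pos: "0 < soft_mass E R" and \<alpha>_le_soft_mass: "\<alpha> \<le> soft_mass E R"
  using soft_mass_ge[OF E, of R] atom \<alpha> by linarith+

text \<open>The factor sqrt d is the price of passing from directional errors to the Euclidean norm.
  The choice m = d / (\<epsilon> \<alpha>^2) is what cancels it.\<close>

lemma sqrt_d_tol: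
  assumes "0 \<le> q" shows "sqrt d * tol m q \<le> 2 * \<alpha> * (\<epsilon> * \<alpha> + sqrt (\<epsilon> * q))"
proof -
  have d0: "1 \<le> sqrt (real d)" using d by simp
  have "tol m q = 2 * (1 / m + sqrt q * sqrt (1 / m))"
    by (simp add: tol_def real_sqrt_divide)
  also have "sqrt (1 / m) = \<alpha> * sqrt (\<epsilon> / d)" unfolding m_inverse using \<alpha> \<epsilon> by simp
  also have "sqrt d * (2 * (1 / m + sqrt q * (\<alpha> * sqrt (\<epsilon> / d)))) =
    2 * (sqrt d * (1 / m) + \<alpha> * (sqrt q * sqrt \<epsilon>))"
    using d by (simp add: real_sqrt_divide algebra_simps)
  also have "sqrt d * (1 / m) = \<epsilon> * \<alpha>\<^sup>2 / sqrt d"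
    using d by (simp add: m_def real_div_sqrt divide_divide_eq_left' field_simps)
  also have "\<dots> \<le> \<epsilon> * \<alpha>\<^sup>2" using d0 \<epsilon> \<alpha> by (simp add: divide_le_eq mult_left_mono[of 1, simplified])
  finally show ?thesis
    using assms by (simp add: real_sqrt_mult power2_eq_square algebra_simps)
qed

section \<open>The coarse step: error radius and certificate for the noise mass at the wide
  scale\<close>

context
  fixes r R :: real and \<delta> :: "nat \<Rightarrow> real" and us :: "(nat \<Rightarrow> real) list" and \<kappa> :: real
  assumes r: "0 < r" and R_def: "R = r / h ^ 4" and \<delta>: "L2_set \<delta> {..<d} \<le> r"
    and us: "norming d \<kappa> us" and \<kappa>: "1 \<le> \<kappa>"
begin

lemma R_pos: "0 < R" and R_ge: "16 * r \<le> R"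
  using scale_ge[OF r] r unfolding R_def by linarith+

lemma wt_bell_ge:
  assumes "ip d u u = 1"
  shows "soft_mass E R / 16 \<le> ev d E \<delta> (\<lambda>x v. wt d u 0 x * bell (v / R))"
proof -
  have "L2_set \<delta> {..<d} \<le> R / 16" using \<delta> R_ge by linarith
  note * = mult_right_mono[OF wt0_exp_ge[OF assms R_pos this] less_imp_le[OF soft_mass_pos[of R]]]
  have "(\<integral>x. wt d u 0 x * exp (- (2 * \<bar>ip d x \<delta>\<bar> / R)) \<partial>gauss d) * soft_mass E R \<le>
      ev d E \<delta> (\<lambda>x v. wt d u 0 x * bell (v / R))"
    by (rule ev_weighted_bell_ge[OF E]) (auto simp: R_pos less_imp_le[OF wt_pos] wt_le_1)
  with * show ?thesis by simp
qed

lemma wt_bell_le_1: "ev d E \<delta> (\<lambda>x v. wt d u 0 x * bell (v / R)) \<le> 1"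
  by (rule ev_le_1[OF E weighted_bell_measurable[OF E] weighted_bell_bound[OF E]])
    (auto simp: R_pos less_imp_le[OF wt_pos] wt_le_1)

lemma measurable_bell_lr: "(\<lambda>p. bell (snd p / R)) \<in> borel_measurable (lr_space d)"
  unfolding lr_space_def by measurable

lemma bell_ev_le:
  assumes "L2_set \<eta> {..<d} \<le> R / 8"
  shows "ev d E \<eta> (\<lambda>x v. bell (v / R)) \<le> 3 * soft_mass E R"
proof -
  note e = gauss_exp_abs_le[OF R_pos assms]
  have "ev d E \<eta> (\<lambda>x v. 1 * bell (v / R)) \<le> (\<integral>x. 1 * exp (2 * \<bar>ip d x \<eta>\<bar> / R) \<partial>gauss d) * soft_mass E R"
    by (rule ev_weighted_bell_le[OF E]) (use e R_pos in auto)
  also have "\<dots> \<le> 3 * soft_mass E R" using e soft_mass_pos[of R] by (intro mult_right_mono) auto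
  finally show ?thesis by simp
qed

lemma bell_ev_ge: "soft_mass E R / 16 \<le> ev d E \<delta> (\<lambda>x v. bell (v / R))"
proof -
  have u: "ip d (unit_vec 0) (unit_vec 0) = 1" using d by (intro ip_unit_vec_self) simp
  note wt = measurable_wt less_imp_le[OF wt_pos] wt_le_1[OF order_refl]
  have "ev d E \<delta> (\<lambda>x v. wt d (unit_vec 0) 0 x * bell (v / R)) \<le> ev d E \<delta> (\<lambda>x v. bell (v / R))"
  proof (rule ev_mono[OF E weighted_bell_measurable[OF E wt R_pos] weighted_bell_bound[OF E wt R_pos]
        measurable_bell_lr, where K' = 1])
    show "wt d (unit_vec 0) 0 x * bell (v / R) \<le> bell (v / R)" for x v
      using mult_right_mono[OF wt_le_1[of 0 d "unit_vec 0" x] bell_nonneg[of "v / R"]] by simp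
  qed (simp_all add: bell_nonneg bell_le_1)
  then show ?thesis using wt_bell_ge[OF u] by linarith
qed

context
  fixes p :: real and a b :: "(nat \<Rightarrow> real) \<Rightarrow> real" and r\<^sub>1 :: real
  assumes p: "\<bar>p - ev d E \<delta> (\<lambda>x v. bell (v / R))\<bar> \<le> tol m (ev d E \<delta> (\<lambda>x v. bell (v / R)))"
    and a: "\<And>u. u \<in> set us \<Longrightarrow> \<bar>a u - ev d E \<delta> (\<lambda>x v. ip d u x * wt d u 0 x * tanh (v / R))\<bar> \<le> tol m 1"
    and b: "\<And>u. u \<in> set us \<Longrightarrow> \<bar>b u - ev d E \<delta> (\<lambda>x v. wt d u 0 x * bell (v / R))\<bar> \<le>
        tol m (ev d E \<delta> (\<lambda>x v. wt d u 0 x * bell (v / R)))"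
    and r\<^sub>1_def: "r\<^sub>1 = min (2 * r) (5120 * R * \<alpha> * sqrt \<epsilon> / (\<kappa> * \<bar>p\<bar>))"
begin

text \<open>The expectation lies between P / 16 and 3 P, with P the soft mass, and the answer is off
  by at most half of it. So p can stand in for the unknown P.\<close>

lemma p_ge: "soft_mass E R / 32 \<le> p" and p_le: "p \<le> 5 * soft_mass E R"
proof -
  let ?P = "ev d E \<delta> (\<lambda>x v. bell (v / R))"
  have "\<alpha> / 16 \<le> ?P" using bell_ev_ge \<alpha>_le_soft_mass[of R] by linarith
  then have 1: "\<bar>p - ?P\<bar> \<le> ?P / 2" using p tol_le_half'[of ?P] by linarith
  have "L2_set \<delta> {..<d} \<le> R / 8" using \<delta> R_ge r by linarith
  then have "?P \<le> 3 * soft_mass E R" by (rule bell_ev_le)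
  then show "soft_mass E R / 32 \<le> p" "p \<le> 5 * soft_mass E R"
    using 1 bell_ev_ge soft_mass_pos[of R] by linarith+
qed

lemma r\<^sub>1_pos: "0 < r\<^sub>1" and r\<^sub>1_le: "r\<^sub>1 \<le> 2 * r"
  using r R_pos \<alpha> \<epsilon> \<kappa> p_ge soft_mass_pos[of R] by (auto simp: r\<^sub>1_def intro!: divide_pos_pos mult_pos_pos)

text \<open>This is the certificate. As \<open>r\<^sub>1\<close> is capped in terms of the measured
  p, a large radius is only ever reported when the noise mass is small. The constant is 32 times
  5120.\<close>

lemma soft_mass_mult_le: "soft_mass E R * \<kappa> * r\<^sub>1 \<le> 163840 * R * \<alpha> * sqrt \<epsilon>"
proof -
  have p0: "0 < p" using p_ge soft_mass_pos[of R] by linarith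
  have "r\<^sub>1 \<le> 5120 * R * \<alpha> * sqrt \<epsilon> / (\<kappa> * p)" using p0 by (simp add: r\<^sub>1_def)
  then have 1: "p * \<kappa> * r\<^sub>1 \<le> 5120 * R * \<alpha> * sqrt \<epsilon>" using p0 \<kappa> by (simp add: pos_le_divide_eq mult_ac)
  have "soft_mass E R * (\<kappa> * r\<^sub>1) \<le> 32 * p * (\<kappa> * r\<^sub>1)"
    using p_ge \<kappa> r\<^sub>1_pos by (intro mult_right_mono) auto
  then show ?thesis using 1 by (simp add: mult_ac)
qed

lemma coarse_consistent: "consistent d us a b (2 * R) (2 * tol m 1) r \<delta>"
proof (rule consistentI[OF \<delta>, where t = "tol m 1"])
  show "0 < 2 * R" using R_pos by simp
  show "ip d u u = 1" if "u \<in> set us" for u using us that by (auto simp: norming_def)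
  show "ev d E \<delta> (\<lambda>x v. ip d u x * wt d u 0 x * tanh (v / R)) =
      ip d u \<delta> / (2 * R) * ev d E \<delta> (\<lambda>x v. wt d u 0 x * bell (v / R))" if "u \<in> set us" for u
    using ev_stein_tanh[OF E, of d u 0 R \<delta>] us that R_pos by (auto simp: norming_def)
  show "\<bar>b u - ev d E \<delta> (\<lambda>x v. wt d u 0 x * bell (v / R))\<bar> \<le> tol m 1" if "u \<in> set us" for u
    using b[OF that] tol_mono[OF m_pos wt_bell_le_1[of u]] by linarith
  have "r / (2 * R) \<le> 1" using R_ge R_pos r by simp
  then have "1 + r / (2 * R) \<le> 2" by simp
  then have "tol m 1 * (1 + r / (2 * R)) \<le> tol m 1 * 2"
    by (rule mult_left_mono) (rule tol_nonneg[OF m_pos], simp)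
  then show "tol m 1 * (1 + r / (2 * R)) \<le> 2 * tol m 1" by simp
qed (rule a)

text \<open>With scale 2 R, tolerance 2 tol and denominators of at least P / 32, each direction is
  off by at most 256 R tol / P. The bounds sqrt d tol \<le> 4 \<alpha> sqrt \<epsilon> and 1 / P
  \<le> 5 / p then produce the 5120 in \<open>r\<^sub>1\<close>; the cap 2 r is the triangle
  inequality.\<close>

lemma coarse_error:
  assumes e: "consistent d us a b (2 * R) (2 * tol m 1) r e"
  shows "L2_set (\<lambda>i. \<delta> i - e i) {..<d} \<le> r\<^sub>1"
proof -
  let ?P = "soft_mass E R"
  have p0: "0 < p" using p_ge soft_mass_pos[of R] by linarith
  have "\<bar>ip d u (\<lambda>i. \<delta> i - e i)\<bar> \<le> 256 * R * tol m 1 / ?P" if "u \<in> set us" for u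
  proof -
    let ?H = "ev d E \<delta> (\<lambda>x v. wt d u 0 x * bell (v / R))"
    have H: "?P / 16 \<le> ?H" by (rule wt_bell_ge) (use us that in \<open>auto simp: norming_def\<close>)
    then have "\<alpha> / 16 \<le> ?H" using \<alpha>_le_soft_mass[of R] by linarith
    then have "\<bar>b u - ?H\<bar> \<le> ?H / 2" using b[OF that] tol_le_half'[of ?H] by linarith
    then have "?P / 32 \<le> b u" using H by linarith
    from consistent_diff[OF coarse_consistent e _ _ that this] R_pos soft_mass_pos[of R]
    show ?thesis by simp
  qed
  moreover have "0 \<le> 256 * R * tol m 1 / ?P"
    using R_pos soft_mass_pos[of R] tol_nonneg[OF m_pos, of 1] by simp
  ultimately have "L2_set (\<lambda>i. \<delta> i - e i) {..<d} \<le> sqrt d * (256 * R * tol m 1 / ?P) / \<kappa>"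
    using us unfolding norming_def by blast
  also have "\<dots> = 256 * R * (sqrt d * tol m 1) / (?P * \<kappa>)" by (simp add: mult_ac)
  also have "\<dots> \<le> 256 * R * (4 * \<alpha> * sqrt \<epsilon>) / (?P * \<kappa>)"
  proof (intro divide_right_mono mult_left_mono)
    have "\<epsilon> * \<alpha> \<le> sqrt \<epsilon>"
    proof -
      have "\<epsilon> * \<alpha> \<le> \<epsilon>" using \<epsilon> \<alpha> by (simp add: mult_left_le)
      also have "\<dots> = sqrt \<epsilon> * sqrt \<epsilon>" using \<epsilon> by simp
      also have "\<dots> \<le> sqrt \<epsilon>" using \<epsilon> by (intro mult_left_le) auto
      finally show ?thesis .
    qed
    then have "2 * \<alpha> * (\<epsilon> * \<alpha> + sqrt \<epsilon>) \<le> 2 * \<alpha> * (2 * sqrt \<epsilon>)"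
      using \<alpha> by (intro mult_left_mono) auto
    then show "sqrt d * tol m 1 \<le> 4 * \<alpha> * sqrt \<epsilon>" using sqrt_d_tol[of 1] by simp
  qed (use R_pos soft_mass_pos[of R] \<kappa> in auto)
  also have "\<dots> = (1024 * R * \<alpha> * sqrt \<epsilon> / \<kappa>) * (1 / ?P)" by (simp add: mult_ac)
  also have "\<dots> \<le> (1024 * R * \<alpha> * sqrt \<epsilon> / \<kappa>) * (5 / p)"
    using p_le p0 soft_mass_pos[of R] R_pos \<alpha> \<epsilon> \<kappa> by (intro mult_left_mono) (auto simp: field_simps)
  also have "\<dots> = 5120 * R * \<alpha> * sqrt \<epsilon> / (\<kappa> * \<bar>p\<bar>)" using p0 by simp
  finally have 1: "L2_set (\<lambda>i. \<delta> i - e i) {..<d} \<le> 5120 * R * \<alpha> * sqrt \<epsilon> / (\<kappa> * \<bar>p\<bar>)" .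
  have "L2_set (\<lambda>i. \<delta> i - e i) {..<d} \<le> 2 * r"
    using L2_set_diff_le[of \<delta> e "{..<d}"] \<delta> e by (simp add: consistent_def)
  then show ?thesis using 1 by (simp add: r\<^sub>1_def)
qed

end
end

section \<open>The fine step: positivity of the narrow-scale denominator and the resulting
  error\<close>

context
  fixes r R r\<^sub>1 R\<^sub>1 :: real and \<delta> :: "nat \<Rightarrow> real" and \<kappa> s \<mu> \<omega> L\<^sub>0 q :: real
    and us :: "(nat \<Rightarrow> real) list" and a b :: "(nat \<Rightarrow> real) \<Rightarrow> real" and T \<rho> :: real
  assumes r: "0 < r" and R_def: "R = r / h ^ 4" and \<delta>: "L2_set \<delta> {..<d} \<le> r\<^sub>1"
    and r\<^sub>1: "0 < r\<^sub>1" "r\<^sub>1 \<le> 2 * r" and R\<^sub>1_def: "R\<^sub>1 = \<mu> * r\<^sub>1"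
    and \<kappa>: "1 \<le> \<kappa>" "65536000 * \<mu> \<le> \<kappa>"
    and w: "good_weight d s \<mu> \<omega> L\<^sub>0" and s: "s = 0 \<or> 1 \<le> s" and \<mu>: "0 < \<mu>" "\<mu> \<le> 4"
    and \<omega>: "0 < \<omega>" "\<omega> \<le> 1" and hL: "L\<^sub>0 \<le> 1 / h ^ 4" and h\<omega>: "h \<le> \<omega> / 160000"
    and mass: "soft_mass E R * \<kappa> * r\<^sub>1 \<le> 163840 * R * \<alpha> * sqrt \<epsilon>"
    and q: "3 * soft_mass E R \<le> q" "q \<le> 480 * soft_mass E R"
    and us: "norming d 1 us"
    and \<rho>_def: "\<rho> = (2 + s) * R\<^sub>1" and T_def: "T = tol m q * (1 + 1 / ((2 + s) * \<mu>))"
    and a: "\<And>u. u \<in> set us \<Longrightarrow> \<bar>a u - ev d E \<delta> (\<lambda>x v. ip d u x * wt d u s x * (tanh (v / R\<^sub>1) - tanh (v / R)))\<bar> \<le> tol m q"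
    and b: "\<And>u. u \<in> set us \<Longrightarrow> \<bar>b u - ev d E \<delta> (\<lambda>x v. wt d u s x * (bell (v / R\<^sub>1) - R\<^sub>1 / R * bell (v / R)))\<bar> \<le> tol m q"
begin

lemma s_nonneg: "0 \<le> s" using s by auto

lemma R_pos': "0 < R" and R\<^sub>1_pos: "0 < R\<^sub>1" and R\<^sub>1_le: "R\<^sub>1 \<le> R"
proof -
  have 1: "16 * r \<le> R" using scale_ge[OF r] by (simp add: R_def)
  then show "0 < R" using r by linarith
  show "0 < R\<^sub>1" using \<mu> r\<^sub>1 by (simp add: R\<^sub>1_def)
  have "\<mu> * r\<^sub>1 \<le> 4 * (2 * r)" using \<mu> r\<^sub>1 r by (intro mult_mono) auto
  then show "R\<^sub>1 \<le> R" using 1 r by (simp add: R\<^sub>1_def)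
qed

lemma q_nonneg: "0 \<le> q" using q soft_mass_pos[of R] by linarith

lemmas wt_facts = measurable_wt less_imp_le[OF wt_pos] wt_le_1[OF s_nonneg]

lemma ev_fine_denominator:
  "ev d E \<delta> (\<lambda>x v. wt d u s x * (bell (v / R\<^sub>1) - R\<^sub>1 / R * bell (v / R))) =
    ev d E \<delta> (\<lambda>x v. wt d u s x * bell (v / R\<^sub>1)) - R\<^sub>1 / R * ev d E \<delta> (\<lambda>x v. wt d u s x * bell (v / R))"
  unfolding ev_def
  using ev_integrable[OF E weighted_bell_measurable[OF E wt_facts R\<^sub>1_pos] weighted_bell_bound[OF E wt_facts R\<^sub>1_pos]]
    ev_integrable[OF E weighted_bell_measurable[OF E wt_facts R_pos'] weighted_bell_bound[OF E wt_facts R_pos']]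
  by (simp add: right_diff_distrib mult.left_commute)

text \<open>Stein's identity is used at both scales, with factors \<open>1 / R\<^sub>1\<close> and
  \<open>1 / R\<close>; pulling out the former leaves the ratio \<open>R\<^sub>1 / R\<close> in
  front of the wide-scale term.\<close>

lemma ev_fine_numerator:
  assumes u: "ip d u u = 1"
  shows "ev d E \<delta> (\<lambda>x v. ip d u x * wt d u s x * (tanh (v / R\<^sub>1) - tanh (v / R))) =
    ip d u \<delta> / \<rho> * ev d E \<delta> (\<lambda>x v. wt d u s x * (bell (v / R\<^sub>1) - R\<^sub>1 / R * bell (v / R)))"
proof -
  let ?S = "\<lambda>R. ev d E \<delta> (\<lambda>x v. ip d u x * wt d u s x * tanh (v / R))"
  let ?B = "\<lambda>R. ev d E \<delta> (\<lambda>x v. wt d u s x * bell (v / R))"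
  have bd: "\<bar>ip d u x * wt d u s x * tanh (v / R)\<bar> \<le> 1" for x v R
    using mult_mono[OF abs_ip_mult_wt_le[OF s_nonneg, of d u x] abs_tanh_le_1[of "v / R"]] wt_pos[of d u s x]
    by (simp add: abs_mult abs_of_pos)
  have me: "(\<lambda>p. ip d u (fst p) * wt d u s (fst p) * tanh (snd p / R)) \<in> borel_measurable (lr_space d)" for R
    unfolding lr_space_def by measurable
  have "ev d E \<delta> (\<lambda>x v. ip d u x * wt d u s x * (tanh (v / R\<^sub>1) - tanh (v / R))) = ?S R\<^sub>1 - ?S R"
    unfolding ev_def using ev_integrable[OF E me bd, of \<delta> R\<^sub>1] ev_integrable[OF E me bd, of \<delta> R]
    by (simp add: right_diff_distrib)
  moreover have "(2 + s) * (?S R\<^sub>1 - ?S R) = ip d u \<delta> / R\<^sub>1 * (?B R\<^sub>1 - R\<^sub>1 / R * ?B R)"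
    using ev_stein_tanh[OF E u s R\<^sub>1_pos, of \<delta>] ev_stein_tanh[OF E u s R_pos', of \<delta>] R\<^sub>1_pos
    by (simp add: right_diff_distrib)
  moreover have "X = y / (k * R\<^sub>1) * Z" if "k * X = y / R\<^sub>1 * Z" "0 < k" for X y k Z
    using that R\<^sub>1_pos by (simp add: field_simps)
  ultimately show ?thesis
    unfolding ev_fine_denominator \<rho>_def using s_nonneg by simp
qed

text \<open>
  The atom contributes \<open>\<alpha>\<close> at the narrow scale \<open>R\<^sub>1\<close>, while the coarse step has already forced the
  noise mass per unit length at scale \<open>R\<close> to be small compared with \<open>\<alpha> / r\<^sub>1\<close>.
\<close>

lemma ev_fine_denominator_ge:
  assumes u: "ip d u u = 1"
  shows "\<omega> * \<alpha> / 4 \<le> ev d E \<delta> (\<lambda>x v. wt d u s x * (bell (v / R\<^sub>1) - R\<^sub>1 / R * bell (v / R)))"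
proof -
  let ?W = "wt_mass d u s" and ?B = "\<lambda>R. ev d E \<delta> (\<lambda>x v. wt d u s x * bell (v / R))"
  have W: "\<omega> \<le> ?W" and
    W1: "?W / 2 \<le> (\<integral>x. wt d u s x * bell (ip d x \<delta> / R\<^sub>1) \<partial>gauss d)"
    using w u r\<^sub>1 \<delta> unfolding good_weight_def R\<^sub>1_def by blast+
  have "2 * R / (1 / h ^ 4) = 2 * r" using h by (simp add: R_def)
  then have "L2_set \<delta> {..<d} \<le> 2 * R / (1 / h ^ 4)" using \<delta> r\<^sub>1 by linarith
  then have W2: "integrable (gauss d) (\<lambda>x. wt d u s x * exp (2 * \<bar>ip d x \<delta>\<bar> / R))"
    "(\<integral>x. wt d u s x * exp (2 * \<bar>ip d x \<delta>\<bar> / R) \<partial>gauss d) \<le> 100 * ?W"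
    using w u R_pos' hL unfolding good_weight_def by blast+
  have "\<alpha> * (?W / 2) \<le> measure E {0} * (\<integral>x. wt d u s x * bell (ip d x \<delta> / R\<^sub>1) \<partial>gauss d)"
    using W W1 \<omega> atom \<alpha> by (intro mult_mono) auto
  also have "\<dots> \<le> ?B R\<^sub>1" by (rule ev_weighted_bell_ge_atom[OF E wt_facts R\<^sub>1_pos])
  finally have 1: "\<alpha> * ?W / 2 \<le> ?B R\<^sub>1" by simp
  have "?B R \<le> (\<integral>x. wt d u s x * exp (2 * \<bar>ip d x \<delta>\<bar> / R) \<partial>gauss d) * soft_mass E R"
    by (rule ev_weighted_bell_le[OF E wt_facts R_pos' W2(1)])
  also have "\<dots> \<le> 100 * ?W * soft_mass E R"
    using W2(2) soft_mass_pos[of R] by (intro mult_right_mono) auto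
  finally have "R\<^sub>1 / R * ?B R \<le> R\<^sub>1 / R * (100 * ?W * soft_mass E R)"
    using R\<^sub>1_pos R_pos' by (intro mult_left_mono) auto
  also have "\<dots> = 100 * ?W / R * (\<mu> * (soft_mass E R * r\<^sub>1))" by (simp add: R\<^sub>1_def)
  \<comment> \<open>Here the constants have to fit: 65536000 is 400 times the 163840 of the
    certificate, so the wide-scale term costs at most half of the \<alpha> \<open>?W\<close> / 2
    contributed by the atom, even with sqrt \<epsilon> bounded only by 1.\<close>
  also have "\<dots> \<le> 100 * ?W / R * (R * \<alpha> / 400)"
  proof (rule mult_left_mono)
    have "soft_mass E R * r\<^sub>1 * (65536000 * \<mu>) \<le> soft_mass E R * r\<^sub>1 * \<kappa>"
      using soft_mass_pos[of R] r\<^sub>1 \<kappa> by (intro mult_left_mono) auto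
    also have "\<dots> \<le> 163840 * R * \<alpha> * sqrt \<epsilon>" using mass by (simp add: mult_ac)
    also have "\<dots> \<le> 163840 * R * \<alpha> * 1" using R_pos' \<alpha> \<epsilon> by (intro mult_left_mono) auto
    finally show "\<mu> * (soft_mass E R * r\<^sub>1) \<le> R * \<alpha> / 400" by (simp add: mult_ac)
    show "0 \<le> 100 * ?W / R" using W \<omega> R_pos' by simp
  qed
  also have "\<dots> = \<alpha> * ?W / 4" using R_pos' by simp
  finally have "\<alpha> * ?W / 4 \<le> ?B R\<^sub>1 - R\<^sub>1 / R * ?B R" using 1 by linarith
  moreover have "\<omega> * \<alpha> \<le> \<alpha> * ?W" using W \<alpha> by (simp add: mult.commute)
  ultimately show ?thesis unfolding ev_fine_denominator by linarith
qed

lemma fine_consistent: "consistent d us a b \<rho> T r\<^sub>1 \<delta>"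
proof (rule consistentI[OF \<delta>, where t = "tol m q"])
  show "0 < \<rho>" using s_nonneg R\<^sub>1_pos by (simp add: \<rho>_def)
  show "ip d u u = 1" if "u \<in> set us" for u using us that by (auto simp: norming_def)
  show "ev d E \<delta> (\<lambda>x v. ip d u x * wt d u s x * (tanh (v / R\<^sub>1) - tanh (v / R))) =
      ip d u \<delta> / \<rho> * ev d E \<delta> (\<lambda>x v. wt d u s x * (bell (v / R\<^sub>1) - R\<^sub>1 / R * bell (v / R)))"
    if "u \<in> set us" for u
    by (rule ev_fine_numerator) (use us that in \<open>auto simp: norming_def\<close>)
  show "tol m q * (1 + r\<^sub>1 / \<rho>) \<le> T"
    using r\<^sub>1 by (simp add: T_def \<rho>_def R\<^sub>1_def)
qed (rule a b, assumption)+

lemma fine_error: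
  assumes e: "consistent d us a b \<rho> T r\<^sub>1 e"
  shows "L2_set (\<lambda>i. \<delta> i - e i) {..<d} \<le> 640000 * ((2 + s) * \<mu> + 1) / \<omega> * h * r"
proof -
  let ?C = "640000 * ((2 + s) * \<mu> + 1) / \<omega>"
  have ge1: "1 \<le> (2 + s) * \<mu> + 1" using s_nonneg \<mu> by simp
  have C: "640000 \<le> ?C" using ge1 \<omega> by (simp add: pos_le_divide_eq mult_mono)
  have \<rho>_pos: "0 < \<rho>" using s_nonneg R\<^sub>1_pos by (simp add: \<rho>_def)
  have trivial: "L2_set (\<lambda>i. \<delta> i - e i) {..<d} \<le> 2 * r\<^sub>1"
    using L2_set_diff_le[of \<delta> e "{..<d}"] \<delta> e by (simp add: consistent_def)
  show ?thesis
  proof (cases "r\<^sub>1 \<le> h\<^sup>2 * r")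
    case True
    \<comment> \<open>The coarse step has already succeeded: both vectors lie in a ball of radius
      h^2 r, whatever the fine answers are.\<close>
    have "2 * r\<^sub>1 \<le> 2 * (h * h * r)" using True by (simp add: power2_eq_square)
    also have "\<dots> \<le> 2 * (1 * h * r)" using h r by (intro mult_left_mono mult_right_mono) auto
    also have "\<dots> = 2 * h * r" by simp
    also have "\<dots> \<le> ?C * h * r" using C h r by (intro mult_right_mono) auto
    finally show ?thesis using trivial by linarith
  next
    case False
    let ?P = "soft_mass E R"
    \<comment> \<open>Inserting \<open>r\<^sub>1\<close> > h^2 r and R = r / h^4 into the
      certificate gives P h^6 = O(\<alpha>). Multiplying by \<epsilon> turns the right side into
      O(h^8), whence \<epsilon> P = O(h^2).\<close>
    have P: "\<epsilon> * ?P \<le> 163840 * h\<^sup>2"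
    proof -
      have "?P * (h\<^sup>2 * r) \<le> ?P * r\<^sub>1" using False soft_mass_pos[of R] by (intro mult_left_mono) auto
      also have "\<dots> = ?P * 1 * r\<^sub>1" by simp
      also have "\<dots> \<le> ?P * \<kappa> * r\<^sub>1" using \<kappa> r\<^sub>1 soft_mass_pos[of R] by (intro mult_right_mono mult_left_mono) auto
      also note mass
      also have "163840 * R * \<alpha> * sqrt \<epsilon> \<le> 163840 * R * \<alpha> * 1" using R_pos' \<alpha> \<epsilon> by (intro mult_left_mono) auto
      finally have "?P * h\<^sup>2 * r \<le> 163840 * \<alpha> / h ^ 4 * r" by (simp add: R_def mult_ac)
      then have "?P * h\<^sup>2 \<le> 163840 * \<alpha> / h ^ 4" using r by (rule mult_right_le_imp_le)
      then have "?P * h\<^sup>2 * h ^ 4 \<le> 163840 * \<alpha>" using h by (simp add: pos_le_divide_eq)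
      then have "\<epsilon> * (?P * h\<^sup>2 * h ^ 4) \<le> \<epsilon> * (163840 * \<alpha>)" using \<epsilon> by (intro mult_left_mono) auto
      also have "\<dots> = 163840 * h ^ 8" by (simp add: h(3))
      finally have "(\<epsilon> * ?P) * h ^ 6 \<le> (163840 * h\<^sup>2) * h ^ 6"
        by (simp add: mult_ac power_add[symmetric])
      then show ?thesis using h by (simp only: mult_le_cancel_right_pos zero_less_power)
    qed
    have t: "sqrt d * tol m q \<le> 20000 * \<alpha> * h"
    proof -
      have "\<epsilon> * q \<le> \<epsilon> * (480 * ?P)" using q \<epsilon> by (intro mult_left_mono) auto
      also have "\<dots> \<le> 480 * (163840 * h\<^sup>2)" using P by simp
      also have "\<dots> \<le> (9000 * h)\<^sup>2" by (simp add: power_mult_distrib)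
      finally have 1: "sqrt (\<epsilon> * q) \<le> 9000 * h" using h by (simp add: real_le_lsqrt)
      have "h ^ 8 \<le> h ^ 1" using h by (intro power_decreasing) auto
      then have "\<epsilon> * \<alpha> \<le> h" using h(3) by simp
      then have "2 * \<alpha> * (\<epsilon> * \<alpha> + sqrt (\<epsilon> * q)) \<le> 2 * \<alpha> * (10000 * h)"
        using 1 h \<alpha> by (intro mult_left_mono) auto
      then show ?thesis using sqrt_d_tol[OF q_nonneg] by simp
    qed
    have "1 \<le> sqrt (real d)" using d by simp
    then have "tol m q \<le> sqrt d * tol m q"
      using mult_right_mono[OF _ tol_nonneg[OF m_pos q_nonneg], of 1 "sqrt d"] by simp
    also note t
    \<comment> \<open>The noise must stay below half of the bound \<omega> \<alpha> / 4 for the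
      denominator; this is the purpose of h \<le> \<omega> / 160000.\<close>
    also have "20000 * \<alpha> * h \<le> 20000 * \<alpha> * (\<omega> / 160000)" using h\<omega> \<alpha> by (intro mult_left_mono) auto
    finally have t': "tol m q \<le> \<omega> * \<alpha> / 8" by (simp add: mult.commute)
    have "\<bar>ip d u (\<lambda>i. \<delta> i - e i)\<bar> \<le> 16 * \<rho> * T / (\<omega> * \<alpha>)" if "u \<in> set us" for u
    proof -
      have "\<omega> * \<alpha> / 4 \<le> ev d E \<delta> (\<lambda>x v. wt d u s x * (bell (v / R\<^sub>1) - R\<^sub>1 / R * bell (v / R)))"
        by (rule ev_fine_denominator_ge) (use us that in \<open>auto simp: norming_def\<close>)
      then have "\<omega> * \<alpha> / 8 \<le> b u" using b[OF that] t' by linarith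
      from consistent_diff[OF fine_consistent e \<rho>_pos _ that this] \<omega> \<alpha> show ?thesis by simp
    qed
    moreover have "0 \<le> 16 * \<rho> * T / (\<omega> * \<alpha>)"
      using \<rho>_pos \<omega> \<alpha> s_nonneg \<mu> tol_nonneg[OF m_pos q_nonneg] by (simp add: T_def)
    ultimately have L2: "L2_set (\<lambda>i. \<delta> i - e i) {..<d} \<le> sqrt d * (16 * \<rho> * T / (\<omega> * \<alpha>)) / 1"
      using us unfolding norming_def by blast
    have "\<rho> * T = r\<^sub>1 * ((2 + s) * \<mu> + 1) * tol m q"
    proof -
      have "k * (1 + 1 / k) = k + 1" if "0 < k" for k :: real using that by (simp add: distrib_left)
      moreover have "0 < (2 + s) * \<mu>" using s_nonneg \<mu> by simp
      ultimately have "(2 + s) * \<mu> * (1 + 1 / ((2 + s) * \<mu>)) = (2 + s) * \<mu> + 1" by blast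
      then have "r\<^sub>1 * tol m q * ((2 + s) * \<mu> * (1 + 1 / ((2 + s) * \<mu>))) = r\<^sub>1 * tol m q * ((2 + s) * \<mu> + 1)"
        by simp
      then show ?thesis by (simp only: \<rho>_def T_def R\<^sub>1_def mult_ac)
    qed
    then have "16 * (\<rho> * T) / (\<omega> * \<alpha>) * sqrt d =
        16 * (r\<^sub>1 * ((2 + s) * \<mu> + 1)) / (\<omega> * \<alpha>) * (sqrt d * tol m q)"
      by simp
    moreover have "sqrt d * (16 * \<rho> * T / (\<omega> * \<alpha>)) / 1 = 16 * (\<rho> * T) / (\<omega> * \<alpha>) * sqrt d"
      by simp
    ultimately have eq: "sqrt d * (16 * \<rho> * T / (\<omega> * \<alpha>)) / 1 =
        16 * (r\<^sub>1 * ((2 + s) * \<mu> + 1)) / (\<omega> * \<alpha>) * (sqrt d * tol m q)" by simp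
    note L2
    also note eq
    \<comment> \<open>From here \<open>r\<^sub>1\<close> is only used through its cap 2 r; 16 times
      2 times 20000 is the 640000 of the claim.\<close>
    also have "\<dots> \<le> 16 * (2 * r * ((2 + s) * \<mu> + 1)) / (\<omega> * \<alpha>) * (20000 * \<alpha> * h)"
    proof (rule mult_mono[OF _ t])
      show "16 * (r\<^sub>1 * ((2 + s) * \<mu> + 1)) / (\<omega> * \<alpha>) \<le> 16 * (2 * r * ((2 + s) * \<mu> + 1)) / (\<omega> * \<alpha>)"
        using r\<^sub>1 ge1 \<omega> \<alpha> by (intro divide_right_mono mult_left_mono mult_right_mono) auto
    qed (use r ge1 \<omega> \<alpha> tol_nonneg[OF m_pos q_nonneg] in auto)
    also have "\<dots> = ?C * h * r" using \<alpha> by simp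
    finally show ?thesis .
  qed
qed

end
end

subsection \<open>The algorithm\<close>

type_synonym lr_alg = "((nat \<Rightarrow> real) \<times> real, nat \<Rightarrow> real) sq_alg"

text \<open>The absolute values of \<open>p ()\<close> keep all later queries bounded by 1 even for invalid answers.\<close>

definition coarse_step ::
  "nat \<Rightarrow> real \<Rightarrow> real \<Rightarrow> real \<Rightarrow> real \<Rightarrow> (nat \<Rightarrow> real) list \<Rightarrow> real \<Rightarrow> (nat \<Rightarrow> real) \<Rightarrow> real \<Rightarrow>
    ((nat \<Rightarrow> real) \<Rightarrow> real \<Rightarrow> real \<Rightarrow> lr_alg) \<Rightarrow> lr_alg" where
  "coarse_step d m \<alpha> \<epsilon> \<kappa> us R c r k =
     ask [()] (\<lambda>_. qry d c (\<lambda>x v. bell (v / R))) (\<lambda>p.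
     ask us (\<lambda>u. qry d c (\<lambda>x v. ip d u x * wt d u 0 x * tanh (v / R))) (\<lambda>a.
     ask us (\<lambda>u. qry d c (\<lambda>x v. wt d u 0 x * bell (v / R))) (\<lambda>b.
       k (\<lambda>i. c i + (SOME e. consistent d us a b (2 * R) (2 * tol m 1) r e) i)
         (min (2 * r) (5120 * R * \<alpha> * sqrt \<epsilon> / (\<kappa> * \<bar>p ()\<bar>))) (96 * \<bar>p ()\<bar>))))"

text \<open>\<open>SOME\<close> is a fixed, deterministic choice, and only queries are counted, so
  the search for a consistent vector is free. Under invalid answers there may be none; the choice is
  then arbitrary, but the remaining queries are still admissible.\<close>

definition fine_step ::
  "nat \<Rightarrow> real \<Rightarrow> real \<Rightarrow> real \<Rightarrow> real \<Rightarrow> (nat \<Rightarrow> real) \<Rightarrow> real \<Rightarrow> real \<Rightarrow>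
    ((nat \<Rightarrow> real) \<Rightarrow> lr_alg) \<Rightarrow> lr_alg" where
  "fine_step d m s \<mu> R c r q k =
     ask (map unit_vec [0..<d])
       (\<lambda>u. qry d c (\<lambda>x v. ip d u x * wt d u s x * (tanh (v / (\<mu> * r)) - tanh (v / R)))) (\<lambda>a.
     ask (map unit_vec [0..<d])
       (\<lambda>u. qry d c (\<lambda>x v. wt d u s x * (bell (v / (\<mu> * r)) - \<mu> * r / R * bell (v / R)))) (\<lambda>b.
       k (\<lambda>i. c i + (SOME e. consistent d (map unit_vec [0..<d]) a b ((2 + s) * (\<mu> * r))
         (tol m q * (1 + 1 / ((2 + s) * \<mu>))) r e) i)))"

definition refine_step ::
  "nat \<Rightarrow> real \<Rightarrow> real \<Rightarrow> real \<Rightarrow> real \<Rightarrow> real \<Rightarrow> real \<Rightarrow> (nat \<Rightarrow> real) list \<Rightarrow>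
    (nat \<Rightarrow> real) \<Rightarrow> real \<Rightarrow> ((nat \<Rightarrow> real) \<Rightarrow> lr_alg) \<Rightarrow> lr_alg" where
  "refine_step d \<alpha> \<epsilon> h \<kappa> s \<mu> us c r k =
     coarse_step d (real d / (\<epsilon> * \<alpha>\<^sup>2)) \<alpha> \<epsilon> \<kappa> us (r / h ^ 4) c r
       (\<lambda>c r\<^sub>1 q. fine_step d (real d / (\<epsilon> * \<alpha>\<^sup>2)) s \<mu> (r / h ^ 4) c r\<^sub>1 q k)"

text \<open>The case a = 0 is needed: an answer 0 for the noise mass makes the reported radius 0,
  since x / 0 = 0, and the queries have to be bounded on that branch of the decision tree
  too.\<close>

lemma abs_tanh_diff_le_1:
  assumes "0 \<le> a" "0 < b" shows "\<bar>tanh (v / a) - tanh (v / b)\<bar> \<le> (1 :: real)"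
proof -
  have *: "\<bar>tanh (x / a) - tanh (x / b)\<bar> \<le> 1" if "0 \<le> x" for x
  proof -
    have "0 \<le> tanh (x / a)" "0 \<le> tanh (x / b)" using that assms by simp_all
    then show ?thesis using tanh_real_lt_1[of "x / a"] tanh_real_lt_1[of "x / b"] by linarith
  qed
  show ?thesis
  proof (cases "0 \<le> v")
    case False
    then show ?thesis using *[of "- v"] by (simp add: abs_minus_commute)
  qed (use * in auto)
qed

lemma fine_query_bounds:
  assumes s: "0 \<le> s" and a: "0 \<le> a" "a \<le> b" "0 < b"
  shows "\<bar>ip d u x * wt d u s x * (tanh (v / a) - tanh (v / b))\<bar> \<le> 1"
    and "\<bar>wt d u s x * (bell (v / a) - a / b * bell (v / b))\<bar> \<le> 1"
proof -
  have "(\<bar>ip d u x\<bar> * wt d u s x) * \<bar>tanh (v / a) - tanh (v / b)\<bar> \<le> 1 * 1"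
    using wt_pos[of d u s x] by (intro mult_mono abs_ip_mult_wt_le[OF s] abs_tanh_diff_le_1 a) auto
  then show "\<bar>ip d u x * wt d u s x * (tanh (v / a) - tanh (v / b))\<bar> \<le> 1"
    using wt_pos[of d u s x] by (simp add: abs_mult abs_of_pos)
  have "0 \<le> a / b * bell (v / b)" "a / b * bell (v / b) \<le> 1 * 1"
    using a by (intro mult_nonneg_nonneg mult_mono bell_nonneg bell_le_1; simp)+
  then have "\<bar>bell (v / a) - a / b * bell (v / b)\<bar> \<le> 1"
    using bell_nonneg[of "v / a"] bell_le_1[of "v / a"] by linarith
  then have "wt d u s x * \<bar>bell (v / a) - a / b * bell (v / b)\<bar> \<le> 1 * 1"
    using wt_pos[of d u s x] by (intro mult_mono wt_le_1[OF s]) auto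
  then show "\<bar>wt d u s x * (bell (v / a) - a / b * bell (v / b))\<bar> \<le> 1"
    using wt_pos[of d u s x] by (simp add: abs_mult abs_of_pos)
qed

lemma fine_query_bounds':
  assumes s: "0 \<le> s" and a: "0 < a" "a \<le> b"
  shows "\<bar>ip d u x * wt d u s x * (tanh (v / a) - tanh (v / b))\<bar> \<le> bell (v / b)"
    and "\<bar>wt d u s x * (bell (v / a) - a / b * bell (v / b))\<bar> \<le> bell (v / b)"
proof -
  have "(\<bar>ip d u x\<bar> * wt d u s x) * \<bar>tanh (v / a) - tanh (v / b)\<bar> \<le> 1 * bell (v / b)"
    using wt_pos[of d u s x] by (intro mult_mono abs_ip_mult_wt_le[OF s] tanh_diff_le_bell a) auto
  then show "\<bar>ip d u x * wt d u s x * (tanh (v / a) - tanh (v / b))\<bar> \<le> bell (v / b)"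
    using wt_pos[of d u s x] by (simp add: abs_mult abs_of_pos)
  have "0 \<le> a / b * bell (v / b)" "a / b * bell (v / b) \<le> 1 * bell (v / b)"
    using a by (intro mult_nonneg_nonneg mult_right_mono bell_nonneg; simp)+
  then have "\<bar>bell (v / a) - a / b * bell (v / b)\<bar> \<le> bell (v / b)"
    using bell_nonneg[of "v / a"] bell_divide_mono[OF a, of v] by linarith
  then have "wt d u s x * \<bar>bell (v / a) - a / b * bell (v / b)\<bar> \<le> 1 * bell (v / b)"
    using wt_pos[of d u s x] by (intro mult_mono wt_le_1[OF s]) auto
  then show "\<bar>wt d u s x * (bell (v / a) - a / b * bell (v / b))\<bar> \<le> bell (v / b)"
    using wt_pos[of d u s x] by (simp add: abs_mult abs_of_pos)
qed

lemma coarse_query_bounds: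
  "\<bar>bell t\<bar> \<le> 1" "\<bar>ip d u x * wt d u 0 x * tanh t\<bar> \<le> 1" "\<bar>wt d u 0 x * bell t\<bar> \<le> 1"
proof -
  show "\<bar>bell t\<bar> \<le> 1" using bell_nonneg[of t] bell_le_1[of t] by simp
  have "(\<bar>ip d u x\<bar> * wt d u 0 x) * \<bar>tanh t\<bar> \<le> 1 * 1"
    using wt_pos[of d u 0 x] by (intro mult_mono abs_ip_mult_wt_le abs_tanh_le_1) auto
  then show "\<bar>ip d u x * wt d u 0 x * tanh t\<bar> \<le> 1"
    using wt_pos[of d u 0 x] by (simp add: abs_mult abs_of_pos)
  have "wt d u 0 x * bell t \<le> 1 * 1"
    using wt_pos[of d u 0 x] by (intro mult_mono wt_le_1 bell_le_1 bell_nonneg) auto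
  then show "\<bar>wt d u 0 x * bell t\<bar> \<le> 1"
    using wt_pos[of d u 0 x] bell_nonneg[of t] by (simp add: abs_mult)
qed

lemma query_measurable:
  "(\<lambda>p. bell (snd p / R)) \<in> borel_measurable (lr_space d)"
  "(\<lambda>p. ip d u (fst p) * wt d u s (fst p) * tanh (snd p / R)) \<in> borel_measurable (lr_space d)"
  "(\<lambda>p. wt d u s (fst p) * bell (snd p / R)) \<in> borel_measurable (lr_space d)"
  "(\<lambda>p. ip d u (fst p) * wt d u s (fst p) * (tanh (snd p / a) - tanh (snd p / R))) \<in> borel_measurable (lr_space d)"
  "(\<lambda>p. wt d u s (fst p) * (bell (snd p / a) - a / R * bell (snd p / R))) \<in> borel_measurable (lr_space d)"
  unfolding lr_space_def by measurable

lemma sq_admissible_refine_step: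
  assumes h: "0 < h" "h \<le> 1 / 4" and r: "0 < r" and s: "0 \<le> s" and \<mu>: "0 < \<mu>" "\<mu> \<le> 4"
    and pos: "0 < \<alpha>" "0 < \<epsilon>" "1 \<le> \<kappa>" and k: "\<And>c. sq_admissible (lr_space d) (k c)"
  shows "sq_admissible (lr_space d) (refine_step d \<alpha> \<epsilon> h \<kappa> s \<mu> us c r k)"
proof -
  have R: "16 * r \<le> r / h ^ 4"
  proof -
    have "h ^ 4 \<le> (1 / 4) ^ 4" using h by (intro power_mono) auto
    then have "16 * h ^ 4 \<le> 1" by (simp add: power_divide)
    then have "r * (16 * h ^ 4) \<le> r * 1" using r by (intro mult_left_mono) auto
    then show ?thesis using h by (simp add: pos_le_divide_eq mult_ac)
  qed
  then have R0: "0 < r / h ^ 4" using r by linarith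
  have a: "0 \<le> \<mu> * min (2 * r) (5120 * (r / h ^ 4) * \<alpha> * sqrt \<epsilon> / (\<kappa> * \<bar>p\<bar>))"
    "\<mu> * min (2 * r) (5120 * (r / h ^ 4) * \<alpha> * sqrt \<epsilon> / (\<kappa> * \<bar>p\<bar>)) \<le> r / h ^ 4" for p
  proof -
    have 0: "0 \<le> min (2 * r) (5120 * (r / h ^ 4) * \<alpha> * sqrt \<epsilon> / (\<kappa> * \<bar>p\<bar>))"
      using r h pos by simp
    then show "0 \<le> \<mu> * min (2 * r) (5120 * (r / h ^ 4) * \<alpha> * sqrt \<epsilon> / (\<kappa> * \<bar>p\<bar>))" using \<mu> by simp
    have "\<mu> * min (2 * r) (5120 * (r / h ^ 4) * \<alpha> * sqrt \<epsilon> / (\<kappa> * \<bar>p\<bar>)) \<le> 4 * (2 * r)"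
      using \<mu> 0 by (intro mult_mono) auto
    then show "\<mu> * min (2 * r) (5120 * (r / h ^ 4) * \<alpha> * sqrt \<epsilon> / (\<kappa> * \<bar>p\<bar>)) \<le> r / h ^ 4"
      using R r by linarith
  qed
  show ?thesis
    unfolding refine_step_def coarse_step_def fine_step_def
    by (intro sq_admissible_ask measurable_qry query_measurable coarse_query_bounds k
        fine_query_bounds[OF s a R0])
qed

section \<open>Runs of a single round against a valid oracle\<close>

lemma vstat_run_ask_lr:
  fixes F :: "'i \<Rightarrow> (nat \<Rightarrow> real) \<Rightarrow> real \<Rightarrow> real"
  assumes run: "vstat_run m (lr_dist d \<beta> E) (ask us (\<lambda>u. qry d c (F u)) k) n b"
    and E: "real_distribution E" and m: "0 < m"
    and F: "\<And>u. (\<lambda>p. F u (fst p) (snd p)) \<in> borel_measurable (lr_space d)" "\<And>u x v. \<bar>F u x v\<bar> \<le> 1"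
  obtains a n' where "n = 2 * length us + n'" "vstat_run m (lr_dist d \<beta> E) (k a) n' b"
    "\<And>u. u \<in> set us \<Longrightarrow> \<bar>a u - ev d E (\<lambda>i. \<beta> i - c i) (F u)\<bar> \<le>
      tol m (ev d E (\<lambda>i. \<beta> i - c i) (\<lambda>x v. \<bar>F u x v\<bar>))"
proof -
  have sets: "sets (lr_dist d \<beta> E) = sets (lr_space d)" by (simp add: lr_dist_def)
  have D: "prob_space (lr_dist d \<beta> E)"
    unfolding lr_dist_def
  proof (rule prob_space.prob_space_distr[OF prob_space_gauss_pair[OF E]])
    have "(\<lambda>p. (fst p, ip d (fst p) \<beta> + snd p)) \<in> lr_space d \<rightarrow>\<^sub>M lr_space d"
      unfolding lr_space_def by measurable
    then show "(\<lambda>(x, z). (x, (\<Sum>i<d. x i * \<beta> i) + z)) \<in> gauss d \<Otimes>\<^sub>M E \<rightarrow>\<^sub>M lr_space d"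
      by (simp add: measurable_cong_sets[OF sets_gauss_pair[OF E] refl] ip_def case_prod_beta)
  qed
  have F': "(\<lambda>p. \<bar>F u (fst p) (snd p)\<bar>) \<in> borel_measurable (lr_space d)" for u
    using F(1)[of u] by measurable
  have "\<exists>a n'. n = 2 * length us + n' \<and> vstat_run m (lr_dist d \<beta> E) (k a) n' b \<and>
    (\<forall>u\<in>set us. \<bar>a u - integral\<^sup>L (lr_dist d \<beta> E) (qry d c (F u))\<bar> \<le>
      2 * (1 / m + sqrt ((\<integral>x. \<bar>qry d c (F u) x\<bar> \<partial>lr_dist d \<beta> E) / m)))"
    by (rule vstat_run_ask[OF run m D])
      (use F measurable_qry[OF F(1)] in \<open>auto simp: measurable_cong_sets[OF sets refl]\<close>)
  then show ?thesis
    using that unfolding integral_lr_dist[OF E F(1)] tol_def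
      integral_lr_dist[OF E F', where \<beta> = \<beta> and c = c] by blast
qed

lemma vstat_run_coarse_step:
  assumes run: "vstat_run m (lr_dist d \<beta> E) (coarse_step d m \<alpha> \<epsilon> \<kappa> us R c r k) n b"
    and E: "real_distribution E" "\<alpha> \<le> measure E {0}" and d: "1 \<le> d"
    and \<alpha>: "0 < \<alpha>" "\<alpha> < 1" and \<epsilon>: "0 < \<epsilon>" "\<epsilon> < 1"
    and h: "0 < h" "h \<le> 1 / 4" "h ^ 8 = \<epsilon> * \<alpha>" and m_def: "m = real d / (\<epsilon> * \<alpha>\<^sup>2)"
    and r: "0 < r" and R_def: "R = r / h ^ 4" and c: "L2_set (\<lambda>i. \<beta> i - c i) {..<d} \<le> r"
    and us: "norming d \<kappa> us" and \<kappa>: "1 \<le> \<kappa>"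
  obtains c\<^sub>1 r\<^sub>1 q n' where "n = 2 + 4 * length us + n'" "vstat_run m (lr_dist d \<beta> E) (k c\<^sub>1 r\<^sub>1 q) n' b"
    "L2_set (\<lambda>i. \<beta> i - c\<^sub>1 i) {..<d} \<le> r\<^sub>1" "0 < r\<^sub>1" "r\<^sub>1 \<le> 2 * r"
    "soft_mass E R * \<kappa> * r\<^sub>1 \<le> 163840 * R * \<alpha> * sqrt \<epsilon>"
    "3 * soft_mass E R \<le> q" "q \<le> 480 * soft_mass E R"
proof -
  note ctx = E d \<alpha> \<epsilon> h m_def r R_def c us \<kappa>
  have m: "0 < m" by (rule m_pos[OF E d \<alpha> \<epsilon> h m_def])
  have P0: "0 < soft_mass E R" by (rule soft_mass_pos[OF E d \<alpha> \<epsilon> h m_def])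
  define \<delta> where "\<delta> = (\<lambda>i. \<beta> i - c i)"
  show ?thesis
  proof (rule vstat_run_ask_lr[where F = "\<lambda>u x v. bell (v / R)",
        OF run[unfolded coarse_step_def] E(1) m, folded \<delta>_def], goal_cases)
    case (3 p n1)
    note p = 3
    show ?case
    proof (rule vstat_run_ask_lr[where F = "\<lambda>u x v. ip d u x * wt d u 0 x * tanh (v / R)",
        OF p(2) E(1) m, folded \<delta>_def], goal_cases)
      case (3 a n2)
      note a = 3
      show ?case
      proof (rule vstat_run_ask_lr[where F = "\<lambda>u x v. wt d u 0 x * bell (v / R)",
        OF a(2) E(1) m, folded \<delta>_def], goal_cases)
        case (3 b\<^sub>1 n3)
        note b = 3
        have p': "\<bar>p () - ev d E \<delta> (\<lambda>x v. bell (v / R))\<bar> \<le> tol m (ev d E \<delta> (\<lambda>x v. bell (v / R)))"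
          using p(3)[of "()"] by (simp add: bell_nonneg abs_of_nonneg)
        have a': "\<bar>a u - ev d E \<delta> (\<lambda>x v. ip d u x * wt d u 0 x * tanh (v / R))\<bar> \<le> tol m 1"
          if "u \<in> set us" for u
        proof (rule order_trans[OF a(3)[OF that] tol_mono[OF m]])
          show "ev d E \<delta> (\<lambda>x v. \<bar>ip d u x * wt d u 0 x * tanh (v / R)\<bar>) \<le> 1"
          proof (rule ev_le_1[OF E(1)])
            show "(\<lambda>p. \<bar>ip d u (fst p) * wt d u 0 (fst p) * tanh (snd p / R)\<bar>) \<in> borel_measurable (lr_space d)"
              using query_measurable(2)[of d u 0 R] by measurable
          qed (simp add: coarse_query_bounds(2) del: abs_mult)
        qed
        have b': "\<bar>b\<^sub>1 u - ev d E \<delta> (\<lambda>x v. wt d u 0 x * bell (v / R))\<bar> \<le>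
          tol m (ev d E \<delta> (\<lambda>x v. wt d u 0 x * bell (v / R)))" if "u \<in> set us" for u
          using b(3)[OF that] by (simp add: abs_of_nonneg bell_nonneg less_imp_le[OF wt_pos])
        note coarse = ctx[folded \<delta>_def] p' a' b' refl
        define e where "e = (SOME e. consistent d us a b\<^sub>1 (2 * R) (2 * tol m 1) r e)"
        have e: "consistent d us a b\<^sub>1 (2 * R) (2 * tol m 1) r e"
          unfolding e_def by (rule someI[where P = "consistent d us a b\<^sub>1 (2 * R) (2 * tol m 1) r"])
            (rule coarse_consistent[OF coarse])
        show ?case
        proof (rule that[OF _ b(2), folded e_def])
          show "n = 2 + 4 * length us + n3" using p(1) a(1) b(1) by simp
          show "L2_set (\<lambda>i. \<beta> i - (c i + e i)) {..<d} \<le> min (2 * r) (5120 * R * \<alpha> * sqrt \<epsilon> / (\<kappa> * \<bar>p ()\<bar>))"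
            using coarse_error[OF coarse e] by (simp only: \<delta>_def diff_diff_add)
          \<comment> \<open>96 = 3 times 32 converts p \<ge> P / 32 into an upper bound 3 P \<le> q
            for the expectation of the fine queries; 480 is 96 times 5.\<close>
          show "3 * soft_mass E R \<le> 96 * \<bar>p ()\<bar>" "96 * \<bar>p ()\<bar> \<le> 480 * soft_mass E R"
            using p_ge[OF coarse] p_le[OF coarse] P0 by auto
          show "0 < min (2 * r) (5120 * R * \<alpha> * sqrt \<epsilon> / (\<kappa> * \<bar>p ()\<bar>))"
            by (rule r\<^sub>1_pos[OF coarse])
          show "min (2 * r) (5120 * R * \<alpha> * sqrt \<epsilon> / (\<kappa> * \<bar>p ()\<bar>)) \<le> 2 * r"
            by simp
          show "soft_mass E R * \<kappa> * min (2 * r) (5120 * R * \<alpha> * sqrt \<epsilon> / (\<kappa> * \<bar>p ()\<bar>)) \<le>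
              163840 * R * \<alpha> * sqrt \<epsilon>"
            by (rule soft_mass_mult_le[OF coarse])
        qed
      qed (rule query_measurable coarse_query_bounds)+
    qed (rule query_measurable coarse_query_bounds)+
  qed (rule query_measurable coarse_query_bounds)+
qed

lemma vstat_run_fine_step:
  assumes run: "vstat_run m (lr_dist d \<beta> E) (fine_step d m s \<mu> R c r\<^sub>1 q k) n b"
    and E: "real_distribution E" "\<alpha> \<le> measure E {0}" and d: "1 \<le> d"
    and \<alpha>: "0 < \<alpha>" "\<alpha> < 1" and \<epsilon>: "0 < \<epsilon>" "\<epsilon> < 1"
    and h: "0 < h" "h \<le> 1 / 4" "h ^ 8 = \<epsilon> * \<alpha>" and m_def: "m = real d / (\<epsilon> * \<alpha>\<^sup>2)"
    and r: "0 < r" and R_def: "R = r / h ^ 4" and c: "L2_set (\<lambda>i. \<beta> i - c i) {..<d} \<le> r\<^sub>1"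
    and r\<^sub>1: "0 < r\<^sub>1" "r\<^sub>1 \<le> 2 * r" and \<kappa>: "1 \<le> \<kappa>" "65536000 * \<mu> \<le> \<kappa>"
    and w: "good_weight d s \<mu> \<omega> L\<^sub>0" and s: "s = 0 \<or> 1 \<le> s" and \<mu>: "0 < \<mu>" "\<mu> \<le> 4"
    and \<omega>: "0 < \<omega>" "\<omega> \<le> 1" and hL: "L\<^sub>0 \<le> 1 / h ^ 4" and h\<omega>: "h \<le> \<omega> / 160000"
    and mass: "soft_mass E R * \<kappa> * r\<^sub>1 \<le> 163840 * R * \<alpha> * sqrt \<epsilon>"
    and q: "3 * soft_mass E R \<le> q" "q \<le> 480 * soft_mass E R"
  obtains c' n' where "n = 4 * d + n'" "vstat_run m (lr_dist d \<beta> E) (k c') n' b"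
    "L2_set (\<lambda>i. \<beta> i - c' i) {..<d} \<le> 640000 * ((2 + s) * \<mu> + 1) / \<omega> * h * r"
proof -
  note ctx = E d \<alpha> \<epsilon> h m_def
  have m: "0 < m" by (rule m_pos[OF ctx])
  have s0: "0 \<le> s" using s by auto
  define \<delta> where "\<delta> = (\<lambda>i. \<beta> i - c i)"
  define vs where "vs = map unit_vec [0..<d]"
  define R\<^sub>1 where "R\<^sub>1 = \<mu> * r\<^sub>1"
  have vs: "norming d 1 vs" unfolding vs_def by (rule norming_coords)
  have R16: "16 * r \<le> R" unfolding R_def by (rule scale_ge[OF ctx r])
  then have R0: "0 < R" using r by linarith
  have R\<^sub>1: "0 < R\<^sub>1" "R\<^sub>1 \<le> R"
  proof -
    show "0 < R\<^sub>1" using r\<^sub>1 \<mu> by (simp add: R\<^sub>1_def)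
    have "\<mu> * r\<^sub>1 \<le> 4 * (2 * r)" using \<mu> r\<^sub>1 r by (intro mult_mono) auto
    then show "R\<^sub>1 \<le> R" using R16 r by (simp add: R\<^sub>1_def)
  qed
  have bell_le: "ev d E \<delta> (\<lambda>x v. bell (v / R)) \<le> q"
  proof -
    \<comment> \<open>\<open>bell_ev_le\<close> holds for any vector of norm at most R / 8, but its
      setting also fixes one of norm at most r. Here \<delta> is only known to have norm at most 2
      r, so the zero vector fills that place.\<close>
    have "L2_set (\<lambda>_. 0 :: real) {..<d} \<le> r" using r by (simp add: L2_set_def)
    moreover have "L2_set \<delta> {..<d} \<le> R / 8" using c r\<^sub>1 R16 unfolding \<delta>_def by linarith
    ultimately show ?thesis using bell_ev_le[OF ctx r R_def _ vs order_refl] q by fastforce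
  qed
  note bounds = fine_query_bounds[OF s0 less_imp_le[OF R\<^sub>1(1)] R\<^sub>1(2) R0]
  show ?thesis
  proof (rule vstat_run_ask_lr[where F = "\<lambda>u x v. ip d u x * wt d u s x * (tanh (v / R\<^sub>1) - tanh (v / R))",
        OF run[unfolded fine_step_def, folded vs_def R\<^sub>1_def] E(1) m, folded \<delta>_def], goal_cases)
    case (3 a n1)
    note a = 3
    show ?case
    proof (rule vstat_run_ask_lr[where F = "\<lambda>u x v. wt d u s x * (bell (v / R\<^sub>1) - R\<^sub>1 / R * bell (v / R))",
        OF a(2) E(1) m, folded \<delta>_def], goal_cases)
      case (3 b\<^sub>1 n2)
      note b = 3
      have a': "\<bar>a u - ev d E \<delta> (\<lambda>x v. ip d u x * wt d u s x * (tanh (v / R\<^sub>1) - tanh (v / R)))\<bar> \<le> tol m q"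
        if "u \<in> set vs" for u
      proof (rule order_trans[OF a(3)[OF that] tol_mono[OF m order_trans[OF _ bell_le]]])
        show "ev d E \<delta> (\<lambda>x v. \<bar>ip d u x * wt d u s x * (tanh (v / R\<^sub>1) - tanh (v / R))\<bar>) \<le>
          ev d E \<delta> (\<lambda>x v. bell (v / R))"
        proof (rule ev_mono[OF E(1) _ _ query_measurable(1) coarse_query_bounds(1) fine_query_bounds'(1)[OF s0 R\<^sub>1]])
          show "(\<lambda>p. \<bar>ip d u (fst p) * wt d u s (fst p) * (tanh (snd p / R\<^sub>1) - tanh (snd p / R))\<bar>)
            \<in> borel_measurable (lr_space d)"
            using query_measurable(4)[of d u s R\<^sub>1 R] by measurable
          show "\<bar>\<bar>ip d u x * wt d u s x * (tanh (v / R\<^sub>1) - tanh (v / R))\<bar>\<bar> \<le> 1" for x v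
            unfolding abs_abs by (rule bounds)
        qed
      qed
      have b': "\<bar>b\<^sub>1 u - ev d E \<delta> (\<lambda>x v. wt d u s x * (bell (v / R\<^sub>1) - R\<^sub>1 / R * bell (v / R)))\<bar> \<le> tol m q"
        if "u \<in> set vs" for u
      proof (rule order_trans[OF b(3)[OF that] tol_mono[OF m order_trans[OF _ bell_le]]])
        show "ev d E \<delta> (\<lambda>x v. \<bar>wt d u s x * (bell (v / R\<^sub>1) - R\<^sub>1 / R * bell (v / R))\<bar>) \<le>
          ev d E \<delta> (\<lambda>x v. bell (v / R))"
        proof (rule ev_mono[OF E(1) _ _ query_measurable(1) coarse_query_bounds(1) fine_query_bounds'(2)[OF s0 R\<^sub>1]])
          show "(\<lambda>p. \<bar>wt d u s (fst p) * (bell (snd p / R\<^sub>1) - R\<^sub>1 / R * bell (snd p / R))\<bar>)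
            \<in> borel_measurable (lr_space d)"
            using query_measurable(5)[of d u s R\<^sub>1 R] by measurable
          show "\<bar>\<bar>wt d u s x * (bell (v / R\<^sub>1) - R\<^sub>1 / R * bell (v / R))\<bar>\<bar> \<le> 1" for x v
            unfolding abs_abs by (rule bounds)
        qed
      qed
      note fine = ctx r R_def c[folded \<delta>_def] r\<^sub>1 R\<^sub>1_def \<kappa> w s \<mu> \<omega> hL h\<omega> mass q vs refl refl a' b'
      let ?T = "tol m q * (1 + 1 / ((2 + s) * \<mu>))"
      define e where "e = (SOME e. consistent d vs a b\<^sub>1 ((2 + s) * R\<^sub>1) ?T r\<^sub>1 e)"
      have e: "consistent d vs a b\<^sub>1 ((2 + s) * R\<^sub>1) ?T r\<^sub>1 e"
        unfolding e_def by (rule someI[where P = "consistent d vs a b\<^sub>1 ((2 + s) * R\<^sub>1) ?T r\<^sub>1"])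
          (rule fine_consistent[OF fine])
      show ?case
      proof (rule that[OF _ b(2), folded e_def])
        show "n = 4 * d + n2" using a(1) b(1) by (simp add: vs_def)
        show "L2_set (\<lambda>i. \<beta> i - (c i + e i)) {..<d} \<le> 640000 * ((2 + s) * \<mu> + 1) / \<omega> * h * r"
          using fine_error[OF fine e] by (simp only: \<delta>_def diff_diff_add)
      qed
    qed (rule query_measurable bounds)+
  qed (rule query_measurable bounds)+
qed

section \<open>Iteration of the rounds and choice of the constants\<close>

primrec refine :: "((nat \<Rightarrow> real) \<Rightarrow> real \<Rightarrow> ((nat \<Rightarrow> real) \<Rightarrow> lr_alg) \<Rightarrow> lr_alg) \<Rightarrow> real \<Rightarrow> nat \<Rightarrow>
    (nat \<Rightarrow> real) \<Rightarrow> real \<Rightarrow> lr_alg" where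
  "refine step \<gamma> 0 c r = Return c"
| "refine step \<gamma> (Suc n) c r = step c r (\<lambda>c'. refine step \<gamma> n c' (\<gamma> * r))"

text \<open>The parameters \<kappa>, s, \<mu> and the directions vary with d; N,
  \<open>h\<^sub>0\<close> and \<Gamma> collect the uniform bounds, and only these reach the final
  constants.\<close>

definition admissible_params :: "nat \<Rightarrow> nat \<Rightarrow> real \<Rightarrow> real \<Rightarrow> real \<Rightarrow> real \<Rightarrow> real \<Rightarrow> (nat \<Rightarrow> real) list \<Rightarrow> bool" where
  "admissible_params d N h\<^sub>0 \<Gamma> \<kappa> s \<mu> us \<longleftrightarrow>
     norming d \<kappa> us \<and> length us \<le> N * d \<and> 1 \<le> \<kappa> \<and> 65536000 * \<mu> \<le> \<kappa> \<and> (s = 0 \<or> 1 \<le> s) \<and> 0 < \<mu> \<and> \<mu> \<le> 4 \<and>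
     (\<exists>\<omega> L\<^sub>0. good_weight d s \<mu> \<omega> L\<^sub>0 \<and> 0 < \<omega> \<and> \<omega> \<le> 1 \<and> h\<^sub>0 \<le> \<omega> / 160000 \<and> L\<^sub>0 * h\<^sub>0 \<le> 1 \<and>
       640000 * ((2 + s) * \<mu> + 1) / \<omega> \<le> \<Gamma>)"

text \<open>The condition 65536000 \<mu> \<le> \<kappa> is met in two ways. For d \<ge> \<kappa>^4
  the windows fit and \<kappa> \<ge> 262144000 pays for \<mu> = 4. For smaller d the coordinates
  give \<kappa> = 1, and a tilted weight permits \<mu> = 1 / 65536000.\<close>

lemma admissible_params_ex:
  "\<exists>N h\<^sub>0 \<Gamma>. 0 < h\<^sub>0 \<and> h\<^sub>0 \<le> 1 / 4 \<and> 0 < \<Gamma> \<and> (\<forall>d. \<exists>\<kappa> s \<mu> us. admissible_params d N h\<^sub>0 \<Gamma> \<kappa> s \<mu> us)"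
proof -
  obtain \<kappa> :: nat where \<kappa>: "262144000 \<le> \<kappa>" by blast
  define b where "b = \<kappa> ^ 4"
  define \<mu> :: real where "\<mu> = 1 / 65536000"
  obtain s \<omega>' L\<^sub>0 where low: "1 \<le> s" "0 < \<omega>'" "\<And>d. d < b \<Longrightarrow> good_weight d s \<mu> \<omega>' L\<^sub>0"
    using good_weight_low_ex[of \<mu> b] by (auto simp: \<mu>_def)
  define \<omega> where "\<omega> = min 1 \<omega>'"
  have \<omega>: "0 < \<omega>" "\<omega> \<le> 1" "\<omega> \<le> \<omega>'" using low by (auto simp: \<omega>_def)
  have low': "good_weight d s \<mu> \<omega> L\<^sub>0" if "d < b" for d
    using low(3)[OF that] \<omega>(3) unfolding good_weight_def by (blast intro: order_trans)
  \<comment> \<open>The entry 1 / 640000 is (1 / 4) / 160000, for the untilted weight with \<omega>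
    = 1 / 4; the other two serve the tilted weight.\<close>
  define h\<^sub>0 where "h\<^sub>0 = min (1 / 640000) (min (\<omega> / 160000) (1 / max 1 L\<^sub>0))"
  define \<Gamma> where "\<Gamma> = max (640000 * ((2 + s) * \<mu> + 1) / \<omega>) (640000 * ((2 + 0) * 4 + 1) / (1 / 4))"
  define N where "N = 2 ^ b + (1 :: nat)"
  have h0: "0 < h\<^sub>0" using \<omega> by (simp add: h\<^sub>0_def)
  have L0: "L\<^sub>0 * h\<^sub>0 \<le> 1"
  proof -
    have "L\<^sub>0 * h\<^sub>0 \<le> max 1 L\<^sub>0 * (1 / max 1 L\<^sub>0)"
      using h0 by (intro mult_mono) (auto simp: h\<^sub>0_def)
    also have "\<dots> = 1" using less_le_trans[OF zero_less_one max.cobounded1[of 1 L\<^sub>0]] by simp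
    finally show ?thesis .
  qed
  have "\<exists>\<kappa> s \<mu> us. admissible_params d N h\<^sub>0 \<Gamma> \<kappa> s \<mu> us" for d
  proof (cases "d < b")
    case True
    have "admissible_params d N h\<^sub>0 \<Gamma> 1 s \<mu> (map unit_vec [0..<d])"
      unfolding admissible_params_def
    proof (intro conjI exI)
      show "length (map unit_vec [0..<d]) \<le> N * d" by (simp add: N_def)
      show "good_weight d s \<mu> \<omega> L\<^sub>0" by (rule low'[OF True])
    qed (use norming_coords low \<omega> L0 in \<open>auto simp: \<mu>_def h\<^sub>0_def \<Gamma>_def\<close>)
    then show ?thesis by blast
  next
    case False
    then obtain us where us: "norming d (real \<kappa>) us" "length us \<le> (2 ^ (\<kappa> ^ 4) + 1) * d"
      using norming_windows[of \<kappa> d] \<kappa> unfolding b_def by fastforce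
    have "admissible_params d N h\<^sub>0 \<Gamma> \<kappa> 0 4 us"
      unfolding admissible_params_def
    proof (intro conjI exI)
      show "length us \<le> N * d" using us(2) by (simp add: N_def b_def)
      show "good_weight d 0 4 (1 / 4) 16" by (rule good_weight_high)
      show "norming d (real \<kappa>) us" by (rule us)
    qed (use \<kappa> in \<open>auto simp: h\<^sub>0_def \<Gamma>_def\<close>)
    then show ?thesis by blast
  qed
  moreover have "h\<^sub>0 \<le> 1 / 4" by (simp add: h\<^sub>0_def)
  moreover have "0 < \<Gamma>" by (simp add: \<Gamma>_def)
  ultimately show ?thesis using h0 by blast
qed

lemma sq_admissible_refine:
  assumes "\<And>c r k. 0 < r \<Longrightarrow> (\<And>c'. sq_admissible M (k c')) \<Longrightarrow> sq_admissible M (step c r k)"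
    and "0 < \<gamma>" "0 < r"
  shows "sq_admissible M (refine step \<gamma> n c r)"
  using assms(3)
proof (induction n arbitrary: c r)
  case (Suc n)
  have "0 < \<gamma> * r" using assms(2) Suc.prems by simp
  then show ?case using Suc by (simp add: assms(1))
qed simp

lemma vstat_run_refine:
  assumes step: "\<And>c r k n b. vstat_run m D (step c r k) n b \<Longrightarrow> 0 < r \<Longrightarrow> L2_set (\<lambda>i. \<beta> i - c i) A \<le> r \<Longrightarrow>
      \<exists>c' n'. n \<le> N + n' \<and> vstat_run m D (k c') n' b \<and> L2_set (\<lambda>i. \<beta> i - c' i) A \<le> \<gamma> * r"
    and \<gamma>: "0 < \<gamma>" and "0 < r" "vstat_run m D (refine step \<gamma> j c r) n b" "L2_set (\<lambda>i. \<beta> i - c i) A \<le> r"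
  shows "n \<le> j * N \<and> L2_set (\<lambda>i. \<beta> i - b i) A \<le> \<gamma> ^ j * r"
  using assms(3-5)
proof (induction j arbitrary: c r n)
  case 0
  then show ?case by (auto elim: vstat_run_ReturnE)
next
  case (Suc j)
  from Suc.prems(2) have "vstat_run m D (step c r (\<lambda>c'. refine step \<gamma> j c' (\<gamma> * r))) n b" by simp
  from step[OF this Suc.prems(1,3)] obtain c' n' where
    c': "n \<le> N + n'" "vstat_run m D (refine step \<gamma> j c' (\<gamma> * r)) n' b" "L2_set (\<lambda>i. \<beta> i - c' i) A \<le> \<gamma> * r"
    by blast
  have "0 < \<gamma> * r" using \<gamma> Suc.prems(1) by simp
  from Suc.IH[OF this c'(2,3)] c'(1) show ?case by (simp add: mult_ac)
qed

theorem theoremE1: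
  "\<exists>(C::real) (p::nat poly) (A :: nat \<Rightarrow> real \<Rightarrow> real \<Rightarrow> ((nat \<Rightarrow> real) \<times> real, nat \<Rightarrow> real) sq_alg).
     C > 0 \<and>
     (\<forall>d\<ge>1. \<forall>\<alpha>\<in>{0<..<1}. \<forall>\<epsilon>\<in>{0<..<1}.
        sq_admissible (lr_space d) (A d \<alpha> \<epsilon>) \<and>
        (\<forall>\<beta> E. L2_set \<beta> {..<d} \<le> 1 \<longrightarrow> real_distribution E \<longrightarrow> measure E {0} \<ge> \<alpha> \<longrightarrow>
           (\<forall>n b. vstat_run (real d / (\<epsilon> * \<alpha>\<^sup>2)) (lr_dist d \<beta> E) (A d \<alpha> \<epsilon>) n b \<longrightarrow>
              n \<le> poly p d \<and> L2_set (\<lambda>i. b i - \<beta> i) {..<d} \<le> C * (\<epsilon> * \<alpha>))))"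
proof -
  obtain N h\<^sub>0 \<Gamma> where h\<^sub>0: "0 < h\<^sub>0" "h\<^sub>0 \<le> 1 / 4" and \<Gamma>: "0 < \<Gamma>" and
    "\<forall>d. \<exists>\<kappa> s \<mu> us. admissible_params d N h\<^sub>0 \<Gamma> \<kappa> s \<mu> us"
    using admissible_params_ex by blast
  then obtain \<kappa> s \<mu> us where par: "\<And>d. admissible_params d N h\<^sub>0 \<Gamma> (\<kappa> d) (s d) (\<mu> d) (us d)"
    by metis
  define A where "A d \<alpha> \<epsilon> =
    (let h = root 8 (\<epsilon> * \<alpha>) in
     if h \<le> h\<^sub>0 then refine (refine_step d \<alpha> \<epsilon> h (\<kappa> d) (s d) (\<mu> d) (us d)) (\<Gamma> * h) 8 (\<lambda>_. 0) 1
     else Return (\<lambda>_. 0))" for d \<alpha> \<epsilon>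
  \<comment> \<open>\<Gamma>^8 accounts for eight rounds when h \<le> \<open>h\<^sub>0\<close>.
    Otherwise \<epsilon> \<alpha> > \<open>h\<^sub>0\<close>^8, and the output 0, whose error is at
    most 1, is covered by 1 / \<open>h\<^sub>0\<close>^8.\<close>
  define C where "C = max (\<Gamma> ^ 8) (1 / h\<^sub>0 ^ 8)"
  \<comment> \<open>A round makes 2 queries for the noise mass, 4 per direction in the coarse step
    and 4 d in the fine step. Eight rounds with at most N d directions give 16 + 8 (4 N + 4)
    d.\<close>
  define p where "p = [: 16, 8 * (4 * N + 4) :]"
  have C: "0 < C" using \<Gamma> by (simp add: C_def less_max_iff_disj)
  have "sq_admissible (lr_space d) (A d \<alpha> \<epsilon>) \<and>
        (\<forall>\<beta> E. L2_set \<beta> {..<d} \<le> 1 \<longrightarrow> real_distribution E \<longrightarrow> measure E {0} \<ge> \<alpha> \<longrightarrow>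
           (\<forall>n b. vstat_run (real d / (\<epsilon> * \<alpha>\<^sup>2)) (lr_dist d \<beta> E) (A d \<alpha> \<epsilon>) n b \<longrightarrow>
              n \<le> poly p d \<and> L2_set (\<lambda>i. b i - \<beta> i) {..<d} \<le> C * (\<epsilon> * \<alpha>)))"
    if d: "1 \<le> d" and \<alpha>: "\<alpha> \<in> {0<..<1}" and \<epsilon>: "\<epsilon> \<in> {0<..<1}" for d \<alpha> \<epsilon>
  proof (intro conjI allI impI)
    define h where "h = root 8 (\<epsilon> * \<alpha>)"
    have \<alpha>: "0 < \<alpha>" "\<alpha> < 1" and \<epsilon>: "0 < \<epsilon>" "\<epsilon> < 1" using \<alpha> \<epsilon> by auto
    have h: "0 < h" "h ^ 8 = \<epsilon> * \<alpha>" using \<alpha> \<epsilon> by (auto simp: h_def)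
    obtain \<omega> L\<^sub>0 where par': "norming d (\<kappa> d) (us d)" "length (us d) \<le> N * d" "1 \<le> \<kappa> d" "65536000 * \<mu> d \<le> \<kappa> d"
      "s d = 0 \<or> 1 \<le> s d" "0 < \<mu> d" "\<mu> d \<le> 4" "good_weight d (s d) (\<mu> d) \<omega> L\<^sub>0" "0 < \<omega>" "\<omega> \<le> 1"
      "h\<^sub>0 \<le> \<omega> / 160000" "L\<^sub>0 * h\<^sub>0 \<le> 1" "640000 * ((2 + s d) * \<mu> d + 1) / \<omega> \<le> \<Gamma>"
      using par[of d] unfolding admissible_params_def by blast
    let ?step = "refine_step d \<alpha> \<epsilon> h (\<kappa> d) (s d) (\<mu> d) (us d)"
    have A: "A d \<alpha> \<epsilon> = (if h \<le> h\<^sub>0 then refine ?step (\<Gamma> * h) 8 (\<lambda>_. 0) 1 else Return (\<lambda>_. 0))"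
      by (simp add: A_def h_def Let_def)
    show "sq_admissible (lr_space d) (A d \<alpha> \<epsilon>)"
    proof (cases "h \<le> h\<^sub>0")
      case True
      have "sq_admissible (lr_space d) (refine ?step (\<Gamma> * h) 8 (\<lambda>_. 0) 1)"
        using par' h h\<^sub>0 True \<alpha> \<epsilon> \<Gamma> by (intro sq_admissible_refine sq_admissible_refine_step) auto
      then show ?thesis using True by (simp add: A)
    qed (simp add: A)
    fix \<beta> E n b
    assume \<beta>: "L2_set \<beta> {..<d} \<le> 1" and E: "real_distribution E" "\<alpha> \<le> measure E {0}"
      and run: "vstat_run (real d / (\<epsilon> * \<alpha>\<^sup>2)) (lr_dist d \<beta> E) (A d \<alpha> \<epsilon>) n b"
    have "n \<le> poly p d \<and> L2_set (\<lambda>i. \<beta> i - b i) {..<d} \<le> C * (\<epsilon> * \<alpha>)"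
    proof (cases "h \<le> h\<^sub>0")
      case True
      have hL: "L\<^sub>0 \<le> 1 / h ^ 4"
      proof (cases "L\<^sub>0 \<le> 0")
        case True
        also have "0 \<le> 1 / h ^ 4" using h by simp
        finally show ?thesis .
      next
        case False
        have "h ^ 4 \<le> h ^ 1" using h h\<^sub>0 True by (intro power_decreasing) auto
        then have "L\<^sub>0 * h ^ 4 \<le> L\<^sub>0 * h\<^sub>0" using True False by (intro mult_left_mono) auto
        then show ?thesis using par'(12) h by (simp add: pos_le_divide_eq)
      qed
      have h4: "h \<le> 1 / 4" and h\<omega>: "h \<le> \<omega> / 160000" using True h\<^sub>0 par'(11) by linarith+
      have run': "vstat_run (real d / (\<epsilon> * \<alpha>\<^sup>2)) (lr_dist d \<beta> E) (refine ?step (\<Gamma> * h) 8 (\<lambda>_. 0) 1) n b"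
        using run True by (simp add: A)
      have "n \<le> 8 * (2 + 4 * (N * d) + 4 * d) \<and> L2_set (\<lambda>i. \<beta> i - b i) {..<d} \<le> (\<Gamma> * h) ^ 8 * 1"
      proof (rule vstat_run_refine[OF _ _ _ run'])
        fix c r k n b
        assume st: "vstat_run (real d / (\<epsilon> * \<alpha>\<^sup>2)) (lr_dist d \<beta> E) (?step c r k) n b"
          and r: "0 < r" and c: "L2_set (\<lambda>i. \<beta> i - c i) {..<d} \<le> r"
        note ctx = E d \<alpha> \<epsilon> h(1) h4 h(2) refl r refl
        obtain c\<^sub>1 r\<^sub>1 q n1 where c1: "n = 2 + 4 * length (us d) + n1"
          "vstat_run (real d / (\<epsilon> * \<alpha>\<^sup>2)) (lr_dist d \<beta> E)
            (fine_step d (real d / (\<epsilon> * \<alpha>\<^sup>2)) (s d) (\<mu> d) (r / h ^ 4) c\<^sub>1 r\<^sub>1 q k) n1 b"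
          "L2_set (\<lambda>i. \<beta> i - c\<^sub>1 i) {..<d} \<le> r\<^sub>1" "0 < r\<^sub>1" "r\<^sub>1 \<le> 2 * r"
          "soft_mass E (r / h ^ 4) * \<kappa> d * r\<^sub>1 \<le> 163840 * (r / h ^ 4) * \<alpha> * sqrt \<epsilon>"
          "3 * soft_mass E (r / h ^ 4) \<le> q" "q \<le> 480 * soft_mass E (r / h ^ 4)"
          by (rule vstat_run_coarse_step[OF st[unfolded refine_step_def] ctx c par'(1,3)])
        obtain c' n' where c': "n1 = 4 * d + n'"
          "vstat_run (real d / (\<epsilon> * \<alpha>\<^sup>2)) (lr_dist d \<beta> E) (k c') n' b"
          "L2_set (\<lambda>i. \<beta> i - c' i) {..<d} \<le> 640000 * ((2 + s d) * \<mu> d + 1) / \<omega> * h * r"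
          by (rule vstat_run_fine_step[OF c1(2) ctx c1(3-5) par'(3,4,8,5,6,7,9,10) hL h\<omega> c1(6-8)])
        have "640000 * ((2 + s d) * \<mu> d + 1) / \<omega> * h * r \<le> \<Gamma> * h * r"
          using par'(13) h r by (intro mult_right_mono) auto
        then show "\<exists>c' n'. n \<le> 2 + 4 * (N * d) + 4 * d + n' \<and>
            vstat_run (real d / (\<epsilon> * \<alpha>\<^sup>2)) (lr_dist d \<beta> E) (k c') n' b \<and>
            L2_set (\<lambda>i. \<beta> i - c' i) {..<d} \<le> \<Gamma> * h * r"
          using c1(1) c' par'(2) by (intro exI[of _ c'] exI[of _ n']) auto
      qed (use \<Gamma> h \<beta> in auto)
      moreover have "8 * (2 + 4 * (N * d) + 4 * d) = poly p d" by (simp add: p_def algebra_simps)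
      moreover have "(\<Gamma> * h) ^ 8 * 1 \<le> C * (\<epsilon> * \<alpha>)"
        unfolding power_mult_distrib h(2) using \<alpha> \<epsilon> by (simp add: C_def mult_right_mono)
      ultimately show ?thesis by linarith
    next
      case False
      then have "n = 0" "b = (\<lambda>_. 0)" using run by (auto simp: A elim: vstat_run_ReturnE)
      have "h\<^sub>0 ^ 8 \<le> \<epsilon> * \<alpha>" using False h\<^sub>0 unfolding h(2)[symmetric] by (intro power_mono) auto
      then have "1 \<le> 1 / h\<^sub>0 ^ 8 * (\<epsilon> * \<alpha>)" using h\<^sub>0 by (simp add: pos_le_divide_eq)
      also have "\<dots> \<le> C * (\<epsilon> * \<alpha>)" using \<alpha> \<epsilon> by (intro mult_right_mono) (auto simp: C_def)
      finally show ?thesis using \<beta> \<open>n = 0\<close> \<open>b = (\<lambda>_. 0)\<close> by simp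
    qed
    moreover have "L2_set (\<lambda>i. b i - \<beta> i) {..<d} = L2_set (\<lambda>i. \<beta> i - b i) {..<d}"
      by (simp add: L2_set_def power2_commute)
    ultimately show "n \<le> poly p d" "L2_set (\<lambda>i. b i - \<beta> i) {..<d} \<le> C * (\<epsilon> * \<alpha>)" by simp_all
  qed
  then show ?thesis using C by blast
qed

end
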